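(* (In $\mathbf{ACA}_0$.) Assume that every coded normal dilator has a well-founded fixed point. Then every instance of $\Pi^1_1$-induction along the natural numbers holds.
   Context: The category of natural numbers has as objects the finite orders $n=\{0,\dots,n-1\}$ and as morphisms the strictly increasing maps. For a finite linear order $a$ let $|a|$ be its cardinality and $\operatorname{en}_a:|a|\to a$ its increasing enumeration; for an embedding $f:a\to b$ of finite orders let $|f|$ be the unique map with $f\circ\operatorname{en}_a=\operatorname{en}_b\circ|f|$. $[X]^{<\omega}$ is the set of finite subsets of $X$, $[f]^{<\omega}(a)=f[a]$. A coded prae-dilator consists of (1) a functor $T$ from the category of natural numbers to linear orders, each $T(n)$ with field a subset of $\mathbb N$, and (2) a natural transformation $\operatorname{supp}^T:T\Rightarrow[\cdot]^{<\omega}$ such that each $\sigma\in T(n)$ lies in the range of $T(\iota_\sigma\circ\operatorname{en}_\sigma)$, where $\iota_\sigma\circ\operatorname{en}_\sigma:|\operatorname{supp}^T_n(\sigma)|\to n$ is the unique embedding with range $\operatorname{supp}^T_n(\sigma)$. For a linear order $X$, $D^T(X)$ is the set of pairs $\langle a,\sigma\rangle$ with $a\in[X]^{<\omega}$, $\sigma\in T(|a|)$, $\operatorname{supp}^T_{|a|}(\sigma)=|a|$, ordered by $\langle a,\sigma\rangle<\langle b,\tau\rangle$ iff $T(|\iota_a^{a\cup b}|)(\sigma)<T(|\iota_b^{a\cup b}|)(\tau)$ ($\iota$ the inclusions into $a\cup b$). A coded dilator is a coded prae-dilator with $D^T(X)$ well-founded for every well-order $X\subseteq\mathbb N$. A normal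 (prae-)dilator additionally has a natural family of embeddings $\mu^T_n:n\to T(n)$ with $\sigma<_{T(n)}\mu^T_n(m)\iff\operatorname{supp}^T_n(\sigma)\subseteq\{0,\dots,m-1\}$ for all $m<n$, $\sigma\in T(n)$. A fixed point of $T$ is a linear order $X$ with an order embedding $\xi:D^T(X)\to X$; it is well-founded if $X$ is. *)

theory Defs
  imports Main "HOL-Library.FuncSet"
begin

section \<open>Second-order arithmetic and models of \<open>ACA\<^sub>0\<close>\<close>

text \<open>
  Structures for the two-sorted language of second-order arithmetic, with Henkin semantics:
  the first-order part is the whole type \<open>'a\<close> (possibly nonstandard), the second-order part
  is a collection of subsets of it.
\<close>

record 'a l2_structure =
  Zer :: 'a
  One :: 'a
  Add :: "'a \<Rightarrow> 'a \<Rightarrow> 'a"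
  Mul :: "'a \<Rightarrow> 'a \<Rightarrow> 'a"
  Less :: "'a \<Rightarrow> 'a \<Rightarrow> bool"
  Sets :: "'a set set"

datatype l2_term = NVar nat | TZer | TOne | TAdd l2_term l2_term | TMul l2_term l2_term

datatype l2_formula =
    FEq l2_term l2_term
  | FLess l2_term l2_term
  | FMem l2_term nat
  | FNeg l2_formula
  | FConj l2_formula l2_formula
  | FAll nat l2_formula
  | FAllSet nat l2_formula

primrec l2_val :: "'a l2_structure \<Rightarrow> (nat \<Rightarrow> 'a) \<Rightarrow> l2_term \<Rightarrow> 'a" where
  "l2_val M e (NVar i) = e i"
| "l2_val M e TZer = Zer M"
| "l2_val M e TOne = One M"
| "l2_val M e (TAdd s t) = Add M (l2_val M e s) (l2_val M e t)"
| "l2_val M e (TMul s t) = Mul M (l2_val M e s) (l2_val M e t)"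

primrec l2_sat :: "'a l2_structure \<Rightarrow> (nat \<Rightarrow> 'a) \<Rightarrow> (nat \<Rightarrow> 'a set) \<Rightarrow> l2_formula \<Rightarrow> bool" where
  "l2_sat M e E (FEq s t) \<longleftrightarrow> l2_val M e s = l2_val M e t"
| "l2_sat M e E (FLess s t) \<longleftrightarrow> Less M (l2_val M e s) (l2_val M e t)"
| "l2_sat M e E (FMem t i) \<longleftrightarrow> l2_val M e t \<in> E i"
| "l2_sat M e E (FNeg \<phi>) \<longleftrightarrow> \<not> l2_sat M e E \<phi>"
| "l2_sat M e E (FConj \<phi> \<psi>) \<longleftrightarrow> l2_sat M e E \<phi> \<and> l2_sat M e E \<psi>"
| "l2_sat M e E (FAll i \<phi>) \<longleftrightarrow> (\<forall>x. l2_sat M (e(i := x)) E \<phi>)"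
| "l2_sat M e E (FAllSet i \<phi>) \<longleftrightarrow> (\<forall>X\<in>Sets M. l2_sat M e (E(i := X)) \<phi>)"

text \<open>Arithmetical formulas have no set quantifiers but may contain free set variables.\<close>

primrec arithmetical :: "l2_formula \<Rightarrow> bool" where
  "arithmetical (FEq s t) \<longleftrightarrow> True"
| "arithmetical (FLess s t) \<longleftrightarrow> True"
| "arithmetical (FMem t i) \<longleftrightarrow> True"
| "arithmetical (FNeg \<phi>) \<longleftrightarrow> arithmetical \<phi>"
| "arithmetical (FConj \<phi> \<psi>) \<longleftrightarrow> arithmetical \<phi> \<and> arithmetical \<psi>"
| "arithmetical (FAll i \<phi>) \<longleftrightarrow> arithmetical \<phi>"
| "arithmetical (FAllSet i \<phi>) \<longleftrightarrow> False"

definition Pi11 :: "l2_formula \<Rightarrow> bool" where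
  "Pi11 \<phi> \<longleftrightarrow> (\<exists>i \<theta>. \<phi> = FAllSet i \<theta> \<and> arithmetical \<theta>)"

definition basic_axioms :: "'a l2_structure \<Rightarrow> bool" where
  "basic_axioms M \<longleftrightarrow>
     (\<forall>n. Add M n (One M) \<noteq> Zer M) \<and>
     (\<forall>m n. Add M m (One M) = Add M n (One M) \<longrightarrow> m = n) \<and>
     (\<forall>m. Add M m (Zer M) = m) \<and>
     (\<forall>m n. Add M m (Add M n (One M)) = Add M (Add M m n) (One M)) \<and>
     (\<forall>m. Mul M m (Zer M) = Zer M) \<and>
     (\<forall>m n. Mul M m (Add M n (One M)) = Add M (Mul M m n) m) \<and>
     (\<forall>m. \<not> Less M m (Zer M)) \<and>
     (\<forall>m n. Less M m (Add M n (One M)) \<longleftrightarrow> Less M m n \<or> m = n)"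

definition induction_axiom :: "'a l2_structure \<Rightarrow> bool" where
  "induction_axiom M \<longleftrightarrow>
     (\<forall>X\<in>Sets M. Zer M \<in> X \<and> (\<forall>n. n \<in> X \<longrightarrow> Add M n (One M) \<in> X) \<longrightarrow> (\<forall>n. n \<in> X))"

definition arithmetical_comprehension :: "'a l2_structure \<Rightarrow> bool" where
  "arithmetical_comprehension M \<longleftrightarrow>
     (\<forall>\<phi> v e E. arithmetical \<phi> \<longrightarrow> range E \<subseteq> Sets M \<longrightarrow> {n. l2_sat M (e(v := n)) E \<phi>} \<in> Sets M)"

definition models_ACA0 :: "'a l2_structure \<Rightarrow> bool" where
  "models_ACA0 M \<longleftrightarrow> Sets M \<noteq> {} \<and> basic_axioms M \<and> induction_axiom M \<and> arithmetical_comprehension M"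

text \<open>
  The induction axiom for \<open>\<phi>\<close> in the number variable \<open>v\<close>, with all other free variables of
  \<open>\<phi>\<close> as parameters (universal closure).
\<close>

definition holds_induction :: "'a l2_structure \<Rightarrow> l2_formula \<Rightarrow> nat \<Rightarrow> bool" where
  "holds_induction M \<phi> v \<longleftrightarrow>
     (\<forall>e E. range E \<subseteq> Sets M \<longrightarrow>
        l2_sat M (e(v := Zer M)) E \<phi> \<and>
        (\<forall>n. l2_sat M (e(v := n)) E \<phi> \<longrightarrow> l2_sat M (e(v := Add M n (One M))) E \<phi>) \<longrightarrow>
        (\<forall>n. l2_sat M (e(v := n)) E \<phi>))"


section \<open>Coding inside a structure\<close>

text \<open>
  From here on every notion is relative to a structure \<open>M\<close>: number quantifiers range over
  \<open>'a\<close>, and every infinite object that is quantified over is required to be coded by an element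
  of \<open>Sets M\<close>.  Relations and functions are written as HOL relations and functions; the
  values of a function outside its intended domain are never used.
\<close>

definition below :: "'a l2_structure \<Rightarrow> 'a \<Rightarrow> 'a set" where
  "below M n = {i. Less M i n}"

definition nat_le :: "'a l2_structure \<Rightarrow> 'a rel" where
  "nat_le M = {(i, j). Less M i j \<or> i = j}"

text \<open>The pairing function \<open>(i + j)\<^sup>2 + i\<close>.\<close>

definition pr :: "'a l2_structure \<Rightarrow> 'a \<Rightarrow> 'a \<Rightarrow> 'a" where
  "pr M i j = Add M (Mul M (Add M i j) (Add M i j)) i"

definition l2_dvd :: "'a l2_structure \<Rightarrow> 'a \<Rightarrow> 'a \<Rightarrow> bool" where
  "l2_dvd M d n \<longleftrightarrow> (\<exists>q. n = Mul M d q)"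

text \<open>
  Finite sets of numbers are coded by numbers via the beta function: the triple
  \<open>(k, (m, n))\<close> codes the set of all \<open>i < k\<close> such that \<open>m (i + 1) + 1\<close> divides \<open>n\<close>.  The
  canonical code of a finite set is its least code.
\<close>

definition elts :: "'a l2_structure \<Rightarrow> 'a \<Rightarrow> 'a set" where
  "elts M a = {i. \<exists>k m n. a = pr M k (pr M m n) \<and> Less M i k \<and>
     l2_dvd M (Add M (Mul M m (Add M i (One M))) (One M)) n}"

definition fin :: "'a l2_structure \<Rightarrow> 'a set \<Rightarrow> bool" where
  "fin M A \<longleftrightarrow> (\<exists>a. elts M a = A)"

definition fcode :: "'a l2_structure \<Rightarrow> 'a set \<Rightarrow> 'a" where
  "fcode M A = (THE a. elts M a = A \<and> (\<forall>b. Less M b a \<longrightarrow> elts M b \<noteq> A))"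

definition fgraph :: "'a l2_structure \<Rightarrow> 'a \<Rightarrow> ('a \<Rightarrow> 'a) \<Rightarrow> 'a set" where
  "fgraph M n f = {pr M i (f i) | i. i \<in> below M n}"

definition fcard :: "'a l2_structure \<Rightarrow> 'a set \<Rightarrow> 'a" where
  "fcard M A = (THE n. \<exists>f. bij_betw f (below M n) A \<and> fin M (fgraph M n f))"


section \<open>Linear orders\<close>

text \<open>Orders are reflexive relations; the field of a linear order may be empty.\<close>

definition lt :: "'a rel \<Rightarrow> 'a \<Rightarrow> 'a \<Rightarrow> bool" where
  "lt r x y \<longleftrightarrow> (x, y) \<in> r \<and> x \<noteq> y"

definition order_embedding :: "'a rel \<Rightarrow> 'a rel \<Rightarrow> ('a \<Rightarrow> 'a) \<Rightarrow> bool" where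
  "order_embedding r s f \<longleftrightarrow> f ` Field r \<subseteq> Field s \<and>
     (\<forall>x\<in>Field r. \<forall>y\<in>Field r. (x, y) \<in> r \<longleftrightarrow> (f x, f y) \<in> s)"

definition coded_linear_order :: "'a l2_structure \<Rightarrow> 'a rel \<Rightarrow> bool" where
  "coded_linear_order M r \<longleftrightarrow> Linear_order r \<and> {pr M x y | x y. (x, y) \<in> r} \<in> Sets M"

definition well_founded :: "'a l2_structure \<Rightarrow> 'a rel \<Rightarrow> bool" where
  "well_founded M r \<longleftrightarrow>
     \<not> (\<exists>s. {pr M i (s i) | i. True} \<in> Sets M \<and> (\<forall>i. lt r (s (Add M i (One M))) (s i)))"

definition coded_well_order :: "'a l2_structure \<Rightarrow> 'a rel \<Rightarrow> bool" where
  "coded_well_order M r \<longleftrightarrow> coded_linear_order M r \<and> well_founded M r"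

text \<open>
  The increasing enumeration of a finite suborder \<open>A\<close> of \<open>r\<close>, and the map
  \<open>|f| : |A| \<rightarrow> |B|\<close> induced by \<open>f : A \<rightarrow> B\<close>.  Extensionality only serves to make the
  descriptions unique.
\<close>

definition enum :: "'a l2_structure \<Rightarrow> 'a rel \<Rightarrow> 'a set \<Rightarrow> 'a \<Rightarrow> 'a" where
  "enum M r A = (THE f. f \<in> extensional (below M (fcard M A)) \<and>
     bij_betw f (below M (fcard M A)) A \<and> fin M (fgraph M (fcard M A) f) \<and>
     (\<forall>i\<in>below M (fcard M A). \<forall>j\<in>below M (fcard M A). Less M i j \<longrightarrow> lt r (f i) (f j)))"

definition fmap :: "'a l2_structure \<Rightarrow> 'a rel \<Rightarrow> 'a set \<Rightarrow> 'a set \<Rightarrow> ('a \<Rightarrow> 'a) \<Rightarrow> 'a \<Rightarrow> 'a" where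
  "fmap M r A B f = (THE g. g \<in> below M (fcard M A) \<rightarrow>\<^sub>E below M (fcard M B) \<and>
     (\<forall>i\<in>below M (fcard M A). f (enum M r A i) = enum M r B (g i)))"


section \<open>Coded prae-dilators\<close>

text \<open>Morphisms \<open>n \<rightarrow> m\<close> of the category of natural numbers.\<close>

definition nat_mor :: "'a l2_structure \<Rightarrow> 'a \<Rightarrow> 'a \<Rightarrow> ('a \<Rightarrow> 'a) \<Rightarrow> bool" where
  "nat_mor M n m f \<longleftrightarrow> f \<in> below M n \<rightarrow> below M m \<and>
     (\<forall>i\<in>below M n. \<forall>j\<in>below M n. Less M i j \<longrightarrow> Less M (f i) (f j)) \<and> fin M (fgraph M n f)"

text \<open>
  \<open>Ord T n\<close> is the order \<open>T(n)\<close>, and \<open>Supp T n \<sigma>\<close> is the support of \<open>\<sigma> \<in> T(n)\<close>.  The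
  action on morphisms takes the code of the graph of a morphism; \<open>act M T n m f\<close> is
  \<open>T(f) : T(n) \<rightarrow> T(m)\<close>.
\<close>

record 'a praedilator =
  Ord :: "'a \<Rightarrow> 'a rel"
  Mor :: "'a \<Rightarrow> 'a \<Rightarrow> 'a \<Rightarrow> 'a \<Rightarrow> 'a"
  Supp :: "'a \<Rightarrow> 'a \<Rightarrow> 'a set"

abbreviation Fld :: "('a, 'b) praedilator_scheme \<Rightarrow> 'a \<Rightarrow> 'a set" where
  "Fld T n \<equiv> Field (Ord T n)"

definition act ::
  "'a l2_structure \<Rightarrow> ('a, 'b) praedilator_scheme \<Rightarrow> 'a \<Rightarrow> 'a \<Rightarrow> ('a \<Rightarrow> 'a) \<Rightarrow> 'a \<Rightarrow> 'a" where
  "act M T n m f = Mor T n m (fcode M (fgraph M n f))"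

definition praedilator_coded :: "'a l2_structure \<Rightarrow> ('a, 'b) praedilator_scheme \<Rightarrow> bool" where
  "praedilator_coded M T \<longleftrightarrow>
     {pr M n (pr M \<sigma> \<tau>) | n \<sigma> \<tau>. (\<sigma>, \<tau>) \<in> Ord T n} \<in> Sets M \<and>
     {pr M (pr M n (pr M m (fcode M (fgraph M n f)))) (pr M \<sigma> (act M T n m f \<sigma>)) | n m f \<sigma>.
        nat_mor M n m f \<and> \<sigma> \<in> Fld T n} \<in> Sets M \<and>
     {pr M n (pr M \<sigma> (fcode M (Supp T n \<sigma>))) | n \<sigma>. \<sigma> \<in> Fld T n} \<in> Sets M"

definition nat_functor :: "'a l2_structure \<Rightarrow> ('a, 'b) praedilator_scheme \<Rightarrow> bool" where
  "nat_functor M T \<longleftrightarrow>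
     (\<forall>n. Linear_order (Ord T n)) \<and>
     (\<forall>n m f. nat_mor M n m f \<longrightarrow> order_embedding (Ord T n) (Ord T m) (act M T n m f)) \<and>
     (\<forall>n. \<forall>\<sigma>\<in>Fld T n. act M T n n (\<lambda>i. i) \<sigma> = \<sigma>) \<and>
     (\<forall>n m k f g. nat_mor M n m f \<and> nat_mor M m k g \<longrightarrow>
        (\<forall>\<sigma>\<in>Fld T n. act M T n k (g \<circ> f) \<sigma> = act M T m k g (act M T n m f \<sigma>)))"

definition supports :: "'a l2_structure \<Rightarrow> ('a, 'b) praedilator_scheme \<Rightarrow> bool" where
  "supports M T \<longleftrightarrow>
     (\<forall>n. \<forall>\<sigma>\<in>Fld T n. Supp T n \<sigma> \<subseteq> below M n \<and> fin M (Supp T n \<sigma>)) \<and>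
     (\<forall>n m f. nat_mor M n m f \<longrightarrow>
        (\<forall>\<sigma>\<in>Fld T n. Supp T m (act M T n m f \<sigma>) = f ` Supp T n \<sigma>)) \<and>
     (\<forall>n. \<forall>\<sigma>\<in>Fld T n.
        \<sigma> \<in> act M T (fcard M (Supp T n \<sigma>)) n (enum M (nat_le M) (Supp T n \<sigma>))
             ` Fld T (fcard M (Supp T n \<sigma>)))"

definition coded_praedilator :: "'a l2_structure \<Rightarrow> ('a, 'b) praedilator_scheme \<Rightarrow> bool" where
  "coded_praedilator M T \<longleftrightarrow> praedilator_coded M T \<and> nat_functor M T \<and> supports M T"


section \<open>The order \<open>D\<^sup>T(X)\<close>, dilators, normality and fixed points\<close>

definition D_pairs ::
  "'a l2_structure \<Rightarrow> ('a, 'b) praedilator_scheme \<Rightarrow> 'a rel \<Rightarrow> ('a set \<times> 'a) set" where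
  "D_pairs M T X = {(A, \<sigma>). fin M A \<and> A \<subseteq> Field X \<and> \<sigma> \<in> Fld T (fcard M A) \<and>
     Supp T (fcard M A) \<sigma> = below M (fcard M A)}"

definition D_less ::
  "'a l2_structure \<Rightarrow> ('a, 'b) praedilator_scheme \<Rightarrow> 'a rel \<Rightarrow> 'a set \<times> 'a \<Rightarrow> 'a set \<times> 'a \<Rightarrow> bool" where
  "D_less M T X p q = (case p of (A, \<sigma>) \<Rightarrow> case q of (B, \<tau>) \<Rightarrow>
     lt (Ord T (fcard M (A \<union> B)))
       (act M T (fcard M A) (fcard M (A \<union> B)) (fmap M X A (A \<union> B) (\<lambda>x. x)) \<sigma>)
       (act M T (fcard M B) (fcard M (A \<union> B)) (fmap M X B (A \<union> B) (\<lambda>x. x)) \<tau>))"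

definition D_code :: "'a l2_structure \<Rightarrow> 'a set \<times> 'a \<Rightarrow> 'a" where
  "D_code M p = pr M (fcode M (fst p)) (snd p)"

text \<open>The reflexive closure of the strict order on \<open>D\<^sup>T(X)\<close>, as a relation on codes.\<close>

definition D_ord :: "'a l2_structure \<Rightarrow> ('a, 'b) praedilator_scheme \<Rightarrow> 'a rel \<Rightarrow> 'a rel" where
  "D_ord M T X = {(D_code M p, D_code M q) | p q.
     p \<in> D_pairs M T X \<and> q \<in> D_pairs M T X \<and> (p = q \<or> D_less M T X p q)}"

definition coded_dilator :: "'a l2_structure \<Rightarrow> ('a, 'b) praedilator_scheme \<Rightarrow> bool" where
  "coded_dilator M T \<longleftrightarrow> coded_praedilator M T \<and>
     (\<forall>X. coded_well_order M X \<longrightarrow> well_founded M (D_ord M T X))"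

record 'a normal_praedilator = "'a praedilator" +
  Mu :: "'a \<Rightarrow> 'a \<Rightarrow> 'a"

definition normality :: "'a l2_structure \<Rightarrow> 'a normal_praedilator \<Rightarrow> bool" where
  "normality M T \<longleftrightarrow>
     {pr M n (pr M k (Mu T n k)) | n k. k \<in> below M n} \<in> Sets M \<and>
     (\<forall>n. \<forall>k\<in>below M n. Mu T n k \<in> Fld T n) \<and>
     (\<forall>n. \<forall>j\<in>below M n. \<forall>k\<in>below M n. Less M j k \<longrightarrow> lt (Ord T n) (Mu T n j) (Mu T n k)) \<and>
     (\<forall>n m f. nat_mor M n m f \<longrightarrow>
        (\<forall>k\<in>below M n. act M T n m f (Mu T n k) = Mu T m (f k))) \<and>
     (\<forall>n. \<forall>m\<in>below M n. \<forall>\<sigma>\<in>Fld T n.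
        lt (Ord T n) \<sigma> (Mu T n m) \<longleftrightarrow> Supp T n \<sigma> \<subseteq> below M m)"

definition coded_normal_dilator :: "'a l2_structure \<Rightarrow> 'a normal_praedilator \<Rightarrow> bool" where
  "coded_normal_dilator M T \<longleftrightarrow> coded_dilator M T \<and> normality M T"

definition fixed_point ::
  "'a l2_structure \<Rightarrow> ('a, 'b) praedilator_scheme \<Rightarrow> 'a rel \<Rightarrow> ('a \<Rightarrow> 'a) \<Rightarrow> bool" where
  "fixed_point M T X \<xi> \<longleftrightarrow> coded_linear_order M X \<and>
     {pr M p (\<xi> p) | p. p \<in> Field (D_ord M T X)} \<in> Sets M \<and>
     order_embedding (D_ord M T X) X \<xi>"

end

theory Submission
  imports Defs
begin

text \<open>
  By arithmetical comprehension, a \<open>\<Pi>\<^sup>1\<^sub>1\<close> formula \<open>\<phi>(n)\<close> says that a tree \<open>T(n + 1)\<close> has no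
  path, where a path also lists the truth sets of all subformulas. Let \<open>T(0)\<close> consist of a root
  only. The premises of the induction say that \<open>T(n + 1)\<close> has no path if \<open>T(n)\<close> has none.
  Consider the Kleene-Brouwer order on attempts to build, for some \<open>n\<close>, a path of \<open>T(n + 1)\<close>
  together with a rank function from \<open>T(n)\<close> into \<open>X\<close>. If \<open>X\<close> is well-founded, the rank function
  excludes paths of \<open>T(n)\<close> and hence of \<open>T(n + 1)\<close>, so this order is well-founded. It is thus a
  dilator in \<open>X\<close>, and it becomes normal when each attempt carries a bound \<open>x \<in> X\<close> for its
  ranks, which is compared first. Now let \<open>X\<close> be a well-founded fixed point. A rank function of
  \<open>T(n)\<close> in \<open>X\<close> is bounded by its value at the root, and it yields a rank function of \<open>T(n + 1)\<close>,
  which sends a node to the attempt that consists of this node and a restriction of the given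
  rank function. As this is uniform, primitive recursion provides rank functions for all \<open>T(n)\<close>.
\<close>

section \<open>Renaming variables\<close>

text \<open>Two obstacles shape the proof. The structure may be nonstandard and its sets need not be
  all subsets, so each induction, recursion and choice must concern an arithmetically definable
  predicate; \<open>ar\<close> and \<open>af\<close> make this a matter of backchaining. Moreover,
  \<open>ACA\<^sub>0\<close> does not in general allow one to iterate an operator on functions along
  the numbers, yet this is what passing from a rank function of one tree to the next amounts to.
  Here the new value at a node depends on the old function only at the root and at numbers below the
  length of the node, because an attempt lists the ranks of the first numbers, read as codes of
  nodes. So finite tables suffice, and these are numbers. The same indexing makes descending
  sequences converge: node and rank list of an attempt have equal length, so they grow together into
  a path and a total rank function. An extra least element \<open>bot\<close> is present over every
  order, even the empty one; its image in the fixed point starts the recursion as the constant value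
  of the first rank function.\<close>

primrec rename_term :: "(nat \<Rightarrow> nat) \<Rightarrow> l2_term \<Rightarrow> l2_term" where
  "rename_term \<rho> (NVar i) = NVar (\<rho> i)"
| "rename_term \<rho> TZer = TZer"
| "rename_term \<rho> TOne = TOne"
| "rename_term \<rho> (TAdd s t) = TAdd (rename_term \<rho> s) (rename_term \<rho> t)"
| "rename_term \<rho> (TMul s t) = TMul (rename_term \<rho> s) (rename_term \<rho> t)"

primrec rename :: "(nat \<Rightarrow> nat) \<Rightarrow> (nat \<Rightarrow> nat) \<Rightarrow> l2_formula \<Rightarrow> l2_formula" where
  "rename \<rho> \<pi> (FEq s t) = FEq (rename_term \<rho> s) (rename_term \<rho> t)"
| "rename \<rho> \<pi> (FLess s t) = FLess (rename_term \<rho> s) (rename_term \<rho> t)"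
| "rename \<rho> \<pi> (FMem t i) = FMem (rename_term \<rho> t) (\<pi> i)"
| "rename \<rho> \<pi> (FNeg \<phi>) = FNeg (rename \<rho> \<pi> \<phi>)"
| "rename \<rho> \<pi> (FConj \<phi> \<psi>) = FConj (rename \<rho> \<pi> \<phi>) (rename \<rho> \<pi> \<psi>)"
| "rename \<rho> \<pi> (FAll i \<phi>) = FAll (\<rho> i) (rename \<rho> \<pi> \<phi>)"
| "rename \<rho> \<pi> (FAllSet i \<phi>) = FAllSet i (rename \<rho> \<pi> \<phi>)"

lemma val_rename_term: "l2_val M e (rename_term \<rho> t) = l2_val M (e \<circ> \<rho>) t"
  by (induction t) auto

text \<open>Injectivity of \<open>\<rho>\<close> excludes capture: changing \<open>e\<close> at
  \<open>\<rho> i\<close> changes \<open>e \<circ> \<rho>\<close> at \<open>i\<close> only.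
  Arithmetical formulas bind no set variables, so \<open>\<pi>\<close> may be arbitrary.\<close>

lemma sat_rename:
  assumes "inj \<rho>" "arithmetical \<phi>"
  shows "l2_sat M e E (rename \<rho> \<pi> \<phi>) \<longleftrightarrow> l2_sat M (e \<circ> \<rho>) (E \<circ> \<pi>) \<phi>"
  using assms(2)
proof (induction \<phi> arbitrary: e)
  case (FAll i \<phi>)
  have "(e(\<rho> i := x)) \<circ> \<rho> = (e \<circ> \<rho>)(i := x)" for x
    using assms(1) by (auto simp: fun_eq_iff inj_def)
  with FAll show ?case by (simp del: fun_upd_apply o_apply)
qed (auto simp: val_rename_term)

lemma arithmetical_rename [simp]: "arithmetical (rename \<rho> \<pi> \<phi>) \<longleftrightarrow> arithmetical \<phi>"
  by (induction \<phi>) auto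

primrec term_bound :: "l2_term \<Rightarrow> nat" where
  "term_bound (NVar i) = Suc i"
| "term_bound TZer = 0"
| "term_bound TOne = 0"
| "term_bound (TAdd s t) = max (term_bound s) (term_bound t)"
| "term_bound (TMul s t) = max (term_bound s) (term_bound t)"

primrec var_bound :: "l2_formula \<Rightarrow> nat" where
  "var_bound (FEq s t) = max (term_bound s) (term_bound t)"
| "var_bound (FLess s t) = max (term_bound s) (term_bound t)"
| "var_bound (FMem t i) = term_bound t"
| "var_bound (FNeg \<phi>) = var_bound \<phi>"
| "var_bound (FConj \<phi> \<psi>) = max (var_bound \<phi>) (var_bound \<psi>)"
| "var_bound (FAll i \<phi>) = max (Suc i) (var_bound \<phi>)"
| "var_bound (FAllSet i \<phi>) = var_bound \<phi>"

lemma val_cong: "(\<And>k. k < term_bound t \<Longrightarrow> e k = e' k) \<Longrightarrow> l2_val M e t = l2_val M e' t"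
  by (induction t) auto

lemma sat_cong:
  "(\<And>k. k < var_bound \<phi> \<Longrightarrow> e k = e' k) \<Longrightarrow> l2_sat M e E \<phi> \<longleftrightarrow> l2_sat M e' E \<phi>"
proof (induction \<phi> arbitrary: e e' E)
  case (FEq s t)
  then show ?case using val_cong[of s e e'] val_cong[of t e e'] by simp
next
  case (FLess s t)
  then show ?case using val_cong[of s e e'] val_cong[of t e e'] by simp
next
  case (FMem t i)
  then show ?case using val_cong[of t e e'] by simp
next
  case (FConj \<phi> \<psi>)
  have "l2_sat M e E \<phi> \<longleftrightarrow> l2_sat M e' E \<phi>" "l2_sat M e E \<psi> \<longleftrightarrow> l2_sat M e' E \<psi>"
    by (rule FConj.IH; use FConj.prems in simp)+
  then show ?case by simp
next
  case (FNeg \<phi>)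
  have "l2_sat M e E \<phi> \<longleftrightarrow> l2_sat M e' E \<phi>"
    by (rule FNeg.IH; use FNeg.prems in simp)
  then show ?case by simp
next
  case (FAll i \<phi>)
  have "l2_sat M (e(i := x)) E \<phi> \<longleftrightarrow> l2_sat M (e'(i := x)) E \<phi>" for x
    by (rule FAll.IH) (use FAll.prems in auto)
  then show ?case by simp
next
  case (FAllSet i \<phi>)
  have "l2_sat M e (E(i := X)) \<phi> \<longleftrightarrow> l2_sat M e' (E(i := X)) \<phi>" for X
    by (rule FAllSet.IH; use FAllSet.prems in simp)
  then show ?case by simp
qed

section \<open>Arithmetical definability\<close>

named_theorems ar_intros

locale aca0 =
  fixes M :: "'a l2_structure"
  assumes models: "models_ACA0 M"
begin

abbreviation zero (\<open>\<zero>\<close>) where "\<zero> \<equiv> Zer M"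
abbreviation one (\<open>\<one>\<close>) where "\<one> \<equiv> One M"
abbreviation plus (infixl \<open>\<oplus>\<close> 65) where "m \<oplus> n \<equiv> Add M m n"
abbreviation times (infixl \<open>\<otimes>\<close> 70) where "m \<otimes> n \<equiv> Mul M m n"
abbreviation less (infix \<open>\<prec>\<close> 50) where "m \<prec> n \<equiv> Less M m n"
abbreviation less_eq (infix \<open>\<preceq>\<close> 50) where "m \<preceq> n \<equiv> m \<prec> n \<or> m = n"

text \<open>
  Variables are de Bruijn indices into the environment, so that the closure rule for a quantifier
  is a higher-order pattern and proofs of definability are a matter of backchaining.
\<close>

definition ar :: "((nat \<Rightarrow> 'a) \<Rightarrow> bool) \<Rightarrow> bool" where
  "ar P \<longleftrightarrow> (\<exists>\<phi> E. arithmetical \<phi> \<and> range E \<subseteq> Sets M \<and> (\<forall>e. P e \<longleftrightarrow> l2_sat M e E \<phi>))"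

definition af :: "((nat \<Rightarrow> 'a) \<Rightarrow> 'a) \<Rightarrow> bool" where
  "af f \<longleftrightarrow> ar (\<lambda>e. e 0 = f (\<lambda>n. e (Suc n)))"

lemma ar_weaken:
  assumes "ar P"
  shows "ar (\<lambda>e. P (\<lambda>n. e (Suc n)))"
proof -
  from assms obtain \<phi> E where \<phi>: "arithmetical \<phi>" "range E \<subseteq> Sets M" "\<forall>e. P e \<longleftrightarrow> l2_sat M e E \<phi>"
    unfolding ar_def by blast
  have "P (\<lambda>n. e (Suc n)) \<longleftrightarrow> l2_sat M e E (rename Suc id \<phi>)" for e
    using \<phi> by (simp add: sat_rename comp_def)
  with \<phi> show ?thesis unfolding ar_def by (intro exI[of _ "rename Suc id \<phi>"] exI[of _ E]) simp
qed

lemma ar_not [ar_intros]: "ar P \<Longrightarrow> ar (\<lambda>e. \<not> P e)"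
  unfolding ar_def by (metis arithmetical.simps(4) l2_sat.simps(4))

lemma ar_conj [ar_intros]:
  assumes "ar P" "ar Q"
  shows "ar (\<lambda>e. P e \<and> Q e)"
proof -
  from assms obtain \<phi> E where \<phi>: "arithmetical \<phi>" "range E \<subseteq> Sets M" "\<forall>e. P e \<longleftrightarrow> l2_sat M e E \<phi>"
    unfolding ar_def by blast
  from assms obtain \<psi> D where \<psi>: "arithmetical \<psi>" "range D \<subseteq> Sets M" "\<forall>e. Q e \<longleftrightarrow> l2_sat M e D \<psi>"
    unfolding ar_def by blast
  \<comment> \<open>Each formula brings its own set parameters; they are interleaved at even and odd
    indices.\<close>
  define \<chi> where "\<chi> = FConj (rename id (\<lambda>i. 2 * i) \<phi>) (rename id (\<lambda>i. Suc (2 * i)) \<psi>)"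
  define C where "C = (\<lambda>i. if even i then E (i div 2) else D (i div 2))"
  have "C \<circ> (\<lambda>i. 2 * i) = E" "C \<circ> (\<lambda>i. Suc (2 * i)) = D"
    by (auto simp: C_def)
  then have "P e \<and> Q e \<longleftrightarrow> l2_sat M e C \<chi>" for e
    using \<phi> \<psi> by (simp add: \<chi>_def sat_rename)
  moreover have "range C \<subseteq> Sets M" using \<phi> \<psi> by (auto simp: C_def)
  moreover have "arithmetical \<chi>" using \<phi> \<psi> by (simp add: \<chi>_def)
  ultimately show ?thesis unfolding ar_def by blast
qed

lemma ar_all [ar_intros]:
  assumes "ar (\<lambda>e. R (e 0) (\<lambda>n. e (Suc n)))"
  shows "ar (\<lambda>e. \<forall>x. R x e)"
proof -
  from assms obtain \<phi> E where \<phi>: "arithmetical \<phi>" "range E \<subseteq> Sets M"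
      "\<forall>e. R (e 0) (\<lambda>n. e (Suc n)) \<longleftrightarrow> l2_sat M e E \<phi>"
    unfolding ar_def by blast
  define N where "N = var_bound \<phi>"
  \<comment> \<open>The quantified variable has index 0, but \<open>FAll\<close> needs a name. The
    fresh \<open>N\<close> takes its place and the indices from 1 to \<open>N\<close> move down by
    one; what happens above \<open>N\<close> is invisible to \<open>\<phi>\<close>.\<close>
  define \<rho> where "\<rho> k = (if k = 0 then N else if k \<le> N then k - 1 else k)" for k
  have inj: "inj \<rho>" by (auto simp: inj_def \<rho>_def split: if_splits)
  have "R x e \<longleftrightarrow> l2_sat M (e(N := x)) E (rename \<rho> id \<phi>)" for x e
  proof -
    have "R x e \<longleftrightarrow> l2_sat M (case_nat x e) E \<phi>"
      using \<phi>(3)[rule_format, of "case_nat x e"] by simp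
    also have "\<dots> \<longleftrightarrow> l2_sat M (e(N := x) \<circ> \<rho>) E \<phi>"
      by (rule sat_cong) (auto simp: \<rho>_def N_def split: nat.split)
    finally show ?thesis using \<phi> inj by (simp add: sat_rename)
  qed
  then have "(\<forall>x. R x e) \<longleftrightarrow> l2_sat M e E (FAll N (rename \<rho> id \<phi>))" for e by simp
  with \<phi> show ?thesis unfolding ar_def
    by (intro exI[of _ "FAll N (rename \<rho> id \<phi>)"] exI[of _ E]) simp
qed

lemma ar_disj [ar_intros]: "ar P \<Longrightarrow> ar Q \<Longrightarrow> ar (\<lambda>e. P e \<or> Q e)"
  using ar_not[OF ar_conj[OF ar_not ar_not], of P Q] by simp

lemma ar_imp [ar_intros]: "ar P \<Longrightarrow> ar Q \<Longrightarrow> ar (\<lambda>e. P e \<longrightarrow> Q e)"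
  using ar_disj[OF ar_not[of P], of Q] by (simp only: imp_conv_disj)

lemma ar_iff [ar_intros]: "ar P \<Longrightarrow> ar Q \<Longrightarrow> ar (\<lambda>e. P e = Q e)"
  using ar_conj[OF ar_imp ar_imp, of P Q Q P] by (simp add: iff_conv_conj_imp)

lemma ar_ex [ar_intros]: "ar (\<lambda>e. R (e 0) (\<lambda>n. e (Suc n))) \<Longrightarrow> ar (\<lambda>e. \<exists>x. R x e)"
  using ar_not[OF ar_all[OF ar_not], of R] by simp

lemma Sets_nonempty: obtains E :: "nat \<Rightarrow> 'a set" where "range E \<subseteq> Sets M"
proof -
  obtain S where "S \<in> Sets M" using models unfolding models_ACA0_def by auto
  then have "range (\<lambda>_::nat. S) \<subseteq> Sets M" by auto
  then show ?thesis by (rule that)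
qed

lemma ar_formula: "arithmetical \<phi> \<Longrightarrow> range E \<subseteq> Sets M \<Longrightarrow> ar (\<lambda>e. l2_sat M e E \<phi>)"
  unfolding ar_def by blast

lemma af_var [ar_intros]: "af (\<lambda>e. e n)"
proof -
  obtain E :: "nat \<Rightarrow> 'a set" where "range E \<subseteq> Sets M" by (rule Sets_nonempty) blast
  then have "ar (\<lambda>e. l2_sat M e E (FEq (NVar 0) (NVar (Suc n))))" by (intro ar_formula) auto
  then show ?thesis by (simp add: af_def)
qed

lemma comprehension:
  assumes "ar (\<lambda>e. P (e 0))"
  shows "{n. P n} \<in> Sets M"
proof -
  from assms obtain \<phi> E where \<phi>: "arithmetical \<phi>" "range E \<subseteq> Sets M" "\<forall>e. P (e 0) \<longleftrightarrow> l2_sat M e E \<phi>"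
    unfolding ar_def by blast
  have "{n. P n} = {n. l2_sat M (e(0 := n)) E \<phi>}" for e :: "nat \<Rightarrow> 'a"
    using \<phi>(3)[rule_format, of "e(0 := n)" for n] by simp
  then show ?thesis
    using models \<phi>(1,2) unfolding models_ACA0_def arithmetical_comprehension_def by metis
qed

lemma ar_mem_var:
  assumes "S \<in> Sets M"
  shows "ar (\<lambda>e. e n \<in> S)"
  using ar_formula[of "FMem (NVar n) 0" "\<lambda>_. S"] assms by (simp add: image_subset_iff)

text \<open>In \<open>ar\<close> the environment is reserved for the arguments and only sets are
  parameters. A possibly nonstandard element is therefore used through its singleton, which
  comprehension provides.\<close>

lemma af_const [ar_intros]: "af (\<lambda>e. c)"
proof -
  obtain E :: "nat \<Rightarrow> 'a set" where E: "range E \<subseteq> Sets M" by (rule Sets_nonempty) blast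
  have "{n. l2_sat M ((\<lambda>_. c)(0 := n)) E (FEq (NVar 0) (NVar 1))} \<in> Sets M"
    using models E unfolding models_ACA0_def arithmetical_comprehension_def
    by (metis arithmetical.simps(1))
  then have "{c} \<in> Sets M" by simp
  from ar_mem_var[OF this, of 0] show ?thesis by (simp add: af_def)
qed

lemma af_weaken:
  assumes "af f"
  shows "af (\<lambda>e. f (\<lambda>n. e (Suc n)))"
proof -
  from assms obtain \<phi> E where \<phi>: "arithmetical \<phi>" "range E \<subseteq> Sets M"
      "\<forall>e. e 0 = f (\<lambda>n. e (Suc n)) \<longleftrightarrow> l2_sat M e E \<phi>"
    unfolding af_def ar_def by blast
  define \<rho> where "\<rho> n = (case n of 0 \<Rightarrow> 0 | Suc k \<Rightarrow> Suc (Suc k))" for n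
  have "inj \<rho>" by (auto simp: inj_def \<rho>_def split: nat.splits)
  moreover have "(\<lambda>n. (e \<circ> \<rho>) (Suc n)) = (\<lambda>n. e (Suc (Suc n)))" "\<rho> 0 = 0"
      for e :: "nat \<Rightarrow> 'a"
    by (auto simp: \<rho>_def)
  ultimately have "e 0 = f (\<lambda>n. e (Suc (Suc n))) \<longleftrightarrow> l2_sat M e E (rename \<rho> id \<phi>)" for e
    using \<phi>(3)[rule_format, of "e \<circ> \<rho>"] \<phi>(1) by (simp add: sat_rename del: comp_apply) (simp add: comp_def)
  with \<phi> show ?thesis unfolding af_def ar_def
    by (intro exI[of _ "rename \<rho> id \<phi>"] exI[of _ E]) simp
qed

lemma ar_eq [ar_intros]:
  assumes "af s" "af t"
  shows "ar (\<lambda>e. s e = t e)"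
proof -
  have "ar (\<lambda>e. \<exists>x. x = s e \<and> x = t e)"
    using assms by (intro ar_ex ar_conj) (simp_all add: af_def)
  then show ?thesis by simp
qed

lemma ar_sub1:
  assumes "ar (\<lambda>e. p (e 0))" "af f"
  shows "ar (\<lambda>e. p (f e))"
proof -
  have "ar (\<lambda>e. \<exists>x. x = f e \<and> p x)"
    by (intro ar_ex ar_conj assms ar_eq af_var af_weaken)
  then show ?thesis by simp
qed

lemma ar_sub2_aux:
  assumes "ar (\<lambda>e. p (e 0) (e 1))" "af f" "af g"
  shows "ar (\<lambda>e. p (f e) (g e))"
proof -
  have "ar (\<lambda>e. \<exists>y. y = g e \<and> (\<exists>x. x = f e \<and> p x y))"
    using assms by (intro ar_ex ar_conj ar_eq af_var af_weaken) simp_all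
  then show ?thesis by simp
qed

lemma ar_less [ar_intros]:
  assumes "af s" "af t"
  shows "ar (\<lambda>e. s e \<prec> t e)"
proof -
  obtain E :: "nat \<Rightarrow> 'a set" where E: "range E \<subseteq> Sets M" by (rule Sets_nonempty) blast
  have "ar (\<lambda>e. l2_sat M e E (FLess (NVar 0) (NVar 1)))" using E by (intro ar_formula) auto
  then show ?thesis using ar_sub2_aux[of "Less M" s t] assms by simp
qed

lemma ar_mem:
  assumes "S \<in> Sets M" "af t"
  shows "ar (\<lambda>e. t e \<in> S)"
  using ar_mem_var[OF assms(1)] assms(2) by (rule ar_sub1)

lemma af_binop:
  assumes "ar (\<lambda>e. e 2 = f (e 0) (e 1))" "af s" "af t"
  shows "af (\<lambda>e. f (s e) (t e))"
proof -
  have "ar (\<lambda>e. \<exists>z. z = e 0 \<and> (\<exists>y. y = t (\<lambda>n. e (Suc n)) \<and> (\<exists>x. x = s (\<lambda>n. e (Suc n)) \<and> z = f x y)))"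
    using assms(1)
    by (intro ar_ex ar_conj ar_eq[OF af_var af_var]
        ar_eq[OF af_var af_weaken[OF af_weaken[OF af_weaken[OF assms(3)]]]]
        ar_eq[OF af_var af_weaken[OF af_weaken[OF af_weaken[OF af_weaken[OF assms(2)]]]]])
      (simp add: numeral_2_eq_2)
  then show ?thesis unfolding af_def by simp
qed

lemma
  shows af_add [ar_intros]: "af s \<Longrightarrow> af t \<Longrightarrow> af (\<lambda>e. s e \<oplus> t e)"
    and af_mul [ar_intros]: "af s \<Longrightarrow> af t \<Longrightarrow> af (\<lambda>e. s e \<otimes> t e)"
proof -
  obtain E :: "nat \<Rightarrow> 'a set" where "range E \<subseteq> Sets M" by (rule Sets_nonempty) blast
  then have "ar (\<lambda>e. l2_sat M e E (FEq (NVar 2) (TAdd (NVar 0) (NVar 1))))"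
      "ar (\<lambda>e. l2_sat M e E (FEq (NVar 2) (TMul (NVar 0) (NVar 1))))"
    by (intro ar_formula; simp)+
  then show "af s \<Longrightarrow> af t \<Longrightarrow> af (\<lambda>e. s e \<oplus> t e)" "af s \<Longrightarrow> af t \<Longrightarrow> af (\<lambda>e. s e \<otimes> t e)"
    by (auto intro: af_binop)
qed

lemma af_val:
  assumes "\<And>k. af (F k)"
  shows "af (\<lambda>e. l2_val M (\<lambda>k. F k e) t)"
  by (induction t) (auto intro!: ar_intros assms)

lemma ar_sat:
  assumes "arithmetical \<phi>" "range E \<subseteq> Sets M" "\<And>k. af (F k)"
  shows "ar (\<lambda>e. l2_sat M (\<lambda>k. F k e) E \<phi>)"
  using assms(1,3)
proof (induction \<phi> arbitrary: F)
  case (FMem t i)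
  then show ?case using assms(2) by (auto intro!: ar_mem af_val)
next
  case (FAll v \<phi>)
  have "ar (\<lambda>e. \<forall>x. l2_sat M (\<lambda>k. if k = v then x else F k e) E \<phi>)"
  proof (rule ar_all)
    have "af (\<lambda>e. if k = v then e 0 else F k (\<lambda>n. e (Suc n)))" for k
      using FAll.prems by (cases "k = v") (auto intro: ar_intros af_weaken)
    with FAll show "ar (\<lambda>e. l2_sat M (\<lambda>k. if k = v then e 0 else F k (\<lambda>n. e (Suc n))) E \<phi>)"
      by simp
  qed
  then show ?case by (simp add: fun_upd_def)
qed (auto intro!: ar_intros af_val)

text \<open>With \<open>ar_subst_list\<close> this yields substitution for any fixed number of
  arguments. It rests on the induction in \<open>ar_sat\<close>, where a quantifier extends the
  family of substituted functions by the new variable.\<close>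

lemma ar_subst:
  assumes "ar P" "\<And>k. af (F k)"
  shows "ar (\<lambda>e. P (\<lambda>k. F k e))"
proof -
  from assms obtain \<phi> E where \<phi>: "arithmetical \<phi>" "range E \<subseteq> Sets M" "\<forall>e. P e \<longleftrightarrow> l2_sat M e E \<phi>"
    unfolding ar_def by blast
  with ar_sat[OF \<phi>(1,2) assms(2)] show ?thesis by simp
qed

lemma ar_lift:
  assumes "ar (\<lambda>e. R (e 0) (\<lambda>n. e (Suc n)))" "af s" "\<And>n. af (F n)"
  shows "ar (\<lambda>e. R (s e) (\<lambda>n. F n e))"
  using ar_subst[OF assms(1), of "case_nat s F"] assms(2,3) by (simp split: nat.split)

lemma ar_subst_list:
  assumes "ar P" "\<forall>f\<in>set fs. af f"
  shows "ar (\<lambda>e. P (\<lambda>k. if k < length fs then (fs ! k) e else e k))"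
proof (rule ar_subst[OF assms(1)])
  fix k
  show "af (\<lambda>e. if k < length fs then (fs ! k) e else e k)"
    using assms(2) by (cases "k < length fs") (auto intro: ar_intros)
qed

lemma ar_sub2: "ar (\<lambda>e. p (e 0) (e 1)) \<Longrightarrow> af f \<Longrightarrow> af g \<Longrightarrow> ar (\<lambda>e. p (f e) (g e))"
  using ar_subst_list[of "\<lambda>e. p (e 0) (e 1)" "[f, g]"] by simp

lemma ar_sub3:
  "ar (\<lambda>e. p (e 0) (e 1) (e 2)) \<Longrightarrow> af f \<Longrightarrow> af g \<Longrightarrow> af h \<Longrightarrow> ar (\<lambda>e. p (f e) (g e) (h e))"
  using ar_subst_list[of "\<lambda>e. p (e 0) (e 1) (e 2)" "[f, g, h]"] by simp

lemma ar_sub4: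
  "ar (\<lambda>e. p (e 0) (e 1) (e 2) (e 3)) \<Longrightarrow> af f \<Longrightarrow> af g \<Longrightarrow> af h \<Longrightarrow> af i \<Longrightarrow>
    ar (\<lambda>e. p (f e) (g e) (h e) (i e))"
  using ar_subst_list[of "\<lambda>e. p (e 0) (e 1) (e 2) (e 3)" "[f, g, h, i]"] by simp

lemma ar_sub5:
  "ar (\<lambda>e. p (e 0) (e 1) (e 2) (e 3) (e 4)) \<Longrightarrow> af f \<Longrightarrow> af g \<Longrightarrow> af h \<Longrightarrow> af i \<Longrightarrow> af j \<Longrightarrow>
    ar (\<lambda>e. p (f e) (g e) (h e) (i e) (j e))"
  using ar_subst_list[of "\<lambda>e. p (e 0) (e 1) (e 2) (e 3) (e 4)" "[f, g, h, i, j]"] by simp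

lemma af_sub1:
  assumes "af (\<lambda>e. p (e 0))" "af f"
  shows "af (\<lambda>e. p (f e))"
  using ar_sub2[of "\<lambda>x y. x = p y" "\<lambda>e. e 0" "\<lambda>e. f (\<lambda>n. e (Suc n))"] assms
    af_weaken[of f]
  by (simp add: af_def af_var[of 0, unfolded af_def, simplified])

lemma af_sub2:
  assumes "af (\<lambda>e. p (e 0) (e 1))" "af f" "af g"
  shows "af (\<lambda>e. p (f e) (g e))"
  using ar_sub3[of "\<lambda>x y z. x = p y z" "\<lambda>e. e 0" "\<lambda>e. f (\<lambda>n. e (Suc n))" "\<lambda>e. g (\<lambda>n. e (Suc n))"] assms
    af_weaken[of f] af_weaken[of g]
  by (simp add: af_def af_var[of 0, unfolded af_def, simplified] numeral_2_eq_2)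

lemma af_sub3:
  assumes "af (\<lambda>e. p (e 0) (e 1) (e 2))" "af f" "af g" "af h"
  shows "af (\<lambda>e. p (f e) (g e) (h e))"
  using ar_sub4[of "\<lambda>x y z u. x = p y z u" "\<lambda>e. e 0" "\<lambda>e. f (\<lambda>n. e (Suc n))" "\<lambda>e. g (\<lambda>n. e (Suc n))"
    "\<lambda>e. h (\<lambda>n. e (Suc n))"] assms
    af_weaken[of f] af_weaken[of g] af_weaken[of h]
  by (simp add: af_def af_var[of 0, unfolded af_def, simplified] numeral_2_eq_2 numeral_3_eq_3)

lemma ar_const [ar_intros]: "ar (\<lambda>e. b)"
proof -
  have "ar (\<lambda>e. e 0 = e 0)" "ar (\<lambda>e. e 0 \<noteq> e 0)" by (intro ar_intros)+
  then show ?thesis by (cases b) simp_all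
qed

section \<open>Arithmetic\<close>


lemma
  shows suc_neq_zero [simp]: "n \<oplus> \<one> \<noteq> \<zero>"
    and suc_inj [simp]: "m \<oplus> \<one> = n \<oplus> \<one> \<longleftrightarrow> m = n"
    and add_zero [simp]: "m \<oplus> \<zero> = m"
    and add_suc: "m \<oplus> (n \<oplus> \<one>) = m \<oplus> n \<oplus> \<one>"
    and mul_zero [simp]: "m \<otimes> \<zero> = \<zero>"
    and mul_suc: "m \<otimes> (n \<oplus> \<one>) = m \<otimes> n \<oplus> m"
    and not_less_zero [simp]: "\<not> m \<prec> \<zero>"
    and less_suc: "m \<prec> n \<oplus> \<one> \<longleftrightarrow> m \<prec> n \<or> m = n"
  using models unfolding models_ACA0_def basic_axioms_def by auto

lemma zero_neq_suc [simp]: "\<zero> \<noteq> n \<oplus> \<one>"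
  using suc_neq_zero by metis

text \<open>The induction axiom speaks about coded sets only, so each use has to discharge the case
  \<open>definable\<close>, normally by \<open>ar_intros\<close>.\<close>

lemma m_induct [case_names definable zero suc]:
  assumes "ar (\<lambda>e. P (e 0))" "P \<zero>" "\<And>n. P n \<Longrightarrow> P (n \<oplus> \<one>)"
  shows "P n"
proof -
  have "\<forall>X\<in>Sets M. \<zero> \<in> X \<and> (\<forall>n. n \<in> X \<longrightarrow> n \<oplus> \<one> \<in> X) \<longrightarrow> (\<forall>n. n \<in> X)"
    using models unfolding models_ACA0_def induction_axiom_def by (elim conjE)
  from bspec[OF this comprehension[of P, OF assms(1)]] assms(2,3) show ?thesis by simp
qed

lemma zero_add [simp]: "\<zero> \<oplus> n = n"
proof (induction n rule: m_induct)
  case (suc n)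
  then show ?case by (simp add: add_suc)
qed (intro ar_intros | simp)+

lemma add_assoc: "a \<oplus> b \<oplus> c = a \<oplus> (b \<oplus> c)"
proof (induction c rule: m_induct)
  case (suc n)
  then show ?case by (simp add: add_suc)
qed (intro ar_intros | simp)+

lemma suc_add: "a \<oplus> \<one> \<oplus> b = a \<oplus> b \<oplus> \<one>"
proof (induction b rule: m_induct)
  case (suc n)
  then show ?case by (simp add: add_suc)
qed (intro ar_intros | simp)+

lemma add_comm: "a \<oplus> b = b \<oplus> a"
proof (induction b rule: m_induct)
  case (suc n)
  then show ?case by (simp add: add_suc suc_add)
qed (intro ar_intros | simp)+

lemma add_left_comm: "a \<oplus> (b \<oplus> c) = b \<oplus> (a \<oplus> c)"
  by (metis add_assoc add_comm)

lemma zero_mul [simp]: "\<zero> \<otimes> n = \<zero>"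
proof (induction n rule: m_induct)
  case (suc n)
  then show ?case by (simp add: mul_suc)
qed (intro ar_intros | simp)+

lemmas add_ac = add_assoc add_comm add_left_comm

lemma suc_mul: "(a \<oplus> \<one>) \<otimes> b = a \<otimes> b \<oplus> b"
proof (induction b rule: m_induct)
  case (suc n)
  then show ?case by (simp add: mul_suc add_ac)
qed (intro ar_intros | simp)+

lemma mul_comm: "a \<otimes> b = b \<otimes> a"
proof (induction b rule: m_induct)
  case (suc n)
  then show ?case by (simp add: mul_suc suc_mul)
qed (intro ar_intros | simp)+

lemma mul_one [simp]: "a \<otimes> \<one> = a" "\<one> \<otimes> a = a"
  using mul_suc[of a \<zero>] mul_comm[of a \<one>] by simp_all

lemma distrib_left: "a \<otimes> (b \<oplus> c) = a \<otimes> b \<oplus> a \<otimes> c"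
proof (induction c rule: m_induct)
  case (suc n)
  then show ?case by (simp add: mul_suc add_assoc[symmetric])
qed (intro ar_intros | simp)+

lemma distrib_right: "(b \<oplus> c) \<otimes> a = b \<otimes> a \<oplus> c \<otimes> a"
  by (metis distrib_left mul_comm)

lemma mul_assoc: "a \<otimes> b \<otimes> c = a \<otimes> (b \<otimes> c)"
proof (induction c rule: m_induct)
  case (suc n)
  then show ?case by (simp add: distrib_left)
qed (intro ar_intros | simp)+

lemma mul_left_comm: "a \<otimes> (b \<otimes> c) = b \<otimes> (a \<otimes> c)"
  by (metis mul_assoc mul_comm)

lemmas mul_ac = mul_assoc mul_comm mul_left_comm

lemma add_right_cancel [simp]: "a \<oplus> c = b \<oplus> c \<longleftrightarrow> a = b"
proof (induction c rule: m_induct)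
  case (suc n)
  then show ?case by (simp add: add_assoc[symmetric])
qed (intro ar_intros | simp)+

lemma add_left_cancel [simp]: "c \<oplus> a = c \<oplus> b \<longleftrightarrow> a = b"
  using add_right_cancel add_comm by metis

lemma cases_m [case_names zero suc]:
  obtains "n = \<zero>" | m where "n = m \<oplus> \<one>"
proof -
  have "n = \<zero> \<or> (\<exists>m. n = m \<oplus> \<one>)"
  proof (induction n rule: m_induct)
    show "ar (\<lambda>e. e 0 = \<zero> \<or> (\<exists>m. e 0 = m \<oplus> \<one>))" by (intro ar_intros)
  qed auto
  then show ?thesis using that by blast
qed

text \<open>The axioms describe the order only through zero and successor; this equivalence reduces
  most of its properties to the algebra of addition.\<close>

lemma less_iff_add: "a \<prec> b \<longleftrightarrow> (\<exists>k. b = a \<oplus> (k \<oplus> \<one>))"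
proof (induction b rule: m_induct)
  show "ar (\<lambda>e. (a \<prec> e 0) = (\<exists>k. e 0 = a \<oplus> (k \<oplus> \<one>)))" by (intro ar_intros)
next
  case zero
  show ?case by (simp add: add_assoc[symmetric])
next
  case (suc n)
  have "(\<exists>k. n \<oplus> \<one> = a \<oplus> (k \<oplus> \<one>)) \<longleftrightarrow> (\<exists>k. n = a \<oplus> k)"
    by (simp add: add_assoc[symmetric])
  also have "\<dots> \<longleftrightarrow> n = a \<or> (\<exists>k. n = a \<oplus> (k \<oplus> \<one>))"
    by (metis add_zero cases_m)
  finally show ?case using suc by (auto simp: less_suc)
qed

lemma less_irrefl [simp]: "\<not> a \<prec> a"
proof
  assume "a \<prec> a"
  then obtain k where "a = a \<oplus> (k \<oplus> \<one>)" by (auto simp: less_iff_add)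
  then have "a \<oplus> \<zero> = a \<oplus> (k \<oplus> \<one>)" by simp
  then show False unfolding add_left_cancel by simp
qed

lemma less_trans [trans]: "a \<prec> b \<Longrightarrow> b \<prec> c \<Longrightarrow> a \<prec> c"
  unfolding less_iff_add by (metis add_assoc add_suc)

lemma less_asym: "a \<prec> b \<Longrightarrow> \<not> b \<prec> a"
  using less_trans less_irrefl by blast

lemma suc_less_suc [simp]: "a \<oplus> \<one> \<prec> b \<oplus> \<one> \<longleftrightarrow> a \<prec> b"
proof -
  have "a \<oplus> \<one> \<oplus> (k \<oplus> \<one>) = a \<oplus> (k \<oplus> \<one>) \<oplus> \<one>" for k
    by (simp add: add_ac)
  then show ?thesis by (simp add: less_iff_add)
qed

lemma less_suc_self [simp]: "a \<prec> a \<oplus> \<one>"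
  by (simp add: less_suc)

lemma zero_less_suc [simp]: "\<zero> \<prec> n \<oplus> \<one>"
  by (auto simp: less_iff_add)

lemma zero_le: "\<zero> \<preceq> n"
  by (cases n rule: cases_m) auto

lemma neq_zero: "n \<noteq> \<zero> \<longleftrightarrow> \<zero> \<prec> n"
  using zero_le[of n] by auto

lemma linear: "a \<prec> b \<or> a = b \<or> b \<prec> a"
proof (induction b rule: m_induct)
  show "ar (\<lambda>e. a \<prec> e 0 \<or> a = e 0 \<or> e 0 \<prec> a)" by (intro ar_intros)
next
  case zero
  then show ?case using zero_le by auto
next
  case (suc n)
  then show ?case
  proof (elim disjE)
    assume "n \<prec> a"
    then obtain k where k: "a = n \<oplus> (k \<oplus> \<one>)" by (auto simp: less_iff_add)
    then have "a = n \<oplus> \<one> \<oplus> k" by (simp add: add_ac)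
    then show ?thesis by (cases k rule: cases_m) (auto simp: less_iff_add)
  qed (auto simp: less_suc)
qed

lemma not_less: "\<not> a \<prec> b \<longleftrightarrow> b \<preceq> a"
  using linear less_asym less_irrefl by blast

lemma suc_le: "a \<oplus> \<one> \<preceq> b \<longleftrightarrow> a \<prec> b"
  by (metis less_suc not_less)

lemma le_trans [trans]: "a \<preceq> b \<Longrightarrow> b \<preceq> c \<Longrightarrow> a \<preceq> c"
  using less_trans by blast

lemma less_le_trans [trans]: "a \<prec> b \<Longrightarrow> b \<preceq> c \<Longrightarrow> a \<prec> c"
  using less_trans by blast

lemma le_less_trans [trans]: "a \<preceq> b \<Longrightarrow> b \<prec> c \<Longrightarrow> a \<prec> c"
  using less_trans by blast

lemma le_iff_add: "a \<preceq> b \<longleftrightarrow> (\<exists>k. b = a \<oplus> k)"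
  unfolding less_iff_add by (metis add_zero cases_m)

lemma le_add1: "a \<preceq> a \<oplus> b"
  by (metis le_iff_add)

lemma le_add2: "b \<preceq> a \<oplus> b"
  by (metis le_add1 add_comm)

lemma add_le_mono: "a \<preceq> b \<Longrightarrow> c \<preceq> d \<Longrightarrow> a \<oplus> c \<preceq> b \<oplus> d"
  unfolding le_iff_add by (metis add_assoc add_left_comm)

lemma mul_le_mono: "a \<preceq> b \<Longrightarrow> c \<preceq> d \<Longrightarrow> a \<otimes> c \<preceq> b \<otimes> d"
  unfolding le_iff_add by (auto simp: distrib_left distrib_right add_assoc)

lemma mul_left_cancel:
  assumes "a \<noteq> \<zero>" "a \<otimes> b = a \<otimes> c"
  shows "b = c"
proof (rule ccontr)
  have *: False if "x \<prec> y" "a \<otimes> x = a \<otimes> y" for x y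
  proof -
    obtain k where "y = x \<oplus> (k \<oplus> \<one>)" using \<open>x \<prec> y\<close> unfolding less_iff_add by blast
    moreover obtain j where "a = j \<oplus> \<one>" using assms(1) by (cases a rule: cases_m) auto
    ultimately have "a \<otimes> y = a \<otimes> x \<oplus> ((a \<otimes> k \<oplus> j) \<oplus> \<one>)"
      by (simp add: distrib_left add_assoc)
    then have "a \<otimes> x \<prec> a \<otimes> y" unfolding less_iff_add by blast
    with that(2) show False by simp
  qed
  assume "b \<noteq> c"
  then show False using linear[of b c] * assms(2) by metis
qed

lemma one_neq_zero [simp]: "\<one> \<noteq> \<zero>" "\<zero> \<noteq> \<one>"
  using suc_neq_zero[of \<zero>] by auto

lemma less_one [simp]: "n \<prec> \<one> \<longleftrightarrow> n = \<zero>"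
  using less_suc[of n \<zero>] by simp

lemma less_induct [consumes 1, case_names less]:
  assumes "ar (\<lambda>e. P (e 0))" "\<And>n. (\<And>m. m \<prec> n \<Longrightarrow> P m) \<Longrightarrow> P n"
  shows "P n"
proof -
  have "\<forall>m. m \<prec> n \<longrightarrow> P m"
  proof (induction n rule: m_induct)
    show "ar (\<lambda>e. \<forall>m. m \<prec> e 0 \<longrightarrow> P m)" by (intro ar_intros ar_sub1[OF assms(1)])
  qed (auto simp: less_suc assms(2))
  then show ?thesis using assms(2) by blast
qed

text \<open>The default \<open>\<zero>\<close> makes the operator total with a definable graph. The
  condition asks for a least witness, as an arbitrary predicate may have witnesses but no least
  one.\<close>

definition lst :: "('a \<Rightarrow> bool) \<Rightarrow> 'a" where
  "lst P = (if \<exists>a. P a \<and> (\<forall>b. b \<prec> a \<longrightarrow> \<not> P b) then THE a. P a \<and> (\<forall>b. b \<prec> a \<longrightarrow> \<not> P b) else \<zero>)"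

lemma lst_eqI: "P a \<Longrightarrow> (\<And>b. b \<prec> a \<Longrightarrow> \<not> P b) \<Longrightarrow> lst P = a"
  unfolding lst_def using linear by (subst if_P, blast, intro the_equality) blast+

lemma least_ex:
  assumes "ar (\<lambda>e. P (e 0))" "P a"
  shows "\<exists>a. P a \<and> (\<forall>b. b \<prec> a \<longrightarrow> \<not> P b)"
proof (rule ccontr)
  assume *: "\<not> ?thesis"
  have "ar (\<lambda>e. \<not> P (e 0))" by (intro ar_intros assms(1))
  then have "\<not> P a" by (induction a rule: less_induct) (use * in blast)
  with assms(2) show False by simp
qed

lemma lst_spec:
  assumes "ar (\<lambda>e. P (e 0))" "P a"
  shows "P (lst P)" "b \<prec> lst P \<Longrightarrow> \<not> P b"
  using least_ex[of P, OF assms] lst_eqI by metis+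

lemma lst_unique: "(\<And>b. P b \<longleftrightarrow> b = a) \<Longrightarrow> lst P = a"
  by (rule lst_eqI) auto

lemma af_lst [ar_intros]:
  assumes "ar (\<lambda>e. R (e 0) (\<lambda>n. e (Suc n)))"
  shows "af (\<lambda>e. lst (\<lambda>x. R x e))"
proof -
  have eq: "y = lst P \<longleftrightarrow> (P y \<and> (\<forall>b. b \<prec> y \<longrightarrow> \<not> P b)) \<or>
      ((\<forall>a. \<not> (P a \<and> (\<forall>b. b \<prec> a \<longrightarrow> \<not> P b))) \<and> y = \<zero>)" for y P
  proof (cases "\<exists>a. P a \<and> (\<forall>b. b \<prec> a \<longrightarrow> \<not> P b)")
    case True
    then obtain a where a: "P a" "\<forall>b. b \<prec> a \<longrightarrow> \<not> P b" by blast
    then have "lst P = a" by (intro lst_eqI) auto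
    with a show ?thesis using linear by metis
  next
    case False
    then show ?thesis by (auto simp: lst_def)
  qed
  show ?thesis unfolding af_def eq by (intro ar_intros ar_lift[OF assms] | assumption)+
qed

text \<open>The least witness is definable from \<open>R\<close>. This replaces the axiom of choice
  wherever a coded function is needed.\<close>

lemma definable_choice:
  assumes "ar (\<lambda>e. R (e 0) (e 1))" "\<And>x. \<exists>y. R x y"
  obtains g where "af (\<lambda>e. g (e 0))" "\<And>x. R x (g x)"
proof
  show "af (\<lambda>e. (\<lambda>x. lst (\<lambda>y. R x y)) (e 0))"
    by (intro ar_intros ar_sub2[OF assms(1)])
  fix x
  have "ar (\<lambda>e. R x (e 0))" by (intro ar_sub2[OF assms(1)] ar_intros)
  then show "R x (lst (\<lambda>y. R x y))" using lst_spec(1)[of "R x"] assms(2) by blast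
qed

section \<open>Pairs and finite sets\<close>

text \<open>With \<open>a = i \<oplus> j\<close>, the code lies between the square of
  \<open>a\<close> and this square plus \<open>a\<close>, hence below the square of
  \<open>a \<oplus> \<one>\<close>. So the sum can be read off from the code.\<close>

lemma pr_less:
  assumes "i \<oplus> j \<prec> i' \<oplus> j'"
  shows "pr M i j \<prec> pr M i' j'"
proof -
  let ?a = "i \<oplus> j" and ?b = "i' \<oplus> j'"
  have *: "(a \<oplus> \<one>) \<otimes> (a \<oplus> \<one>) = a \<otimes> a \<oplus> a \<oplus> (a \<oplus> \<one>)" for a
    by (simp add: distrib_left distrib_right add_ac)
  have "pr M i j \<preceq> ?a \<otimes> ?a \<oplus> ?a"
    unfolding pr_def by (intro add_le_mono le_add1) simp
  also have "?a \<otimes> ?a \<oplus> ?a \<prec> (?a \<oplus> \<one>) \<otimes> (?a \<oplus> \<one>)"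
    unfolding less_iff_add by (rule exI[of _ ?a]) (rule *)
  finally have 1: "pr M i j \<prec> (?a \<oplus> \<one>) \<otimes> (?a \<oplus> \<one>)" .
  have "(?a \<oplus> \<one>) \<otimes> (?a \<oplus> \<one>) \<preceq> ?b \<otimes> ?b"
    using assms by (intro mul_le_mono) (simp_all add: suc_le)
  also have "?b \<otimes> ?b \<preceq> pr M i' j'" unfolding pr_def by (rule le_add1)
  finally show ?thesis using 1 by (rule less_le_trans[rotated])
qed

lemma pr_inj [simp]: "pr M i j = pr M i' j' \<longleftrightarrow> i = i' \<and> j = j'"
proof
  assume *: "pr M i j = pr M i' j'"
  then have "i \<oplus> j = i' \<oplus> j'" using pr_less linear less_irrefl by metis
  with * show "i = i' \<and> j = j'" by (auto simp: pr_def)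
qed simp

lemma af_pr [ar_intros]: "af s \<Longrightarrow> af t \<Longrightarrow> af (\<lambda>e. pr M (s e) (t e))"
  unfolding pr_def by (intro ar_intros)

lemma fst_le_pr: "i \<preceq> pr M i j"
  unfolding pr_def by (rule le_add2)

definition p1 :: "'a \<Rightarrow> 'a" where "p1 x = lst (\<lambda>i. \<exists>j. x = pr M i j)"
definition p2 :: "'a \<Rightarrow> 'a" where "p2 x = lst (\<lambda>j. \<exists>i. x = pr M i j)"

lemma p1_pr [simp]: "p1 (pr M i j) = i" and p2_pr [simp]: "p2 (pr M i j) = j"
  unfolding p1_def p2_def by (auto intro!: lst_unique)

lemma af_p1 [ar_intros]: "af s \<Longrightarrow> af (\<lambda>e. p1 (s e))"
  by (rule af_sub1) (unfold p1_def, intro ar_intros)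

lemma af_p2 [ar_intros]: "af s \<Longrightarrow> af (\<lambda>e. p2 (s e))"
  by (rule af_sub1) (unfold p2_def, intro ar_intros)

text \<open>Applied to a sequence, this says that its length is at most its code, which later bounds
  the part of a rank function that is consulted at a node.\<close>

lemma p1_le: "p1 x \<preceq> x"
proof (cases "\<exists>i j. x = pr M i j")
  case True
  then obtain i j where "x = pr M i j" by blast
  then show ?thesis using fst_le_pr[of i j] by simp
next
  case False
  then have "p1 x = \<zero>" by (auto simp: p1_def lst_def)
  then show ?thesis using zero_le by simp
qed

lemma ar_elts [ar_intros]: "af s \<Longrightarrow> af t \<Longrightarrow> ar (\<lambda>e. s e \<in> elts M (t e))"
  by (rule ar_sub2[where p = "\<lambda>x y. x \<in> elts M y"])
    (simp_all add: elts_def l2_dvd_def, intro ar_intros)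

lemma ar_below [ar_intros]: "af s \<Longrightarrow> af t \<Longrightarrow> ar (\<lambda>e. s e \<in> below M (t e))"
  unfolding below_def mem_Collect_eq by (intro ar_intros)

text \<open>With \<open>d\<^sub>i = m (i + 1) + 1\<close>, the divisor \<open>d\<^sub>i\<close> of \<open>n d\<^sub>j\<close> divides \<open>n m (j - i)\<close>.
  As \<open>d\<^sub>i\<close> is coprime to \<open>m\<close> and \<open>j - i\<close> divides \<open>m\<close>, it divides \<open>n\<close>.\<close>

lemma dvd_refl: "l2_dvd M a a"
  unfolding l2_dvd_def by (metis mul_one(1))

lemma dvd_mul: "l2_dvd M d a \<Longrightarrow> l2_dvd M d (a \<otimes> b)"
  unfolding l2_dvd_def by (metis mul_assoc)

lemma dvd_mul2: "l2_dvd M d a \<Longrightarrow> l2_dvd M d (b \<otimes> a)"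
  unfolding l2_dvd_def by (metis mul_assoc mul_comm)

lemma dvd_diff:
  assumes "l2_dvd M d a" "l2_dvd M d (a \<oplus> b)"
  shows "l2_dvd M d b"
proof -
  obtain p q where p: "a = d \<otimes> p" "a \<oplus> b = d \<otimes> q"
    using assms unfolding l2_dvd_def by blast
  show ?thesis
  proof (cases "p \<preceq> q")
    case True
    then obtain k where "q = p \<oplus> k" unfolding le_iff_add by blast
    with p have "b = d \<otimes> k" by (simp add: distrib_left)
    then show ?thesis unfolding l2_dvd_def by blast
  next
    case False
    then obtain k where "p = q \<oplus> k" using linear le_iff_add[of q p] by blast
    with p have "a = (a \<oplus> b) \<oplus> d \<otimes> k" by (simp add: distrib_left)
    then have "a \<oplus> \<zero> = a \<oplus> (b \<oplus> d \<otimes> k)" by (simp add: add_assoc)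
    then have "\<zero> = b \<oplus> d \<otimes> k" unfolding add_left_cancel .
    then have "b = \<zero>" using le_add1[of b "d \<otimes> k"] by (metis not_less_zero)
    then show ?thesis unfolding l2_dvd_def by (metis mul_zero)
  qed
qed

text \<open>Coprimality of \<open>d\<close> and \<open>m\<close> in the form of a cancellation rule:
  \<open>d\<close> divides \<open>a \<otimes> m \<otimes> u\<close>, and also the sum of this with
  \<open>a\<close>, which is \<open>a \<otimes> d\<close>.\<close>

lemma dvd_cancel_unit:
  assumes "d = m \<otimes> u \<oplus> \<one>" "l2_dvd M d (a \<otimes> m)"
  shows "l2_dvd M d a"
proof (rule dvd_diff)
  show "l2_dvd M d (a \<otimes> m \<otimes> u)" using assms(2) by (rule dvd_mul)
  have "a \<otimes> m \<otimes> u \<oplus> a = a \<otimes> d" using assms(1) by (simp add: mul_assoc mul_suc)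
  then show "l2_dvd M d (a \<otimes> m \<otimes> u \<oplus> a)" using dvd_mul2 dvd_refl by simp
qed

abbreviation beta_mod :: "'a \<Rightarrow> 'a \<Rightarrow> 'a" where
  "beta_mod m i \<equiv> m \<otimes> (i \<oplus> \<one>) \<oplus> \<one>"

lemma beta_coprime_aux:
  assumes "l2_dvd M (beta_mod m i) (n \<otimes> (m \<otimes> r))" "l2_dvd M r m"
  shows "l2_dvd M (beta_mod m i) n"
proof -
  obtain q where q: "m = r \<otimes> q" using assms(2) unfolding l2_dvd_def by blast
  have "l2_dvd M (beta_mod m i) (n \<otimes> r \<otimes> m)" using assms(1) by (simp add: mul_ac)
  then have "l2_dvd M (beta_mod m i) (n \<otimes> r)" by (rule dvd_cancel_unit[rotated]) simp
  then have "l2_dvd M (beta_mod m i) (n \<otimes> r \<otimes> q)" by (rule dvd_mul)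
  then have "l2_dvd M (beta_mod m i) (n \<otimes> m)" using q by (simp add: mul_assoc)
  then show ?thesis by (rule dvd_cancel_unit[rotated]) simp
qed

lemma beta_coprime:
  assumes "l2_dvd M (beta_mod m i) (n \<otimes> beta_mod m j)" "i \<noteq> j" "i \<prec> k" "j \<prec> k"
    and m: "\<And>r. r \<noteq> \<zero> \<Longrightarrow> r \<prec> k \<Longrightarrow> l2_dvd M r m"
  shows "l2_dvd M (beta_mod m i) n"
proof -
  consider r where "j = i \<oplus> r" | r where "i = j \<oplus> r"
    using linear[of i j] le_iff_add by metis
  then show ?thesis
  proof cases
    case 1
    have "r \<noteq> \<zero>" using 1 assms(2) by auto
    moreover have "r \<prec> k" using le_less_trans[OF le_add2[of r i], of k] 1 assms(4) by simp
    ultimately have r: "l2_dvd M r m" by (rule m)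
    have "n \<otimes> beta_mod m j = n \<otimes> beta_mod m i \<oplus> n \<otimes> (m \<otimes> r)"
      using 1 by (simp add: distrib_left distrib_right add_ac)
    with assms(1) have "l2_dvd M (beta_mod m i) (n \<otimes> (m \<otimes> r))"
      using dvd_diff[OF dvd_mul2[OF dvd_refl]] by metis
    then show ?thesis using r by (rule beta_coprime_aux)
  next
    case 2
    have "r \<noteq> \<zero>" using 2 assms(2) by auto
    moreover have "r \<prec> k" using le_less_trans[OF le_add2[of r j], of k] 2 assms(3) by simp
    ultimately have r: "l2_dvd M r m" by (rule m)
    have "n \<otimes> beta_mod m i = n \<otimes> beta_mod m j \<oplus> n \<otimes> (m \<otimes> r)"
      using 2 by (simp add: distrib_left distrib_right add_ac)
    with assms(1) have "l2_dvd M (beta_mod m i) (n \<otimes> (m \<otimes> r))"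
      using dvd_diff dvd_mul2[OF dvd_refl] by metis
    then show ?thesis using r by (rule beta_coprime_aux)
  qed
qed

text \<open>The role of a factorial: with this \<open>m\<close>, the moduli
  \<open>beta_mod m i\<close> for \<open>i \<prec> k\<close> are pairwise coprime, and
  \<open>m \<noteq> \<zero>\<close> makes them different from \<open>\<one>\<close>.\<close>

lemma common_multiple: "\<exists>m. m \<noteq> \<zero> \<and> (\<forall>r. r \<noteq> \<zero> \<and> r \<prec> k \<longrightarrow> l2_dvd M r m)"
proof (induction k rule: m_induct)
  show "ar (\<lambda>e. \<exists>m. m \<noteq> \<zero> \<and> (\<forall>r. r \<noteq> \<zero> \<and> r \<prec> e 0 \<longrightarrow> l2_dvd M r m))"
    unfolding l2_dvd_def by (intro ar_intros)
next
  case zero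
  show ?case using one_neq_zero(1) by (intro exI[of _ \<one>]) auto
next
  case (suc k)
  then obtain m where m: "m \<noteq> \<zero>" "\<And>r. r \<noteq> \<zero> \<Longrightarrow> r \<prec> k \<Longrightarrow> l2_dvd M r m" by blast
  show ?case
  proof (cases "k = \<zero>")
    case True
    then show ?thesis using m by (auto simp: less_suc)
  next
    case False
    have "m \<otimes> k \<noteq> \<zero>" using mul_left_cancel[of m k \<zero>] m(1) False by auto
    then show ?thesis using m dvd_mul[of _ m k] dvd_mul2[OF dvd_refl, of k m]
      by (intro exI[of _ "m \<otimes> k"]) (auto simp: less_suc)
  qed
qed

text \<open>The code is the product of the moduli \<open>beta_mod m i\<close> with
  \<open>i \<in> A\<close>, built up one factor at a time. By coprimality no other modulus with
  index below \<open>k\<close> divides it. The claim for partial products is arithmetical in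
  \<open>A\<close>.\<close>

lemma fin_bounded:
  assumes "A \<in> Sets M" "A \<subseteq> below M k"
  shows "fin M A"
proof -
  obtain m where m: "m \<noteq> \<zero>" "\<And>r. r \<noteq> \<zero> \<Longrightarrow> r \<prec> k \<Longrightarrow> l2_dvd M r m"
    using common_multiple by blast
  have "\<exists>n. \<forall>i. i \<prec> k \<longrightarrow> (l2_dvd M (beta_mod m i) n \<longleftrightarrow> i \<prec> j \<and> i \<in> A)" if "j \<preceq> k" for j
  proof -
    have "j \<preceq> k \<longrightarrow> (\<exists>n. \<forall>i. i \<prec> k \<longrightarrow> (l2_dvd M (beta_mod m i) n \<longleftrightarrow> i \<prec> j \<and> i \<in> A))"
    proof (induction j rule: m_induct)
      show "ar (\<lambda>e. e 0 \<preceq> k \<longrightarrow> (\<exists>n. \<forall>i. i \<prec> k \<longrightarrow> (l2_dvd M (beta_mod m i) n \<longleftrightarrow> i \<prec> e 0 \<and> i \<in> A)))"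
        unfolding l2_dvd_def by (intro ar_intros ar_mem[OF assms(1)])
    next
      case zero
      \<comment> \<open>The empty product: every modulus exceeds \<open>\<one>\<close> because
        \<open>m \<noteq> \<zero>\<close>.\<close>
      have "\<not> l2_dvd M (beta_mod m i) \<one>" for i
      proof
        assume "l2_dvd M (beta_mod m i) \<one>"
        then obtain q where q: "\<one> = beta_mod m i \<otimes> q" unfolding l2_dvd_def by blast
        have "q \<noteq> \<zero>" using q by auto
        then have "\<one> \<preceq> q" using suc_le[of \<zero> q] neq_zero by simp
        then have "beta_mod m i \<otimes> \<one> \<preceq> beta_mod m i \<otimes> q" by (intro mul_le_mono) auto
        then have "beta_mod m i \<preceq> \<one>" unfolding q[symmetric] by simp
        moreover have "m \<otimes> (i \<oplus> \<one>) \<noteq> \<zero>" using mul_left_cancel[of m "i \<oplus> \<one>" \<zero>] m(1) by auto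
        ultimately show False using suc_le[of "m \<otimes> (i \<oplus> \<one>)" \<one>] by simp
      qed
      then show ?case by auto
    next
      case (suc j)
      show ?case
      proof
        assume "j \<oplus> \<one> \<preceq> k"
        then have j: "j \<prec> k" by (simp add: suc_le)
        with suc obtain n where n: "\<And>i. i \<prec> k \<Longrightarrow> l2_dvd M (beta_mod m i) n \<longleftrightarrow> i \<prec> j \<and> i \<in> A"
          by blast
        show "\<exists>n. \<forall>i. i \<prec> k \<longrightarrow> (l2_dvd M (beta_mod m i) n \<longleftrightarrow> i \<prec> j \<oplus> \<one> \<and> i \<in> A)"
        proof (cases "j \<in> A")
          case True
          have "l2_dvd M (beta_mod m i) (n \<otimes> beta_mod m j) \<longleftrightarrow> i \<prec> j \<oplus> \<one> \<and> i \<in> A"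
            if i: "i \<prec> k" for i
          proof (cases "i = j")
            case True
            then show ?thesis using \<open>j \<in> A\<close> dvd_mul2[OF dvd_refl] by simp
          next
            case False
            then have "l2_dvd M (beta_mod m i) (n \<otimes> beta_mod m j) \<longleftrightarrow> l2_dvd M (beta_mod m i) n"
              using beta_coprime[OF _ False i j m(2)] dvd_mul by blast
            then show ?thesis using n[OF i] False by (simp add: less_suc)
          qed
          then show ?thesis by blast
        next
          case False
          then have "l2_dvd M (beta_mod m i) n \<longleftrightarrow> i \<prec> j \<oplus> \<one> \<and> i \<in> A" if "i \<prec> k" for i
            using n[OF that] by (auto simp: less_suc)
          then show ?thesis by blast
        qed
      qed
    qed
    with that show ?thesis by blast
  qed
  from this[of k] obtain n where n: "\<And>i. i \<prec> k \<Longrightarrow> l2_dvd M (beta_mod m i) n \<longleftrightarrow> i \<prec> k \<and> i \<in> A"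
    by blast
  have "elts M (pr M k (pr M m n)) = A"
    using n assms(2) by (auto simp: elts_def below_def)
  then show ?thesis unfolding fin_def by blast
qed

lemma fin_coded:
  assumes "fin M A"
  shows "A \<in> Sets M"
proof -
  obtain a where "A = elts M a" using assms unfolding fin_def by blast
  then have "A = {n. n \<in> elts M a}" by auto
  also have "\<dots> \<in> Sets M" by (intro comprehension ar_intros)
  finally show ?thesis .
qed

lemma elts_bounded: "\<exists>k. elts M a \<subseteq> below M k"
  unfolding elts_def below_def
  by (cases "\<exists>k m n. a = pr M k (pr M m n)") auto

text \<open>From here on, finiteness in the structure means boundedness of a coded set, and
  divisibility does not occur any more.\<close>

lemma fin_iff: "fin M A \<longleftrightarrow> A \<in> Sets M \<and> (\<exists>k. A \<subseteq> below M k)"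
  using fin_bounded fin_coded elts_bounded unfolding fin_def by metis

lemma elts_fcode:
  assumes "fin M A"
  shows "elts M (fcode M A) = A"
proof -
  obtain a where a: "elts M a = A" using assms unfolding fin_def by blast
  have "ar (\<lambda>e. \<forall>x. x \<in> elts M (e 0) \<longleftrightarrow> x \<in> elts M a)" by (intro ar_intros)
  then have "ar (\<lambda>e. elts M (e 0) = A)" using a by (simp add: set_eq_iff)
  from least_ex[of "\<lambda>b. elts M b = A", OF this a]
  obtain c where c: "elts M c = A \<and> (\<forall>b. b \<prec> c \<longrightarrow> elts M b \<noteq> A)" by blast
  have "fcode M A = c" unfolding fcode_def
    using c linear by (intro the_equality) blast+
  with c show ?thesis by simp
qed

lemma fcode_inj: "fin M A \<Longrightarrow> fin M B \<Longrightarrow> fcode M A = fcode M B \<longleftrightarrow> A = B"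
  using elts_fcode by metis

lemma af_fcode [ar_intros]:
  assumes "ar (\<lambda>e. R (e 0) (\<lambda>n. e (Suc n)))"
  shows "af (\<lambda>e. fcode M {x. R x e})"
proof -
  \<comment> \<open>On sets without a code, \<open>fcode\<close> is a description with no witness.
    Its value is unspecified but always the same element \<open>u\<close>, which can serve as a
    constant, so \<open>fcode\<close> is definable without a finiteness condition.\<close>
  define u where "u = (THE a :: 'a. False)"
  define c where "c a A \<longleftrightarrow> (\<forall>x. x \<in> elts M a \<longleftrightarrow> x \<in> A)" for a A
  have eq: "y = fcode M A \<longleftrightarrow> (c y A \<and> (\<forall>b. b \<prec> y \<longrightarrow> \<not> c b A)) \<or>
      ((\<forall>a. \<not> (c a A \<and> (\<forall>b. b \<prec> a \<longrightarrow> \<not> c b A))) \<and> y = u)" for y A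
  proof (cases "\<exists>a. c a A \<and> (\<forall>b. b \<prec> a \<longrightarrow> \<not> c b A)")
    case True
    then obtain a where a: "c a A \<and> (\<forall>b. b \<prec> a \<longrightarrow> \<not> c b A)" by blast
    have "fcode M A = a" unfolding fcode_def
      using a linear unfolding c_def by (intro the_equality) blast+
    with a show ?thesis using linear by blast
  next
    case False
    then have "(\<lambda>a. elts M a = A \<and> (\<forall>b. b \<prec> a \<longrightarrow> elts M b \<noteq> A)) = (\<lambda>_. False)"
      unfolding c_def by (metis set_eq_iff)
    then have "fcode M A = u" unfolding fcode_def u_def by (rule arg_cong)
    with False show ?thesis by blast
  qed
  show ?thesis unfolding af_def eq c_def mem_Collect_eq by (intro ar_intros ar_lift[OF assms])
qed

section \<open>Finite sequences, recursion and enumerations\<close>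


abbreviation "rel1 P \<equiv> ar (\<lambda>e. P (e 0))"
abbreviation "rel2 P \<equiv> ar (\<lambda>e. P (e 0) (e 1))"
abbreviation "rel3 P \<equiv> ar (\<lambda>e. P (e 0) (e 1) (e 2))"
abbreviation "fn1 f \<equiv> af (\<lambda>e. f (e 0))"
abbreviation "fn2 f \<equiv> af (\<lambda>e. f (e 0) (e 1))"
abbreviation "fn3 f \<equiv> af (\<lambda>e. f (e 0) (e 1) (e 2))"

lemma ar_if [ar_intros]: "ar P \<Longrightarrow> ar Q \<Longrightarrow> ar R \<Longrightarrow> ar (\<lambda>e. if P e then Q e else R e)"
  unfolding if_bool_eq_conj by (intro ar_intros)

lemma af_if [ar_intros]:
  assumes "ar P" "af f" "af g"
  shows "af (\<lambda>e. if P e then f e else g e)"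
  using ar_if[OF ar_weaken[OF assms(1)] assms(2,3)[unfolded af_def]]
  unfolding af_def by (simp add: if_distrib[of "(=) _"])

lemma le_induct [case_names definable base suc]:
  assumes "rel1 P" "P k" "\<And>n. k \<preceq> n \<Longrightarrow> P n \<Longrightarrow> P (n \<oplus> \<one>)" "k \<preceq> n"
  shows "P n"
proof -
  have "k \<preceq> n \<longrightarrow> P n"
  proof (induction n rule: m_induct)
    show "ar (\<lambda>e. k \<preceq> e 0 \<longrightarrow> P (e 0))" by (intro ar_intros assms(1))
  qed (use assms(2,3) in \<open>auto simp: less_suc\<close>)
  with assms(4) show ?thesis by simp
qed

text \<open>The graph enters through its least code, so a sequence is determined by its length and
  entries (\<open>seq_ext\<close>) and equality of numbers can serve as equality of
  sequences.\<close>

definition seq :: "'a \<Rightarrow> ('a \<Rightarrow> 'a) \<Rightarrow> 'a" where "seq l f = pr M l (fcode M (fgraph M l f))"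
definition ap :: "'a \<Rightarrow> 'a \<Rightarrow> 'a" where "ap c i = lst (\<lambda>j. pr M i j \<in> elts M (p2 c))"
definition isseq :: "'a \<Rightarrow> bool" where "isseq c \<longleftrightarrow> c = seq (p1 c) (ap c)"

lemma mem_below [simp]: "i \<in> below M n \<longleftrightarrow> i \<prec> n"
  by (simp add: below_def)

lemma fgraph_alt: "fgraph M n f = {x. \<exists>i. x = pr M i (f i) \<and> i \<prec> n}"
  by (auto simp: fgraph_def)

lemma fgraph_cong: "(\<And>i. i \<prec> l \<Longrightarrow> f i = g i) \<Longrightarrow> fgraph M l f = fgraph M l g"
  unfolding fgraph_alt by auto

lemma pr_mem_fgraph [simp]: "pr M i j \<in> fgraph M l f \<longleftrightarrow> i \<prec> l \<and> j = f i"
  unfolding fgraph_alt by auto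

lemma fin_fgraph:
  assumes "fn1 f"
  shows "fin M (fgraph M l f)"
proof -
  note [ar_intros] = af_sub1[OF assms]
  have "\<exists>b. \<forall>i. i \<prec> l \<longrightarrow> pr M i (f i) \<prec> b"
  proof (induction l rule: m_induct)
    show "ar (\<lambda>e. \<exists>b. \<forall>i. i \<prec> e 0 \<longrightarrow> pr M i (f i) \<prec> b)" by (intro ar_intros)
  next
    case (suc n)
    then obtain b where b: "\<And>i. i \<prec> n \<Longrightarrow> pr M i (f i) \<prec> b" by blast
    have "pr M i (f i) \<prec> b \<oplus> (pr M n (f n) \<oplus> \<one>)" if "i \<prec> n \<oplus> \<one>" for i
    proof (cases "i = n")
      case True
      have "pr M n (f n) \<prec> pr M n (f n) \<oplus> \<one>" by simp
      also have "pr M n (f n) \<oplus> \<one> \<preceq> b \<oplus> (pr M n (f n) \<oplus> \<one>)" by (rule le_add2)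
      finally show ?thesis using True by simp
    next
      case False
      with that have "pr M i (f i) \<prec> b" by (auto simp: less_suc b)
      also have "b \<preceq> b \<oplus> (pr M n (f n) \<oplus> \<one>)" by (rule le_add1)
      finally show ?thesis .
    qed
    then show ?case by blast
  qed simp
  then obtain b where "\<And>i. i \<prec> l \<Longrightarrow> pr M i (f i) \<prec> b" by blast
  then have "fgraph M l f \<subseteq> below M b" unfolding fgraph_alt by auto
  moreover have "fgraph M l f \<in> Sets M"
    unfolding fgraph_alt by (intro comprehension ar_intros)
  ultimately show ?thesis by (simp add: fin_bounded)
qed

lemma af_fgraph [ar_intros]:
  assumes "af l" "af (\<lambda>e. g (e 0) (\<lambda>n. e (Suc n)))"
  shows "af (\<lambda>e. fcode M (fgraph M (l e) (\<lambda>i. g i e)))"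
proof -
  \<comment> \<open>Inside the comprehension the index is bound below the element of the graph, so
    the environment of \<open>g\<close> has to skip one more variable.\<close>
  have "ar (\<lambda>e. e 0 = g (e 1) (\<lambda>n. e (Suc (Suc (Suc n)))))"
    using ar_lift[OF assms(2)[unfolded af_def], of "\<lambda>e. e 0" "case_nat (\<lambda>e. e 1) (\<lambda>n e. e (Suc (Suc (Suc n))))"]
    by (simp add: af_var split: nat.split)
  then have [ar_intros]: "af (\<lambda>e. g (e 0) (\<lambda>n. e (Suc (Suc n))))" by (simp add: af_def)
  show ?thesis unfolding fgraph_alt by (intro ar_intros af_weaken[OF af_weaken[OF assms(1)]])
qed

lemma af_seq [ar_intros]:
  "af l \<Longrightarrow> af (\<lambda>e. g (e 0) (\<lambda>n. e (Suc n))) \<Longrightarrow> af (\<lambda>e. seq (l e) (\<lambda>i. g i e))"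
  unfolding seq_def by (intro ar_intros)

lemma af_ap [ar_intros]: "af s \<Longrightarrow> af t \<Longrightarrow> af (\<lambda>e. ap (s e) (t e))"
  by (rule af_sub2) (unfold ap_def, intro ar_intros)

lemma ar_isseq [ar_intros]: "af s \<Longrightarrow> ar (\<lambda>e. isseq (s e))"
  by (rule ar_sub1) (unfold isseq_def, intro ar_intros)

lemma p1_seq [simp]: "p1 (seq l f) = l"
  by (simp add: seq_def)

lemma ap_seq:
  assumes "fin M (fgraph M l f)" "i \<prec> l"
  shows "ap (seq l f) i = f i"
  unfolding ap_def seq_def using assms by (simp add: elts_fcode lst_unique)

lemma ap_seq_fn1 [simp]: "fn1 f \<Longrightarrow> i \<prec> l \<Longrightarrow> ap (seq l f) i = f i"
  by (intro ap_seq fin_fgraph)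

lemma fn1_ap: "fn1 (ap c)"
  by (intro ar_intros)

lemma seq_cong: "(\<And>i. i \<prec> l \<Longrightarrow> f i = g i) \<Longrightarrow> seq l f = seq l g"
  unfolding seq_def using fgraph_cong by metis

lemma isseq_seq: "fin M (fgraph M l f) \<Longrightarrow> isseq (seq l f)"
  unfolding isseq_def by (simp, rule seq_cong) (simp add: ap_seq)

lemma isseq_seq_fn1 [simp]: "fn1 f \<Longrightarrow> isseq (seq l f)"
  by (intro isseq_seq fin_fgraph)

lemma seq_ext:
  "isseq c \<Longrightarrow> isseq d \<Longrightarrow> p1 c = p1 d \<Longrightarrow> (\<And>i. i \<prec> p1 c \<Longrightarrow> ap c i = ap d i) \<Longrightarrow> c = d"
  unfolding isseq_def using seq_cong[of "p1 c" "ap c" "ap d"] by metis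

text \<open>Courses of values of length \<open>n \<oplus> \<one>\<close> exist by arithmetical
  induction and agree with each other, and the least one is taken. The values are numbers, so a
  recursion on functions is possible only through finite tables, which is where the parameter
  \<open>b\<close> will be used as a bound.\<close>

lemma recursion:
  assumes "fn1 A" "fn3 G"
  obtains H where "fn2 H" "\<And>b. H b \<zero> = A b" "\<And>b n. H b (n \<oplus> \<one>) = G b n (H b n)"
proof -
  note [ar_intros] = af_sub1[OF assms(1)] af_sub3[OF assms(2)]
  define good where "good b n c \<longleftrightarrow> isseq c \<and> p1 c = n \<oplus> \<one> \<and> ap c \<zero> = A b \<and>
    (\<forall>i. i \<prec> n \<longrightarrow> ap c (i \<oplus> \<one>) = G b i (ap c i))" for b n c
  have good_ar [ar_intros]: "ar (\<lambda>e. good (s e) (t e) (u e))" if "af s" "af t" "af u" for s t u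
    by (rule ar_sub3[OF _ that]) (unfold good_def, intro ar_intros)
  have ex: "\<exists>c. good b n c" for b n
  proof (induction n rule: m_induct)
    show "ar (\<lambda>e. \<exists>c. good b (e 0) c)" by (intro ar_intros)
  next
    case zero
    have "fn1 (\<lambda>_. A b)" by (intro ar_intros)
    then show ?case by (intro exI[of _ "seq \<one> (\<lambda>_. A b)"]) (simp add: good_def)
  next
    case (suc n)
    then obtain c where c: "good b n c" by blast
    define f where "f i = (if i \<prec> n \<oplus> \<one> then ap c i else G b n (ap c n))" for i
    have f: "fn1 f" unfolding f_def by (intro ar_intros)
    have "f (i \<oplus> \<one>) = G b i (f i)" if "i \<prec> n \<oplus> \<one>" for i
    proof (cases "i = n")
      case False
      with that have "i \<prec> n" by (simp add: less_suc)
      with c that show ?thesis by (simp add: f_def good_def)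
    qed (simp add: f_def)
    moreover have "f \<zero> = A b" using c by (simp add: f_def good_def)
    moreover have "i \<prec> n \<oplus> \<one> \<oplus> \<one>" if "i \<prec> n \<oplus> \<one>" for i
      using that less_trans less_suc_self by blast
    ultimately have "good b (n \<oplus> \<one>) (seq (n \<oplus> \<one> \<oplus> \<one>) f)"
      using f by (simp add: good_def)
    then show ?case by blast
  qed
  have uniq: "ap c i = ap d i" if "good b n c" "good b m d" "i \<preceq> n" "i \<preceq> m" for b n m c d i
  proof -
    have "i \<preceq> n \<and> i \<preceq> m \<longrightarrow> ap c i = ap d i"
    proof (induction i rule: m_induct)
      show "ar (\<lambda>e. e 0 \<preceq> n \<and> e 0 \<preceq> m \<longrightarrow> ap c (e 0) = ap d (e 0))" by (intro ar_intros)
    next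
      case zero
      then show ?case using that(1,2) by (simp add: good_def)
    next
      case (suc i)
      show ?case
      proof
        assume "i \<oplus> \<one> \<preceq> n \<and> i \<oplus> \<one> \<preceq> m"
        then have "i \<prec> n" "i \<prec> m" by (simp_all add: suc_le)
        with suc that(1,2) show "ap c (i \<oplus> \<one>) = ap d (i \<oplus> \<one>)" by (simp add: good_def)
      qed
    qed
    with that(3,4) show ?thesis by blast
  qed
  define H where "H b n = ap (lst (good b n)) n" for b n
  have g: "good b n (lst (good b n))" for b n
  proof -
    have "rel1 (good b n)" by (intro ar_intros)
    with ex show ?thesis using lst_spec(1)[of "good b n"] by blast
  qed
  show ?thesis
  proof
    show "fn2 H" unfolding H_def by (intro ar_intros)
    show "H b \<zero> = A b" for b using g[of b \<zero>] by (simp add: H_def good_def)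
    show "H b (n \<oplus> \<one>) = G b n (H b n)" for b n
      using g[of b "n \<oplus> \<one>"] uniq[OF g[of b n] g[of b "n \<oplus> \<one>"], of n] by (simp add: H_def good_def)
  qed
qed

section \<open>Well-foundedness through minimal elements\<close>

definition minimal_principle :: "('a \<Rightarrow> 'a \<Rightarrow> bool) \<Rightarrow> bool" where
  "minimal_principle L \<longleftrightarrow> (\<forall>P a. rel1 P \<longrightarrow> P a \<longrightarrow> (\<exists>m. P m \<and> (\<forall>y. L y m \<longrightarrow> \<not> P y)))"

lemma minimal_principleD:
  assumes "minimal_principle L" "rel1 P" "P a"
  obtains m where "P m" "\<And>y. L y m \<Longrightarrow> \<not> P y"
  using assms unfolding minimal_principle_def by blast

lemma minimal_principle_less: "minimal_principle (Less M)"
  unfolding minimal_principle_def using least_ex by blast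

lemma seq_coded: "fn1 s \<Longrightarrow> {pr M i (s i) | i. True} \<in> Sets M"
proof -
  assume "fn1 s"
  note [ar_intros] = af_sub1[OF this]
  have "{x. \<exists>i. x = pr M i (s i)} \<in> Sets M" by (intro comprehension ar_intros)
  then show ?thesis by simp
qed

lemma fn1_coded: "{pr M i (s i) | i. True} \<in> Sets M \<Longrightarrow> fn1 s"
proof -
  assume "{pr M i (s i) | i. True} \<in> Sets M" (is "?S \<in> _")
  then have "ar (\<lambda>e. pr M (e 1) (e 0) \<in> ?S)" by (intro ar_mem ar_intros)
  then show ?thesis unfolding af_def by simp
qed

text \<open>Without a minimal element, the least-number choice of a smaller element can be iterated
  by \<open>recursion\<close>. The resulting descending sequence is definable, hence coded, against
  \<open>well_founded\<close>.\<close>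

lemma well_founded_minimal:
  assumes "well_founded M r" "rel2 (lt r)"
  shows "minimal_principle (lt r)"
  unfolding minimal_principle_def
proof (intro allI impI, rule ccontr)
  fix P a assume P: "rel1 P" "P a" and neg: "\<not> (\<exists>m. P m \<and> (\<forall>y. lt r y m \<longrightarrow> \<not> P y))"
  note [ar_intros] = ar_sub1[OF P(1)] ar_sub2[OF assms(2)]
  define nxt where "nxt x = lst (\<lambda>y. P y \<and> lt r y x)" for x
  have nxt: "P (nxt x) \<and> lt r (nxt x) x" if Px: "P x" for x
  proof -
    obtain y where y: "P y \<and> lt r y x" using neg Px by blast
    have "ar (\<lambda>e. P (e 0) \<and> lt r (e 0) x)" by (intro ar_intros)
    then show ?thesis using lst_spec(1)[of "\<lambda>y. P y \<and> lt r y x"] y unfolding nxt_def by blast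
  qed
  have nxt_fn: "fn1 nxt" unfolding nxt_def by (intro ar_intros)
  obtain H where H: "fn2 H" "\<And>b. H b \<zero> = a" "\<And>b n. H b (n \<oplus> \<one>) = nxt (H b n)"
  proof (rule recursion[of "\<lambda>_. a" "\<lambda>_ _. nxt"])
    show "fn1 (\<lambda>_. a)" "fn3 (\<lambda>_ _. nxt)" by (intro ar_intros af_sub1[OF nxt_fn])+
  qed blast
  let ?s = "H \<zero>"
  have s: "fn1 ?s" by (intro af_sub2[OF H(1)] ar_intros)
  have Ps: "P (?s n)" for n
  proof (induction n rule: m_induct)
    show "ar (\<lambda>e. P (?s (e 0)))" by (intro ar_intros s)
  qed (use H nxt P in auto)
  have "\<forall>i. lt r (?s (i \<oplus> \<one>)) (?s i)" using H(3) nxt Ps by simp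
  with seq_coded[OF s] assms(1) show False unfolding well_founded_def by blast
qed

text \<open>A minimal element among the values from stage \<open>k\<close> on is attained at some
  \<open>l\<close>, and from there no further drop is possible.\<close>

lemma eventually_constant:
  assumes "minimal_principle L" "fn1 u"
    and step: "\<And>i. k \<preceq> i \<Longrightarrow> u (i \<oplus> \<one>) = u i \<or> L (u (i \<oplus> \<one>)) (u i)"
  obtains l where "k \<preceq> l" "\<And>i. l \<preceq> i \<Longrightarrow> u i = u l"
proof -
  note [ar_intros] = af_sub1[OF assms(2)]
  have "rel1 (\<lambda>x. \<exists>i. k \<preceq> i \<and> x = u i)" by (intro ar_intros)
  moreover have "\<exists>i. k \<preceq> i \<and> u k = u i" by blast
  ultimately obtain m where m: "\<exists>i. k \<preceq> i \<and> m = u i" "\<And>y. L y m \<Longrightarrow> \<not> (\<exists>i. k \<preceq> i \<and> y = u i)"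
    by (rule minimal_principleD[OF assms(1)]) blast
  then obtain l where l: "k \<preceq> l" "m = u l" by blast
  have "u i = u l" if "l \<preceq> i" for i
  proof (rule le_induct[OF _ _ _ that])
    show "rel1 (\<lambda>i. u i = u l)" by (intro ar_intros)
    fix n assume n: "l \<preceq> n" "u n = u l"
    then have "k \<preceq> n" "k \<preceq> n \<oplus> \<one>" using l(1) less_suc_self less_trans by blast+
    then show "u (n \<oplus> \<one>) = u l" using step[of n] m(2)[of "u (n \<oplus> \<one>)"] n l by auto
  qed simp
  with l(1) show ?thesis by (rule that)
qed

section \<open>The pigeonhole principle and cardinalities\<close>

lemma pigeonhole:
  assumes "isseq g" "\<And>i j. i \<prec> p1 g \<Longrightarrow> j \<prec> p1 g \<Longrightarrow> ap g i = ap g j \<Longrightarrow> i = j"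
    and "\<And>i. i \<prec> p1 g \<Longrightarrow> ap g i \<prec> n"
  shows "p1 g \<preceq> n"
proof -
  \<comment> \<open>The induction hypothesis is applied to a modified sequence. Quantifying over
    \<open>g\<close> means quantifying over codes, so the predicate stays arithmetical.\<close>
  have "\<forall>g. isseq g \<and> (\<forall>i j. i \<prec> p1 g \<and> j \<prec> p1 g \<and> ap g i = ap g j \<longrightarrow> i = j) \<and>
    (\<forall>i. i \<prec> p1 g \<longrightarrow> ap g i \<prec> n) \<longrightarrow> p1 g \<preceq> n"
  proof (induction n rule: m_induct)
    show "ar (\<lambda>e. \<forall>g. isseq g \<and> (\<forall>i j. i \<prec> p1 g \<and> j \<prec> p1 g \<and> ap g i = ap g j \<longrightarrow> i = j) \<and>
        (\<forall>i. i \<prec> p1 g \<longrightarrow> ap g i \<prec> e 0) \<longrightarrow> p1 g \<preceq> e 0)"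
      by (intro ar_intros)
  next
    case zero
    then show ?case using neq_zero by auto
  next
    case (suc n)
    note IH = suc[rule_format]
    show ?case
    proof (intro allI impI, elim conjE)
      fix g assume g: "isseq g" "\<forall>i j. i \<prec> p1 g \<and> j \<prec> p1 g \<and> ap g i = ap g j \<longrightarrow> i = j"
        "\<forall>i. i \<prec> p1 g \<longrightarrow> ap g i \<prec> n \<oplus> \<one>"
      show "p1 g \<preceq> n \<oplus> \<one>"
      proof (cases "p1 g" rule: cases_m)
        case zero
        then show ?thesis by simp
      next
        case (suc m)
        \<comment> \<open>The last entry is removed. If the largest value \<open>n\<close> occurs
          earlier, the removed value takes its place, so all values of the shorter sequence lie
          below \<open>n\<close>.\<close>
        define f where "f i = (if ap g i = n then ap g m else ap g i)" for i
        have f: "fn1 f" unfolding f_def by (intro ar_intros)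
        have m: "m \<prec> p1 g" "\<And>i. i \<prec> m \<Longrightarrow> i \<prec> p1 g \<and> i \<noteq> m" using suc by (auto simp: less_suc)
        have "m \<preceq> n"
        proof -
          have inj: "i = j" if "i \<prec> m" "j \<prec> m" "f i = f j" for i j
            using g(2) m that unfolding f_def by (metis (full_types))
          have bd: "f i \<prec> n" if "i \<prec> m" for i
            using g(2,3) m that unfolding f_def less_suc by metis
          have "p1 (seq m f) \<preceq> n"
          proof (rule IH, intro conjI allI impI)
            fix i j assume "i \<prec> p1 (seq m f) \<and> j \<prec> p1 (seq m f) \<and> ap (seq m f) i = ap (seq m f) j"
            then show "i = j" using inj f by auto
          next
            fix i assume "i \<prec> p1 (seq m f)"
            then show "ap (seq m f) i \<prec> n" using bd f by simp
          qed (rule isseq_seq_fn1[OF f])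
          then show ?thesis by simp
        qed
        then show ?thesis using suc by auto
      qed
    qed
  qed
  with assms show ?thesis by blast
qed

definition slin :: "('a \<Rightarrow> 'a \<Rightarrow> bool) \<Rightarrow> 'a set \<Rightarrow> bool" where
  "slin L B \<longleftrightarrow> (\<forall>x. \<not> L x x) \<and> (\<forall>x y z. L x y \<longrightarrow> L y z \<longrightarrow> L x z) \<and>
    (\<forall>x\<in>B. \<forall>y\<in>B. L x y \<or> x = y \<or> L y x)"

lemma slin_irrefl: "slin L B \<Longrightarrow> \<not> L x x"
  and slin_trans: "slin L B \<Longrightarrow> L x y \<Longrightarrow> L y z \<Longrightarrow> L x z"
  and slin_total: "slin L B \<Longrightarrow> x \<in> B \<Longrightarrow> y \<in> B \<Longrightarrow> L x y \<or> x = y \<or> L y x"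
  unfolding slin_def by blast+

lemma slin_less: "slin (Less M) B"
  unfolding slin_def using less_trans linear by auto

lemma slin_lt:
  assumes "Linear_order r"
  shows "slin (lt r) (Field r)"
proof -
  have "antisym r" "trans r" "total_on (Field r) r"
    using assms by (simp_all add: linear_order_on_def partial_order_on_def preorder_on_def)
  then show ?thesis unfolding slin_def lt_def antisym_def trans_def total_on_def by blast
qed

definition inc :: "('a \<Rightarrow> 'a \<Rightarrow> bool) \<Rightarrow> 'a \<Rightarrow> bool" where
  "inc L g \<longleftrightarrow> isseq g \<and> (\<forall>i j. i \<prec> j \<and> j \<prec> p1 g \<longrightarrow> L (ap g i) (ap g j))"

definition vals :: "'a \<Rightarrow> 'a set" where "vals g = {x. \<exists>i. i \<prec> p1 g \<and> x = ap g i}"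

lemma ar_inc:
  assumes "rel2 L" "af s"
  shows "ar (\<lambda>e. inc L (s e))"
  by (rule ar_sub1[OF _ assms(2)]) (unfold inc_def, intro ar_intros ar_sub2[OF assms(1)])

lemma inc_iff:
  assumes "slin L B" "inc L g" "i \<prec> p1 g" "j \<prec> p1 g"
  shows inc_less_iff: "L (ap g i) (ap g j) \<longleftrightarrow> i \<prec> j"
    and inc_inj: "ap g i = ap g j \<longleftrightarrow> i = j"
  using assms linear[of i j] slin_irrefl[OF assms(1)] slin_trans[OF assms(1)] less_asym[of i j]
  unfolding inc_def by metis+

lemma fin_vals: "fin M (vals g)"
proof -
  have "\<exists>b. \<forall>i. i \<prec> l \<longrightarrow> ap g i \<prec> b" for l
  proof (induction l rule: m_induct)
    show "ar (\<lambda>e. \<exists>b. \<forall>i. i \<prec> e 0 \<longrightarrow> ap g i \<prec> b)" by (intro ar_intros)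
  next
    case (suc n)
    then obtain b where b: "\<And>i. i \<prec> n \<Longrightarrow> ap g i \<prec> b" by blast
    consider "ap g n \<prec> b" | "b \<preceq> ap g n" using linear by blast
    then show ?case
    proof cases
      case 1
      then show ?thesis using b by (intro exI[of _ b]) (auto simp: less_suc)
    next
      case 2
      then have "ap g i \<prec> ap g n \<oplus> \<one>" if "i \<prec> n" for i
        using b[OF that] less_trans less_suc by blast
      then show ?thesis by (intro exI[of _ "ap g n \<oplus> \<one>"]) (auto simp: less_suc)
    qed
  qed simp
  then obtain b where "\<And>i. i \<prec> p1 g \<Longrightarrow> ap g i \<prec> b" by blast
  then have "vals g \<subseteq> below M b" by (auto simp: vals_def)
  moreover have "vals g \<in> Sets M" unfolding vals_def by (intro comprehension ar_intros)
  ultimately show ?thesis by (simp add: fin_bounded)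
qed

lemma card_le:
  assumes "fin M (fgraph M n f)" "inj_on f (below M n)" "f ` below M n \<subseteq> A"
    and "fin M (fgraph M m h)" "A \<subseteq> h ` below M m"
  shows "n \<preceq> m"
proof -
  \<comment> \<open>Outside their domains, \<open>f\<close> and \<open>h\<close> are arbitrary.
    Reading them off from the codes of their graphs makes them definable.\<close>
  define f' where "f' = ap (seq n f)"
  define h' where "h' = ap (seq m h)"
  have f': "f' i = f i" if "i \<prec> n" for i using ap_seq[OF assms(1) that] by (simp add: f'_def)
  have h': "h' i = h i" if "i \<prec> m" for i using ap_seq[OF assms(4) that] by (simp add: h'_def)
  define q where "q i = lst (\<lambda>j. j \<prec> m \<and> h' j = f' i)" for i
  have q_fn: "fn1 q" unfolding q_def f'_def h'_def by (intro ar_intros)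
  have q: "q i \<prec> m \<and> h' (q i) = f i" if i: "i \<prec> n" for i
  proof -
    have "f i \<in> h ` below M m" using assms(3,5) i by (meson image_eqI mem_below subsetD)
    then obtain j where "j \<prec> m" "f i = h j" by auto
    then have j: "j \<prec> m" "h' j = f' i" using h' f'[OF i] by simp_all
    have "ar (\<lambda>e. e 0 \<prec> m \<and> h' (e 0) = f' i)" unfolding h'_def by (intro ar_intros)
    then show ?thesis using lst_spec(1)[of "\<lambda>j. j \<prec> m \<and> h' j = f' i"] j f'[OF i]
      unfolding q_def by auto
  qed
  have "p1 (seq n q) \<preceq> m"
  proof (rule pigeonhole)
    show "isseq (seq n q)" using q_fn by simp
    fix i j assume "i \<prec> p1 (seq n q)" "j \<prec> p1 (seq n q)" "ap (seq n q) i = ap (seq n q) j"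
    then have "i \<prec> n" "j \<prec> n" "q i = q j" using q_fn by simp_all
    then have "f i = f j" using q by metis
    then show "i = j" using assms(2) \<open>i \<prec> n\<close> \<open>j \<prec> n\<close> by (auto dest: inj_onD)
  next
    fix i assume "i \<prec> p1 (seq n q)"
    then show "ap (seq n q) i \<prec> m" using q q_fn by simp
  qed
  then show ?thesis by simp
qed

lemma fgraph_ap: "fin M (fgraph M n (ap g))"
  by (intro fin_fgraph fn1_ap)

lemma fcard_eqI:
  assumes "bij_betw f (below M n) A" "fin M (fgraph M n f)"
  shows "fcard M A = n"
  unfolding fcard_def
proof (rule the_equality)
  fix m assume "\<exists>h. bij_betw h (below M m) A \<and> fin M (fgraph M m h)"
  then obtain h where h: "bij_betw h (below M m) A" "fin M (fgraph M m h)" by blast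
  have "n \<preceq> m" "m \<preceq> n"
    using card_le[of n f A m h] card_le[of m h A n f] assms h by (auto simp: bij_betw_def)
  then show "m = n" using less_asym by blast
qed (use assms in blast)

lemma bij_inc:
  assumes "slin L B" "inc L g"
  shows "bij_betw (ap g) (below M (p1 g)) (vals g)"
  using inc_inj[OF assms] by (auto simp: bij_betw_def inj_on_def vals_def)

lemma fcard_vals: "slin L B \<Longrightarrow> inc L g \<Longrightarrow> fcard M (vals g) = p1 g"
  using fcard_eqI[OF bij_inc fgraph_ap] .

lemma inc_unique:
  assumes L: "slin L B" and g: "inc L g" "inc L h" "vals g = vals h"
  shows "g = h"
proof (rule seq_ext)
  show "isseq g" "isseq h" using g by (auto simp: inc_def)
  show len: "p1 g = p1 h" using fcard_vals[OF L g(1)] fcard_vals[OF L g(2)] g(3) by simp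
  \<comment> \<open>At the first difference, the smaller entry also occurs in the other sequence. It
    must occur there earlier, where both sequences agree, so the first sequence would repeat
    it.\<close>
  have *: False if "inc L g" "inc L h" "vals g = vals h" "p1 g = p1 h" "i \<prec> p1 g"
    "\<forall>k. k \<prec> i \<longrightarrow> ap g k = ap h k" "L (ap g i) (ap h i)" for g h i
  proof -
    have "ap g i \<in> vals h" using that(3,5) by (auto simp: vals_def)
    then obtain j where j: "j \<prec> p1 h" "ap g i = ap h j" by (auto simp: vals_def)
    then have "j \<prec> i" using that inc_less_iff[OF L that(2), of j i] by simp
    then have "ap g j = ap g i" using that(6) j by simp
    then show False using inc_inj[OF L that(1), of j i] j that \<open>j \<prec> i\<close> by simp
  qed
  have "i \<prec> p1 g \<longrightarrow> ap g i = ap h i" for i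
  proof (rule ccontr)
    assume "\<not> (i \<prec> p1 g \<longrightarrow> ap g i = ap h i)"
    moreover have "rel1 (\<lambda>i. \<not> (i \<prec> p1 g \<longrightarrow> ap g i = ap h i))" by (intro ar_intros)
    ultimately obtain k where k: "k \<prec> p1 g" "ap g k \<noteq> ap h k" "\<forall>j. j \<prec> k \<longrightarrow> (j \<prec> p1 g \<longrightarrow> ap g j = ap h j)"
      using least_ex[of "\<lambda>i. \<not> (i \<prec> p1 g \<longrightarrow> ap g i = ap h i)" i] by blast
    have eq: "\<forall>j. j \<prec> k \<longrightarrow> ap g j = ap h j" using k less_trans by blast
    have "ap g k \<in> vals g" "ap h k \<in> vals h" using k(1) len by (auto simp: vals_def)
    moreover have "L x y \<or> x = y \<or> L y x" if xy: "x \<in> vals g" "y \<in> vals g" for x y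
    proof -
      obtain i j where "i \<prec> p1 g" "x = ap g i" "j \<prec> p1 g" "y = ap g j"
        using xy unfolding vals_def by blast
      then show ?thesis using linear[of i j] inc_less_iff[OF L g(1)] by metis
    qed
    ultimately have "L (ap g k) (ap h k) \<or> L (ap h k) (ap g k)" using g(3) k(2) by blast
    then show False
      using *[OF g len k(1) eq] *[OF g(2,1) g(3)[symmetric] len[symmetric], of k] k(1) len eq by auto
  qed
  then show "\<And>i. i \<prec> p1 g \<Longrightarrow> ap g i = ap h i" by blast
qed

text \<open>Insertion sort: the elements of \<open>A\<close> below \<open>n\<close> are sorted
  already, and if \<open>n \<in> A\<close>, it is inserted at the first position \<open>p\<close>
  whose entry is missing or not smaller in the sense of \<open>L\<close>.\<close>

lemma inc_exists:
  assumes L: "slin L B" "rel2 L" and A: "fin M A" "A \<subseteq> B"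
  obtains g where "inc L g" "vals g = A"
proof -
  obtain k where k: "A \<subseteq> below M k" using A(1) fin_iff by blast
  note AS = fin_coded[OF A(1)]
  note [ar_intros] = ar_sub2[OF L(2)] ar_inc[OF L(2)] ar_mem[OF AS]
  have "\<exists>g. inc L g \<and> (\<forall>x. (\<exists>i. i \<prec> p1 g \<and> x = ap g i) \<longleftrightarrow> x \<prec> n \<and> x \<in> A)" for n
  proof (induction n rule: m_induct)
    show "ar (\<lambda>e. \<exists>g. inc L g \<and> (\<forall>x. (\<exists>i. i \<prec> p1 g \<and> x = ap g i) \<longleftrightarrow> x \<prec> e 0 \<and> x \<in> A))"
      by (intro ar_intros)
  next
    case zero
    have "fn1 (\<lambda>i. i)" by (intro ar_intros)
    then show ?case by (intro exI[of _ "seq \<zero> (\<lambda>i. i)"]) (simp add: inc_def)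
  next
    case (suc n)
    then obtain g where g: "inc L g" and gv: "\<And>x. (\<exists>i. i \<prec> p1 g \<and> x = ap g i) \<longleftrightarrow> x \<prec> n \<and> x \<in> A"
      by blast
    show ?case
    proof (cases "n \<in> A")
      case False
      then show ?thesis using g gv by (intro exI[of _ g]) (auto simp: less_suc)
    next
      case True
      have tot: "L (ap g i) n \<or> L n (ap g i)" if "i \<prec> p1 g" for i
      proof -
        have "ap g i \<prec> n \<and> ap g i \<in> A" using gv[of "ap g i"] that by blast
        then show ?thesis using True A(2) slin_total[OF L(1), of "ap g i" n] less_irrefl by blast
      qed
      define P where "P i \<longleftrightarrow> \<not> (i \<prec> p1 g \<and> L (ap g i) n)" for i
      have "rel1 P" unfolding P_def by (intro ar_intros)
      moreover have "P (p1 g)" by (simp add: P_def)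
      ultimately obtain p where p: "P p" "\<And>b. b \<prec> p \<Longrightarrow> \<not> P b" using least_ex by blast
      have p_le: "p \<preceq> p1 g" using p(2)[of "p1 g"] \<open>P (p1 g)\<close> linear by blast
      have low: "i \<prec> p1 g \<and> L (ap g i) n" if "i \<prec> p" for i using p(2)[OF that] by (simp add: P_def)
      have high: "L n (ap g i)" if "p \<preceq> i" "i \<prec> p1 g" for i
      proof -
        have "p \<prec> p1 g" using that le_less_trans by blast
        then have "L n (ap g p)" using p(1) tot[of p] by (auto simp: P_def)
        moreover have "p = i \<or> L (ap g p) (ap g i)" using that g by (auto simp: inc_def)
        ultimately show ?thesis using slin_trans[OF L(1)] by blast
      qed
      define f where "f i = (if i \<prec> p then ap g i else if i = p then n
        else ap g (lst (\<lambda>j. i = j \<oplus> \<one>)))" for i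
      have f: "fn1 f" unfolding f_def by (intro ar_intros)
      have f_suc: "f (i \<oplus> \<one>) = ap g i" if "p \<preceq> i" for i
      proof -
        have "p \<prec> i \<oplus> \<one>" using that by (auto simp: less_suc)
        then have "\<not> i \<oplus> \<one> \<prec> p" "i \<oplus> \<one> \<noteq> p" using less_asym by auto
        moreover have "lst (\<lambda>j. i \<oplus> \<one> = j \<oplus> \<one>) = i" by (rule lst_unique) auto
        ultimately show ?thesis by (simp add: f_def del: suc_inj)
      qed
      have f_low: "f i = ap g i" if "i \<prec> p" for i using that by (simp add: f_def)
      have f_p: "f p = n" by (simp add: f_def)
      \<comment> \<open>Positions of the new sequence: before the inserted element, at it, or the
        successor of an old position from \<open>p\<close> on.\<close>
      have cs: thesis if "i \<prec> p \<Longrightarrow> thesis" "i = p \<Longrightarrow> thesis"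
          "\<And>j. p \<preceq> j \<Longrightarrow> i = j \<oplus> \<one> \<Longrightarrow> thesis" for i thesis
      proof -
        have "thesis" if "p \<prec> i"
        proof (cases i rule: cases_m)
          case zero
          then show ?thesis using that by simp
        next
          case (suc j)
          then show ?thesis using that \<open>\<And>j. p \<preceq> j \<Longrightarrow> i = j \<oplus> \<one> \<Longrightarrow> thesis\<close>[of j]
            by (auto simp: less_suc)
        qed
        then show ?thesis using that linear by blast
      qed
      let ?h = "seq (p1 g \<oplus> \<one>) f"
      have "L (f i) (f j)" if ij: "i \<prec> j" "j \<prec> p1 g \<oplus> \<one>" for i j
      proof (cases rule: cs[of j])
        case 1
        then show ?thesis using ij low less_trans[of i j p] g f_low by (auto simp: inc_def)
      next
        case 2
        then show ?thesis using ij low f_low f_p by auto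
      next
        case (3 j')
        then have j': "j' \<prec> p1 g" "f j = ap g j'" using ij f_suc by simp_all
        have i: "i \<prec> j' \<or> i = j'" using ij 3 by (simp add: less_suc)
        show ?thesis
        proof (cases rule: cs[of i])
          case 1
          then show ?thesis using 3 j' f_low g less_le_trans[of i p j'] by (auto simp: inc_def)
        next
          case 2
          then show ?thesis using high 3 j' f_p by simp
        next
          case (3 i')
          then have "i' \<prec> j'" using i less_suc_self[of i'] less_trans[of i' i j'] by auto
          then show ?thesis using 3 j' f_suc g by (simp add: inc_def)
        qed
      qed
      then have "inc L ?h"
        using f less_trans[of _ _ "p1 g \<oplus> \<one>"] unfolding inc_def by (auto simp: less_trans)
      moreover have "(\<exists>i. i \<prec> p1 g \<oplus> \<one> \<and> x = f i) \<longleftrightarrow> x \<prec> n \<oplus> \<one> \<and> x \<in> A" for x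
      proof
        assume "\<exists>i. i \<prec> p1 g \<oplus> \<one> \<and> x = f i"
        then obtain i where i: "i \<prec> p1 g \<oplus> \<one>" "x = f i" by blast
        show "x \<prec> n \<oplus> \<one> \<and> x \<in> A"
        proof (cases rule: cs[of i])
          case 1
          then show ?thesis using gv[of x] i low f_low by (auto simp: less_suc)
        next
          case 2
          then show ?thesis using i f_p True by auto
        next
          case (3 j)
          then have "j \<prec> p1 g" "x = ap g j" using i f_suc by simp_all
          then show ?thesis using gv[of x] less_suc by blast
        qed
      next
        assume x: "x \<prec> n \<oplus> \<one> \<and> x \<in> A"
        show "\<exists>i. i \<prec> p1 g \<oplus> \<one> \<and> x = f i"
        proof (cases "x = n")
          case True
          then show ?thesis using f_p p_le by (intro exI[of _ p]) (auto simp: less_suc)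
        next
          case False
          then obtain i where i: "i \<prec> p1 g" "x = ap g i" using x gv by (auto simp: less_suc)
          show ?thesis
          proof (cases "i \<prec> p")
            case True
            then show ?thesis using i f_low by (intro exI[of _ i]) (simp add: less_suc)
          next
            case False
            then have "p \<preceq> i" using linear by blast
            then show ?thesis using i f_suc[of i] by (intro exI[of _ "i \<oplus> \<one>"]) simp
          qed
        qed
      qed
      ultimately show ?thesis using f by (intro exI[of _ ?h]) (simp cong: conj_cong)
    qed
  qed
  from this[of k] obtain g where "inc L g" "\<And>x. (\<exists>i. i \<prec> p1 g \<and> x = ap g i) \<longleftrightarrow> x \<prec> k \<and> x \<in> A"
    by blast
  moreover from this(2) have "vals g = A" using k by (auto simp: vals_def)
  ultimately show ?thesis using that by blast
qed

lemma rel2_lt: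
  assumes "{pr M x y | x y. (x, y) \<in> r} \<in> Sets M"
  shows "rel2 (lt r)"
proof -
  have "lt r x y \<longleftrightarrow> pr M x y \<in> {pr M x y | x y. (x, y) \<in> r} \<and> x \<noteq> y" for x y
    by (auto simp: lt_def)
  moreover have "ar (\<lambda>e. pr M (e 0) (e 1) \<in> {pr M x y | x y. (x, y) \<in> r} \<and> e 0 \<noteq> e 1)"
    by (intro ar_intros ar_mem[OF assms])
  ultimately show ?thesis by (simp only:)
qed

text \<open>Uniqueness of increasing sequences identifies the enumeration given by a description
  with the definable function \<open>ap g\<close>, so the given notions become computable from
  codes.\<close>

lemma enum_eq:
  assumes r: "Linear_order r" and g: "inc (lt r) g"
  shows "enum M r (vals g) = restrict (ap g) (below M (p1 g))"
proof -
  note L = slin_lt[OF r]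
  note c = fcard_vals[OF L g]
  let ?f = "restrict (ap g) (below M (p1 g))"
  have "bij_betw ?f (below M (p1 g)) (vals g)"
    using bij_inc[OF L g] bij_betw_cong[of "below M (p1 g)" ?f "ap g"] by simp
  moreover have "fin M (fgraph M (p1 g) ?f)"
    using fgraph_ap[of "p1 g" g] fgraph_cong[of "p1 g" ?f "ap g"] by simp
  moreover have "\<forall>i\<in>below M (p1 g). \<forall>j\<in>below M (p1 g). i \<prec> j \<longrightarrow> lt r (?f i) (?f j)"
    using g by (simp add: inc_def)
  moreover have "f = ?f" if f: "f \<in> extensional (below M (p1 g))" "bij_betw f (below M (p1 g)) (vals g)"
    "fin M (fgraph M (p1 g) f)" "\<forall>i\<in>below M (p1 g). \<forall>j\<in>below M (p1 g). i \<prec> j \<longrightarrow> lt r (f i) (f j)" for f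
  proof -
    have ap: "ap (seq (p1 g) f) i = f i" if "i \<prec> p1 g" for i using ap_seq[OF f(3) that] .
    have "inc (lt r) (seq (p1 g) f)"
      using f(4) ap isseq_seq[OF f(3)] less_trans[of _ _ "p1 g"] by (auto simp: inc_def)
    moreover have "vals (seq (p1 g) f) = vals g"
    proof -
      have "vals (seq (p1 g) f) = f ` below M (p1 g)" using ap by (auto simp: vals_def)
      with f(2) show ?thesis by (simp add: bij_betw_def)
    qed
    ultimately have "seq (p1 g) f = g" using inc_unique[OF L _ g] by blast
    then show ?thesis using ap f(1) by (auto simp: extensional_def restrict_def)
  qed
  ultimately show ?thesis unfolding enum_def c by (intro the_equality) auto
qed

lemma fmap_inclusion:
  assumes r: "Linear_order r" and g: "inc (lt r) g" "inc (lt r) h" "vals g \<subseteq> vals h"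
  shows "nat_mor M (p1 g) (p1 h) (fmap M r (vals g) (vals h) (\<lambda>x. x))"
    and "i \<prec> p1 g \<Longrightarrow> ap h (fmap M r (vals g) (vals h) (\<lambda>x. x) i) = ap g i"
proof -
  let ?f = "fmap M r (vals g) (vals h) (\<lambda>x. x)"
  note L = slin_lt[OF r]
  define q where "q i = lst (\<lambda>j. j \<prec> p1 h \<and> ap h j = ap g i)" for i
  have q_fn: "fn1 q" unfolding q_def by (intro ar_intros)
  have q: "q i \<prec> p1 h \<and> ap h (q i) = ap g i" if i: "i \<prec> p1 g" for i
  proof -
    have "ap g i \<in> vals h" using i g(3) by (auto simp: vals_def)
    then obtain j where j: "j \<prec> p1 h \<and> ap h j = ap g i" by (auto simp: vals_def)
    have "rel1 (\<lambda>j. j \<prec> p1 h \<and> ap h j = ap g i)" by (intro ar_intros)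
    then show ?thesis using lst_spec(1)[of "\<lambda>j. j \<prec> p1 h \<and> ap h j = ap g i"] j
      unfolding q_def by auto
  qed
  have f: "?f = restrict q (below M (p1 g))"
    unfolding fmap_def fcard_vals[OF L g(1)] fcard_vals[OF L g(2)] enum_eq[OF r g(1)] enum_eq[OF r g(2)]
  proof (rule the_equality)
    show "restrict q (below M (p1 g)) \<in> below M (p1 g) \<rightarrow>\<^sub>E below M (p1 h) \<and>
      (\<forall>i\<in>below M (p1 g). restrict (ap g) (below M (p1 g)) i =
        restrict (ap h) (below M (p1 h)) (restrict q (below M (p1 g)) i))"
      using q by auto
  next
    fix k assume k: "k \<in> below M (p1 g) \<rightarrow>\<^sub>E below M (p1 h) \<and>
      (\<forall>i\<in>below M (p1 g). restrict (ap g) (below M (p1 g)) i = restrict (ap h) (below M (p1 h)) (k i))"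
    have "k i = q i" if i: "i \<prec> p1 g" for i
    proof -
      have "k i \<in> below M (p1 h)" by (rule PiE_mem[OF conjunct1[OF k]]) (simp add: i)
      moreover from this have "ap g i = ap h (k i)" using bspec[OF conjunct2[OF k], of i] i by simp
      ultimately have "ap g i = ap h (k i)" "k i \<prec> p1 h" by simp_all
      then show ?thesis using q[OF i] inc_inj[OF L g(2), of "k i" "q i"] by metis
    qed
    then show "k = restrict q (below M (p1 g))"
      using k by (auto simp: PiE_iff extensional_def restrict_def fun_eq_iff)
  qed
  show "i \<prec> p1 g \<Longrightarrow> ap h (?f i) = ap g i" using q by (simp add: f)
  have "fin M (fgraph M (p1 g) ?f)"
    using fin_fgraph[OF q_fn, of "p1 g"] fgraph_cong[of "p1 g" ?f q] by (simp add: f)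
  moreover have "q i \<prec> q j" if "i \<prec> j" "i \<prec> p1 g" "j \<prec> p1 g" for i j
    using q[OF that(2)] q[OF that(3)] inc_less_iff[OF L g(2), of "q i" "q j"]
      inc_less_iff[OF L g(1), of i j] that by simp
  ultimately show "nat_mor M (p1 g) (p1 h) ?f" using q by (auto simp: nat_mor_def f)
qed

section \<open>A normal form for \<open>\<Pi>\<^sup>1\<^sub>1\<close> formulas\<close>


abbreviation two (\<open>\<two>\<close>) where "\<two> \<equiv> \<one> \<oplus> \<one>"

lemma two_neq [simp]: "\<two> \<noteq> \<one>" "\<one> \<noteq> \<two>"
  using less_suc_self[of \<one>] less_irrefl by metis+

text \<open>A number codes an environment for the number variables. The index is a standard number
  because only variables of actual formulas are read off.\<close>

primrec dec :: "nat \<Rightarrow> 'a \<Rightarrow> 'a" where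
  "dec 0 x = p1 x"
| "dec (Suc k) x = dec k (p2 x)"

lemma af_dec [ar_intros]: "af s \<Longrightarrow> af (\<lambda>e. dec k (s e))"
  by (induction k arbitrary: s) (auto intro: ar_intros)

lemma dec_exists: "\<exists>x. \<forall>k<N. dec k x = e k"
proof (induction N arbitrary: e)
  case (Suc N)
  from Suc[of "\<lambda>k. e (Suc k)"] obtain x where "\<forall>k<N. dec k x = e (Suc k)" by blast
  then have "\<forall>k<Suc N. dec k (pr M (e 0) x) = e k" by (auto simp: less_Suc_eq_0_disj)
  then show ?case by blast
qed simp

lemma ar_ball_nat [ar_intros]: "(\<And>k. ar (P k)) \<Longrightarrow> ar (\<lambda>e. \<forall>k<(N::nat). P k e)"
proof (induction N)
  case (Suc N)
  have "ar (\<lambda>e. (\<forall>k<N. P k e) \<and> P N e)" by (intro ar_conj Suc)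
  then show ?case by (simp add: All_less_Suc conj_commute)
qed (simp add: ar_const)

text \<open>The matrix constrains \<open>Y\<close> at one number \<open>i\<close> at a time. If the
  entry \<open>G x\<close> of a path consists of a witness \<open>z\<close> and the truth value of
  \<open>x \<in> Y\<close>, then the condition relates only the two entries \<open>G x\<close> and
  \<open>G i\<close>, and nodes can test it on pairs of positions.\<close>

definition nf :: "('a set \<Rightarrow> bool) \<Rightarrow> bool" where
  "nf R \<longleftrightarrow> (\<exists>P N. rel3 P \<and> rel3 N \<and>
    (\<forall>Y\<in>Sets M. R Y \<longleftrightarrow> (\<forall>x. \<exists>z. \<forall>i. (P x z i \<longrightarrow> i \<in> Y) \<and> (N x z i \<longrightarrow> i \<notin> Y))))"

lemma ar_bool3:
  assumes "\<And>b1 b2 b3. ar (\<lambda>e. B e b1 b2 b3)" "ar p" "ar q" "ar r"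
  shows "ar (\<lambda>e. B e (p e) (q e) (r e))"
proof -
  have "ar (\<lambda>e. if p e then if q e then if r e then B e True True True else B e True True False
        else if r e then B e True False True else B e True False False
       else if q e then if r e then B e False True True else B e False True False
        else if r e then B e False False True else B e False False False)" (is "ar ?C")
    by (intro ar_intros assms)
  moreover have "?C = (\<lambda>e. B e (p e) (q e) (r e))"
  proof
    show "?C e = B e (p e) (q e) (r e)" for e
      by (cases "p e"; cases "q e"; cases "r e") simp_all
  qed
  ultimately show ?thesis by (simp only:)
qed

text \<open>The witness guesses the three truth values along with \<open>z\<close>, where
  \<open>\<zero>\<close> stands for true. \<open>P\<close> and \<open>N\<close> check the guesses.
  If \<open>B\<close> fails for them, \<open>P\<close> and \<open>N\<close> hold everywhere, which
  no \<open>Y\<close> can satisfy.\<close>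

lemma nf_basic:
  assumes B: "\<And>b1 b2 b3. rel2 (\<lambda>x z. B x z b1 b2 b3)" and fgh: "fn2 f" "fn2 g" "fn2 h"
  shows "nf (\<lambda>Y. \<forall>x. \<exists>z. B x z (f x z \<in> Y) (g x z \<in> Y) (h x z \<in> Y))"
proof -
  note [ar_intros] = fgh[THEN af_sub2]
  define z where "z w = p1 w" for w
  define b1 where "b1 w \<longleftrightarrow> p1 (p2 w) = \<zero>" for w
  define b2 where "b2 w \<longleftrightarrow> p1 (p2 (p2 w)) = \<zero>" for w
  define b3 where "b3 w \<longleftrightarrow> p2 (p2 (p2 w)) = \<zero>" for w
  define ok where "ok x w \<longleftrightarrow> B x (z w) (b1 w) (b2 w) (b3 w)" for x w
  have ok_ar: "rel2 ok" unfolding ok_def b1_def b2_def b3_def z_def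
    by (rule ar_bool3) (intro ar_intros ar_sub2[OF B])+
  define P where "P x w i \<longleftrightarrow> \<not> ok x w \<or> (b1 w \<and> i = f x (z w)) \<or> (b2 w \<and> i = g x (z w)) \<or>
    (b3 w \<and> i = h x (z w))" for x w i
  define N where "N x w i \<longleftrightarrow> \<not> ok x w \<or> (\<not> b1 w \<and> i = f x (z w)) \<or> (\<not> b2 w \<and> i = g x (z w)) \<or>
    (\<not> b3 w \<and> i = h x (z w))" for x w i
  have "rel3 P" "rel3 N"
    unfolding P_def N_def b1_def b2_def b3_def z_def by (intro ar_intros ar_sub2[OF ok_ar])+
  moreover have "(\<exists>z. B x z (f x z \<in> Y) (g x z \<in> Y) (h x z \<in> Y)) \<longleftrightarrow>
    (\<exists>w. \<forall>i. (P x w i \<longrightarrow> i \<in> Y) \<and> (N x w i \<longrightarrow> i \<notin> Y))" (is "?l = ?r") for x Y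
  proof
    assume ?l
    then obtain z0 where z0: "B x z0 (f x z0 \<in> Y) (g x z0 \<in> Y) (h x z0 \<in> Y)" by blast
    let ?b = "\<lambda>p. if p then \<zero> else \<one>"
    let ?w = "pr M z0 (pr M (?b (f x z0 \<in> Y)) (pr M (?b (g x z0 \<in> Y)) (?b (h x z0 \<in> Y))))"
    have w: "z ?w = z0" "b1 ?w \<longleftrightarrow> f x z0 \<in> Y" "b2 ?w \<longleftrightarrow> g x z0 \<in> Y" "b3 ?w \<longleftrightarrow> h x z0 \<in> Y"
      by (auto simp: z_def b1_def b2_def b3_def)
    then have "ok x ?w" using z0 by (simp add: ok_def)
    with w show ?r by (intro exI[of _ ?w]) (auto simp: P_def N_def)
  next
    assume ?r
    then obtain w where w: "\<And>i. P x w i \<Longrightarrow> i \<in> Y" "\<And>i. N x w i \<Longrightarrow> i \<notin> Y" by blast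
    then have ok: "ok x w" by (auto simp: P_def N_def)
    have "b1 w \<longleftrightarrow> f x (z w) \<in> Y" "b2 w \<longleftrightarrow> g x (z w) \<in> Y" "b3 w \<longleftrightarrow> h x (z w) \<in> Y"
      using w unfolding P_def N_def by blast+
    with ok show ?l by (auto simp: ok_def)
  qed
  ultimately show ?thesis unfolding nf_def by blast
qed

lemma nf_basic_all:
  assumes "\<And>b1 b2 b3. rel1 (\<lambda>x. B x b1 b2 b3)" "fn1 f" "fn1 g" "fn1 h"
  shows "nf (\<lambda>Y. \<forall>x. B x (f x \<in> Y) (g x \<in> Y) (h x \<in> Y))"
  using nf_basic[of "\<lambda>x _. B x" "\<lambda>x _. f x" "\<lambda>x _. g x" "\<lambda>x _. h x"] assms by simp

lemma nf_conj:
  assumes "nf R" "nf S"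
  shows "nf (\<lambda>Y. R Y \<and> S Y)"
proof -
  obtain P N where R: "rel3 P" "rel3 N"
    "\<And>Y. Y \<in> Sets M \<Longrightarrow> R Y \<longleftrightarrow> (\<forall>x. \<exists>z. \<forall>i. (P x z i \<longrightarrow> i \<in> Y) \<and> (N x z i \<longrightarrow> i \<notin> Y))"
    using assms(1) unfolding nf_def by blast
  obtain P' N' where S: "rel3 P'" "rel3 N'"
    "\<And>Y. Y \<in> Sets M \<Longrightarrow> S Y \<longleftrightarrow> (\<forall>x. \<exists>z. \<forall>i. (P' x z i \<longrightarrow> i \<in> Y) \<and> (N' x z i \<longrightarrow> i \<notin> Y))"
    using assms(2) unfolding nf_def by blast
  note [ar_intros] = ar_sub3[OF R(1)] ar_sub3[OF R(2)] ar_sub3[OF S(1)] ar_sub3[OF S(2)]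
  \<comment> \<open>The universally quantified number carries a tag that selects one of the
    conjuncts.\<close>
  define P'' where "P'' x z i \<longleftrightarrow> (if p1 x = \<zero> then P (p2 x) z i else P' (p2 x) z i)" for x z i
  define N'' where "N'' x z i \<longleftrightarrow> (if p1 x = \<zero> then N (p2 x) z i else N' (p2 x) z i)" for x z i
  have "rel3 P''" "rel3 N''" unfolding P''_def N''_def by (intro ar_intros)+
  moreover have "R Y \<and> S Y \<longleftrightarrow> (\<forall>x. \<exists>z. \<forall>i. (P'' x z i \<longrightarrow> i \<in> Y) \<and> (N'' x z i \<longrightarrow> i \<notin> Y))" (is "?l = ?r")
    if Y: "Y \<in> Sets M" for Y
  proof
    assume ?l
    show ?r
    proof
      fix x show "\<exists>z. \<forall>i. (P'' x z i \<longrightarrow> i \<in> Y) \<and> (N'' x z i \<longrightarrow> i \<notin> Y)"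
        using \<open>?l\<close> R(3)[OF Y] S(3)[OF Y] by (cases "p1 x = \<zero>") (simp_all add: P''_def N''_def)
    qed
  next
    assume r: ?r
    have "R Y" unfolding R(3)[OF Y]
    proof
      fix x show "\<exists>z. \<forall>i. (P x z i \<longrightarrow> i \<in> Y) \<and> (N x z i \<longrightarrow> i \<notin> Y)"
        using r[rule_format, of "pr M \<zero> x"] by (simp add: P''_def N''_def)
    qed
    moreover have "S Y" unfolding S(3)[OF Y]
    proof
      fix x show "\<exists>z. \<forall>i. (P' x z i \<longrightarrow> i \<in> Y) \<and> (N' x z i \<longrightarrow> i \<notin> Y)"
        using r[rule_format, of "pr M \<one> x"] by (simp add: P''_def N''_def)
    qed
    ultimately show ?l ..
  qed
  ultimately show ?thesis unfolding nf_def by blast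
qed

definition sec :: "'a \<Rightarrow> 'a set \<Rightarrow> 'a set" where "sec c Y = {i. pr M c i \<in> Y}"

lemma mem_sec [simp]: "i \<in> sec c Y \<longleftrightarrow> pr M c i \<in> Y"
  by (simp add: sec_def)

lemma sec_Sets [simp]: "Y \<in> Sets M \<Longrightarrow> sec c Y \<in> Sets M"
  unfolding sec_def by (intro comprehension ar_mem ar_intros)

lemma nf_sec:
  assumes "nf R"
  shows "nf (\<lambda>Y. R (sec c Y))"
proof -
  obtain P N where R: "rel3 P" "rel3 N"
    "\<And>Y. Y \<in> Sets M \<Longrightarrow> R Y \<longleftrightarrow> (\<forall>x. \<exists>z. \<forall>i. (P x z i \<longrightarrow> i \<in> Y) \<and> (N x z i \<longrightarrow> i \<notin> Y))"
    using assms(1) unfolding nf_def by blast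
  note [ar_intros] = ar_sub3[OF R(1)] ar_sub3[OF R(2)]
  define P' where "P' x z w \<longleftrightarrow> (\<exists>i. w = pr M c i \<and> P x z i)" for x z w
  define N' where "N' x z w \<longleftrightarrow> (\<exists>i. w = pr M c i \<and> N x z i)" for x z w
  have "rel3 P'" "rel3 N'" unfolding P'_def N'_def by (intro ar_intros)+
  moreover have "R (sec c Y) \<longleftrightarrow> (\<forall>x. \<exists>z. \<forall>i. (P' x z i \<longrightarrow> i \<in> Y) \<and> (N' x z i \<longrightarrow> i \<notin> Y))"
    if Y: "Y \<in> Sets M" for Y
  proof -
    have "(\<forall>i. (P x z i \<longrightarrow> i \<in> sec c Y) \<and> (N x z i \<longrightarrow> i \<notin> sec c Y)) \<longleftrightarrow>
        (\<forall>w. (P' x z w \<longrightarrow> w \<in> Y) \<and> (N' x z w \<longrightarrow> w \<notin> Y))" for x z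
      unfolding P'_def N'_def mem_sec by blast
    then show ?thesis unfolding R(3)[OF sec_Sets[OF Y]] by presburger
  qed
  ultimately show ?thesis unfolding nf_def by blast
qed

definition join :: "'a set \<Rightarrow> 'a set \<Rightarrow> 'a set \<Rightarrow> 'a set" where
  "join X Y Z = {w. (\<exists>i. w = pr M \<zero> i \<and> i \<in> X) \<or> (\<exists>i. w = pr M \<one> i \<and> i \<in> Y) \<or>
    (\<exists>i. w = pr M \<two> i \<and> i \<in> Z)}"

lemma sec_join [simp]: "sec \<zero> (join X Y Z) = X" "sec \<one> (join X Y Z) = Y" "sec \<two> (join X Y Z) = Z"
  by (auto simp: join_def)

lemma mem_join [simp]:
  "pr M \<zero> i \<in> join X Y Z \<longleftrightarrow> i \<in> X" "pr M \<one> i \<in> join X Y Z \<longleftrightarrow> i \<in> Y" "pr M \<two> i \<in> join X Y Z \<longleftrightarrow> i \<in> Z"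
  by (auto simp: join_def)

lemma join_Sets [simp]:
  assumes "X \<in> Sets M" "Y \<in> Sets M" "Z \<in> Sets M"
  shows "join X Y Z \<in> Sets M"
  unfolding join_def by (intro comprehension ar_intros assms[THEN ar_mem])

text \<open>
  A set \<open>Y\<close> satisfying \<open>R\<close> contains \<open>X\<close> in its first section and the truth set of \<open>\<theta>\<close> in its
  second section; the third section holds the corresponding sets for the subformulas.
\<close>

lemma formula_nf:
  assumes "arithmetical \<theta>" "range E \<subseteq> Sets M" "var_bound \<theta> \<le> N"
  shows "\<exists>R. nf R \<and> (\<forall>X\<in>Sets M. \<exists>Y\<in>Sets M. sec \<zero> Y = X \<and> R Y) \<and>
    (\<forall>Y\<in>Sets M. R Y \<longrightarrow> (\<forall>x. pr M \<one> x \<in> Y \<longleftrightarrow> l2_sat M (\<lambda>k. dec k x) (E(j := sec \<zero> Y)) \<theta>))"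
    (is "?K \<theta>")
proof -
  define T where "T X \<phi> = {x. l2_sat M (\<lambda>k. dec k x) (E(j := X)) \<phi>}" for X \<phi>
  have range: "range (E(j := X)) \<subseteq> Sets M" if "X \<in> Sets M" for X
    using assms(2) that by auto
  have T: "T X \<phi> \<in> Sets M" if "X \<in> Sets M" "arithmetical \<phi>" for X \<phi>
    unfolding T_def using ar_sat[OF that(2) range[OF that(1)], of "\<lambda>k e. dec k (e 0)"]
    by (intro comprehension) (simp add: ar_intros)
  \<comment> \<open>If the truth of \<open>\<phi>\<close> does not depend on the set variable
    \<open>j\<close>, its truth set is fixed and may serve as a parameter of the normal
    form.\<close>
  have indep: "?K \<phi>" if ar: "arithmetical \<phi>"
    and eq: "\<And>e X. l2_sat M e (E(j := X)) \<phi> \<longleftrightarrow> l2_sat M e E \<phi>" for \<phi>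
  proof -
    have "E j \<in> Sets M" using assms(2) by auto
    from T[OF this ar] have TS: "T (E j) \<phi> \<in> Sets M" .
    let ?R = "\<lambda>Y. \<forall>x. (pr M \<one> x \<in> Y) = (x \<in> T (E j) \<phi>)"
    have "nf ?R"
      using nf_basic_all[of "\<lambda>x b1 b2 b3. b1 = (x \<in> T (E j) \<phi>)" "\<lambda>x. pr M \<one> x" "\<lambda>x. x" "\<lambda>x. x"]
      by (simp add: ar_intros ar_mem[OF TS])
    moreover have "\<exists>Y\<in>Sets M. sec \<zero> Y = X \<and> ?R Y" if X: "X \<in> Sets M" for X
      by (rule bexI[of _ "join X (T (E j) \<phi>) X"]) (simp_all add: X TS)
    moreover have "\<forall>Y\<in>Sets M. ?R Y \<longrightarrow>
        (\<forall>x. pr M \<one> x \<in> Y \<longleftrightarrow> l2_sat M (\<lambda>k. dec k x) (E(j := sec \<zero> Y)) \<phi>)"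
      by (simp add: T_def eq)
    ultimately show ?thesis by blast
  qed
  have boolean: "?K \<chi>" if \<phi>: "?K \<phi>" and \<psi>: "?K \<psi>" and \<chi>: "arithmetical \<chi>"
    "\<And>e D. l2_sat M e D \<chi> \<longleftrightarrow> b (l2_sat M e D \<phi>) (l2_sat M e D \<psi>)" for \<phi> \<psi> \<chi> b
  proof -
    obtain R where R: "nf R" "\<forall>X\<in>Sets M. \<exists>Y\<in>Sets M. sec \<zero> Y = X \<and> R Y"
      "\<forall>Y\<in>Sets M. R Y \<longrightarrow> (\<forall>x. pr M \<one> x \<in> Y \<longleftrightarrow> l2_sat M (\<lambda>k. dec k x) (E(j := sec \<zero> Y)) \<phi>)"
      using \<phi> by blast
    obtain S where S: "nf S" "\<forall>X\<in>Sets M. \<exists>Y\<in>Sets M. sec \<zero> Y = X \<and> S Y"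
      "\<forall>Y\<in>Sets M. S Y \<longrightarrow> (\<forall>x. pr M \<one> x \<in> Y \<longleftrightarrow> l2_sat M (\<lambda>k. dec k x) (E(j := sec \<zero> Y)) \<psi>)"
      using \<psi> by blast
    let ?a = "\<lambda>x. pr M \<two> (pr M \<zero> x)" and ?b = "\<lambda>x. pr M \<two> (pr M \<one> x)"
    \<comment> \<open>The third section holds the sets for both subformulas. One clause makes them
      speak about the same \<open>X\<close>, the other computes the new truth set pointwise.\<close>
    let ?R = "\<lambda>Y. R (sec \<zero> (sec \<two> Y)) \<and> S (sec \<one> (sec \<two> Y)) \<and>
      (\<forall>x. (pr M \<zero> x \<in> Y) = (?a (pr M \<zero> x) \<in> Y) \<and> (pr M \<zero> x \<in> Y) = (?b (pr M \<zero> x) \<in> Y)) \<and>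
      (\<forall>x. (pr M \<one> x \<in> Y) = b (?a (pr M \<one> x) \<in> Y) (?b (pr M \<one> x) \<in> Y))"
    have "nf (\<lambda>Y. \<forall>x. (pr M \<zero> x \<in> Y) = (?a (pr M \<zero> x) \<in> Y) \<and> (pr M \<zero> x \<in> Y) = (?b (pr M \<zero> x) \<in> Y))"
      using nf_basic_all[of "\<lambda>x b1 b2 b3. b1 = b2 \<and> b1 = b3" "\<lambda>x. pr M \<zero> x"
        "\<lambda>x. ?a (pr M \<zero> x)" "\<lambda>x. ?b (pr M \<zero> x)"]
      by (simp add: ar_intros)
    moreover have "nf (\<lambda>Y. \<forall>x. (pr M \<one> x \<in> Y) = b (?a (pr M \<one> x) \<in> Y) (?b (pr M \<one> x) \<in> Y))"
      using nf_basic_all[of "\<lambda>x b1 b2 b3. b1 = b b2 b3" "\<lambda>x. pr M \<one> x"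
        "\<lambda>x. ?a (pr M \<one> x)" "\<lambda>x. ?b (pr M \<one> x)"]
      by (simp add: ar_intros)
    ultimately have "nf ?R"
      by (intro nf_conj nf_sec[of "\<lambda>Y. R (sec \<zero> Y)"] nf_sec[of "\<lambda>Y. S (sec \<one> Y)"]
        nf_sec[of R] nf_sec[of S] R S)
    moreover have sem: "pr M \<one> x \<in> Y \<longleftrightarrow> l2_sat M (\<lambda>k. dec k x) (E(j := sec \<zero> Y)) \<chi>"
      if Y: "Y \<in> Sets M" "?R Y" for Y x
    proof -
      have "sec \<zero> (sec \<zero> (sec \<two> Y)) = sec \<zero> Y" "sec \<zero> (sec \<one> (sec \<two> Y)) = sec \<zero> Y" using Y(2) by auto
      then show ?thesis
        using Y R(3)[rule_format, of "sec \<zero> (sec \<two> Y)" x] S(3)[rule_format, of "sec \<one> (sec \<two> Y)" x]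
        by (simp add: \<chi>(2))
    qed
    moreover have "\<exists>Y\<in>Sets M. sec \<zero> Y = X \<and> ?R Y" if X: "X \<in> Sets M" for X
    proof -
      obtain Y where Y: "Y \<in> Sets M" "sec \<zero> Y = X" "R Y" using R(2) X by blast
      obtain Z where Z: "Z \<in> Sets M" "sec \<zero> Z = X" "S Z" using S(2) X by blast
      have *: "pr M \<zero> x \<in> Y \<longleftrightarrow> x \<in> X" "pr M \<zero> x \<in> Z \<longleftrightarrow> x \<in> X" for x
        by (simp_all only: mem_sec[symmetric] Y(2) Z(2))
      have **: "x \<in> T X \<chi> \<longleftrightarrow> b (pr M \<one> x \<in> Y) (pr M \<one> x \<in> Z)" for x
        using R(3)[rule_format, OF Y(1,3), of x] S(3)[rule_format, OF Z(1,3), of x]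
        unfolding Y(2) Z(2) T_def by (simp add: \<chi>(2))
      let ?W = "join X (T X \<chi>) (join Y Z Y)"
      have "?W \<in> Sets M" using X Y(1) Z(1) T[OF X \<chi>(1)] by simp
      moreover have "?R ?W" using Y(3) Z(3) by (simp add: * **)
      moreover have "sec \<zero> ?W = X" by simp
      ultimately show ?thesis by blast
    qed
    ultimately show ?thesis by (intro exI[of _ ?R] conjI ballI impI allI) assumption+
  qed
  from assms(1,3) show "?K \<theta>"
  proof (induction \<theta>)
    case (FMem t i)
    show ?case
    proof (cases "i = j")
      case False
      then show ?thesis by (intro indep) simp_all
    next
      case True
      let ?v = "\<lambda>x. l2_val M (\<lambda>k. dec k x) t"
      let ?R = "\<lambda>Y. \<forall>x. (pr M \<one> x \<in> Y) = (pr M \<zero> (?v x) \<in> Y)"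
      have "fn1 ?v" by (intro af_val ar_intros)
      then have "nf ?R"
        using nf_basic_all[of "\<lambda>x b1 b2 b3. b1 = b2" "\<lambda>x. pr M \<one> x" "\<lambda>x. pr M \<zero> (?v x)" "\<lambda>x. x"]
        by (simp add: ar_intros)
      moreover have "\<exists>Y\<in>Sets M. sec \<zero> Y = X \<and> ?R Y" if X: "X \<in> Sets M" for X
        using True by (intro bexI[of _ "join X (T X (FMem t i)) X"]) (simp_all add: X T, simp add: T_def)
      moreover have "\<forall>Y\<in>Sets M. ?R Y \<longrightarrow>
        (\<forall>x. pr M \<one> x \<in> Y \<longleftrightarrow> l2_sat M (\<lambda>k. dec k x) (E(j := sec \<zero> Y)) (FMem t i))"
        using True by simp
      ultimately show ?thesis by blast
    qed
  next
    case (FNeg \<phi>)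
    then show ?case using boolean[of \<phi> \<phi> "FNeg \<phi>" "\<lambda>b _. \<not> b"] by simp
  next
    case (FConj \<phi> \<psi>)
    then show ?case using boolean[of \<phi> \<psi> "FConj \<phi> \<psi>" "(\<and>)"] by simp
  next
    case (FAll v \<phi>)
    then have a: "arithmetical \<phi>" "var_bound \<phi> \<le> N" by simp_all
    obtain R where R: "nf R" "\<forall>X\<in>Sets M. \<exists>Y\<in>Sets M. sec \<zero> Y = X \<and> R Y"
      "\<forall>Y\<in>Sets M. R Y \<longrightarrow> (\<forall>x. pr M \<one> x \<in> Y \<longleftrightarrow> l2_sat M (\<lambda>k. dec k x) (E(j := sec \<zero> Y)) \<phi>)"
      using FAll.IH[OF a] by blast
    \<comment> \<open>Changing the variable \<open>v\<close> means passing to a code that agrees on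
      all other relevant variables. As each modified environment has a code by
      \<open>dec_exists\<close>, the quantifier becomes one over codes.\<close>
    define U where "U x x' \<longleftrightarrow> (\<forall>k<N. k \<noteq> v \<longrightarrow> dec k x' = dec k x)" for x x'
    have U: "rel2 U" unfolding U_def by (intro ar_intros)
    have sat_U: "l2_sat M (\<lambda>k. dec k x) D (FAll v \<phi>) \<longleftrightarrow>
        (\<forall>x'. U x x' \<longrightarrow> l2_sat M (\<lambda>k. dec k x') D \<phi>)" (is "?l = ?r") for x D
    proof
      assume l: ?l
      show ?r
      proof (intro allI impI)
        fix x' assume "U x x'"
        then have "l2_sat M (\<lambda>k. dec k x') D \<phi> \<longleftrightarrow> l2_sat M ((\<lambda>k. dec k x)(v := dec v x')) D \<phi>"
          using FAll.prems by (intro sat_cong) (auto simp: U_def)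
        then show "l2_sat M (\<lambda>k. dec k x') D \<phi>" using l by simp
      qed
    next
      assume r: ?r
      have "l2_sat M ((\<lambda>k. dec k x)(v := y)) D \<phi>" for y
      proof -
        obtain x' where x': "\<forall>k<N. dec k x' = ((\<lambda>k. dec k x)(v := y)) k" using dec_exists by blast
        then have "U x x'" by (simp add: U_def)
        with r have "l2_sat M (\<lambda>k. dec k x') D \<phi>" by blast
        moreover have "l2_sat M (\<lambda>k. dec k x') D \<phi> \<longleftrightarrow> l2_sat M ((\<lambda>k. dec k x)(v := y)) D \<phi>"
          using FAll.prems x' by (intro sat_cong) auto
        ultimately show ?thesis by simp
      qed
      then show ?l by simp
    qed
    \<comment> \<open>The truth set of the universal formula is fixed by two clauses of the required
      form: a code in it has only good variants, and a code outside it has a counterexample as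
      witness.\<close>
    let ?R = "\<lambda>Y. R (sec \<two> Y) \<and> (\<forall>x. (pr M \<zero> x \<in> Y) = (pr M \<two> (pr M \<zero> x) \<in> Y)) \<and>
      (\<forall>w. U (p1 w) (p2 w) \<longrightarrow> pr M \<one> (p1 w) \<in> Y \<longrightarrow> pr M \<two> (pr M \<one> (p2 w)) \<in> Y) \<and>
      (\<forall>x. \<exists>x'. U x x' \<and> (pr M \<one> x \<in> Y \<or> pr M \<two> (pr M \<one> x') \<notin> Y))"
    have "nf (\<lambda>Y. \<forall>x. (pr M \<zero> x \<in> Y) = (pr M \<two> (pr M \<zero> x) \<in> Y))"
      using nf_basic_all[of "\<lambda>x b1 b2 b3. b1 = b2" "\<lambda>x. pr M \<zero> x" "\<lambda>x. pr M \<two> (pr M \<zero> x)" "\<lambda>x. x"]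
      by (simp add: ar_intros)
    moreover have "nf (\<lambda>Y. \<forall>w. U (p1 w) (p2 w) \<longrightarrow> pr M \<one> (p1 w) \<in> Y \<longrightarrow> pr M \<two> (pr M \<one> (p2 w)) \<in> Y)"
      using nf_basic_all[of "\<lambda>w b1 b2 b3. U (p1 w) (p2 w) \<longrightarrow> b1 \<longrightarrow> b2" "\<lambda>w. pr M \<one> (p1 w)"
        "\<lambda>w. pr M \<two> (pr M \<one> (p2 w))" "\<lambda>x. x"]
      by (simp add: ar_intros ar_sub2[OF U])
    moreover have "nf (\<lambda>Y. \<forall>x. \<exists>x'. U x x' \<and> (pr M \<one> x \<in> Y \<or> pr M \<two> (pr M \<one> x') \<notin> Y))"
      using nf_basic[of "\<lambda>x x' b1 b2 b3. U x x' \<and> (b1 \<or> \<not> b2)" "\<lambda>x x'. pr M \<one> x"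
        "\<lambda>x x'. pr M \<two> (pr M \<one> x')" "\<lambda>x x'. x"] U
      by (simp add: ar_intros)
    ultimately have "nf ?R" by (intro nf_conj nf_sec R)
    moreover have sem: "pr M \<one> x \<in> Y \<longleftrightarrow> l2_sat M (\<lambda>k. dec k x) (E(j := sec \<zero> Y)) (FAll v \<phi>)"
      if Y: "Y \<in> Sets M" "?R Y" for Y x
    proof -
      have "sec \<zero> (sec \<two> Y) = sec \<zero> Y" using Y(2) by auto
      then have s: "pr M \<two> (pr M \<one> x') \<in> Y \<longleftrightarrow> l2_sat M (\<lambda>k. dec k x') (E(j := sec \<zero> Y)) \<phi>" for x'
        using Y R(3)[rule_format, of "sec \<two> Y" x'] by simp
      have "pr M \<two> (pr M \<one> x') \<in> Y" if "U x x'" "pr M \<one> x \<in> Y" for x'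
        using Y(2) that p1_pr[of x x'] p2_pr[of x x'] by metis
      moreover have "\<exists>x'. U x x' \<and> (pr M \<one> x \<in> Y \<or> pr M \<two> (pr M \<one> x') \<notin> Y)" using Y(2) by blast
      ultimately show ?thesis unfolding sat_U s[symmetric] by blast
    qed
    moreover have "\<exists>Y\<in>Sets M. sec \<zero> Y = X \<and> ?R Y" if X: "X \<in> Sets M" for X
    proof -
      obtain Y where Y: "Y \<in> Sets M" "sec \<zero> Y = X" "R Y" using R(2) X by blast
      have *: "pr M \<zero> x \<in> Y \<longleftrightarrow> x \<in> X" for x by (simp only: mem_sec[symmetric] Y(2))
      let ?T = "T X (FAll v \<phi>)"
      let ?W = "join X ?T Y"
      have **: "x \<in> ?T \<longleftrightarrow> (\<forall>x'. U x x' \<longrightarrow> pr M \<one> x' \<in> Y)" for x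
        using R(3)[rule_format, OF Y(1,3)] unfolding Y(2) T_def mem_Collect_eq sat_U by simp
      \<comment> \<open>If \<open>x\<close> is in the truth set, the witness may be any variant, for
        instance \<open>x\<close>.\<close>
      have "U x x" for x by (simp add: U_def)
      then have "\<exists>x'. U x x' \<and> (x \<in> ?T \<or> pr M \<one> x' \<notin> Y)" for x
        unfolding ** by blast
      moreover have "\<forall>w. U (p1 w) (p2 w) \<longrightarrow> p1 w \<in> ?T \<longrightarrow> pr M \<one> (p2 w) \<in> Y"
        unfolding ** by blast
      ultimately have "?R ?W" unfolding mem_join sec_join * by (intro conjI allI Y(3)) auto
      moreover have "?W \<in> Sets M" using X Y(1) T[OF X, of "FAll v \<phi>"] FAll.prems by simp
      moreover have "sec \<zero> ?W = X" by simp
      ultimately show ?thesis by blast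
    qed
    ultimately show ?case by (intro exI[of _ ?R] conjI ballI impI allI) assumption+
  next
    case (FEq s t)
    show ?case by (rule indep) simp_all
  next
    case (FLess s t)
    show ?case by (rule indep) simp_all
  qed simp_all
qed

lemma Pi11_normal_form:
  assumes "Pi11 \<phi>" "range E \<subseteq> Sets M"
  shows "\<exists>Q. ar (\<lambda>e. Q (e 0) (e 1) (e 2) (e 3) (e 4)) \<and>
    (\<forall>n. l2_sat M (e(v := n)) E \<phi> \<longleftrightarrow> \<not> (\<exists>G. fn1 G \<and> (\<forall>x i. Q n x (G x) i (G i))))"
proof -
  from assms(1) obtain j \<theta> where \<phi>: "\<phi> = FAllSet j \<theta>" "arithmetical \<theta>" unfolding Pi11_def by blast
  let ?N = "var_bound \<theta>"
  obtain R where R: "nf R" "\<forall>X\<in>Sets M. \<exists>Y\<in>Sets M. sec \<zero> Y = X \<and> R Y"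
    "\<forall>Y\<in>Sets M. R Y \<longrightarrow> (\<forall>x. pr M \<one> x \<in> Y \<longleftrightarrow> l2_sat M (\<lambda>k. dec k x) (E(j := sec \<zero> Y)) \<theta>)"
    using formula_nf[OF \<phi>(2) assms(2) order_refl] by blast
  from R(1) obtain P N where PN: "rel3 P" "rel3 N"
    "\<And>Y. Y \<in> Sets M \<Longrightarrow> R Y \<longleftrightarrow> (\<forall>x. \<exists>z. \<forall>i. (P x z i \<longrightarrow> i \<in> Y) \<and> (N x z i \<longrightarrow> i \<notin> Y))"
    unfolding nf_def by blast
  note [ar_intros] = ar_sub3[OF PN(1)] ar_sub3[OF PN(2)]
  \<comment> \<open>\<open>x\<close> codes the environment \<open>e\<close> with value
    \<open>n\<close> for \<open>v\<close>, as far as the variables of \<open>\<theta>\<close> are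
    concerned.\<close>
  define D where "D n x \<longleftrightarrow> (\<forall>k<?N. if k = v then dec k x = n else dec k x = e k)" for n x
  have "rel2 D" unfolding D_def by (intro ar_intros)
  note [ar_intros] = ar_sub2[OF this]
  have sat_D: "l2_sat M (\<lambda>k. dec k x) (E(j := X)) \<theta> \<longleftrightarrow> l2_sat M (e(v := n)) (E(j := X)) \<theta>" if "D n x" for n x X
    using that by (intro sat_cong) (auto simp: D_def split: if_splits)
  \<comment> \<open>An entry is a pair of a witness and a bit, where \<open>\<zero>\<close> means
    membership in \<open>Y\<close>. The last clause keeps codes of the current environment out of
    the truth set of \<open>\<theta>\<close>, so a path is a counterexample to \<open>\<phi>\<close>
    at \<open>n\<close>.\<close>
  define Q where "Q n x a i b \<longleftrightarrow> (P x (p1 a) i \<longrightarrow> p2 b = \<zero>) \<and> (N x (p1 a) i \<longrightarrow> p2 b \<noteq> \<zero>) \<and>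
    (D n x \<and> i = pr M \<one> x \<longrightarrow> p2 b \<noteq> \<zero>)" for n x a i b
  show ?thesis
  proof (intro exI[of _ Q] conjI allI)
    show "ar (\<lambda>e. Q (e 0) (e 1) (e 2) (e 3) (e 4))" unfolding Q_def by (intro ar_intros)
    fix n
    show "l2_sat M (e(v := n)) E \<phi> \<longleftrightarrow> \<not> (\<exists>G. fn1 G \<and> (\<forall>x i. Q n x (G x) i (G i)))"
    proof
      assume s: "l2_sat M (e(v := n)) E \<phi>"
      show "\<not> (\<exists>G. fn1 G \<and> (\<forall>x i. Q n x (G x) i (G i)))"
      proof
        assume "\<exists>G. fn1 G \<and> (\<forall>x i. Q n x (G x) i (G i))"
        then obtain G where G: "fn1 G" "\<And>x i. Q n x (G x) i (G i)" by blast
        define Y where "Y = {i. p2 (G i) = \<zero>}"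
        have Y: "Y \<in> Sets M" unfolding Y_def by (intro comprehension ar_intros G(1))
        have "R Y" unfolding PN(3)[OF Y]
        proof
          fix x show "\<exists>z. \<forall>i. (P x z i \<longrightarrow> i \<in> Y) \<and> (N x z i \<longrightarrow> i \<notin> Y)"
            using G(2)[of x] unfolding Q_def Y_def by (intro exI[of _ "p1 (G x)"]) simp
        qed
        obtain x where "\<forall>k<?N. dec k x = (e(v := n)) k" using dec_exists by blast
        then have x: "D n x" by (simp add: D_def)
        have "pr M \<one> x \<notin> Y" using G(2)[of x "pr M \<one> x"] x by (simp add: Q_def Y_def)
        then have "\<not> l2_sat M (e(v := n)) (E(j := sec \<zero> Y)) \<theta>"
          using R(3)[rule_format, OF Y \<open>R Y\<close>] sat_D[OF x] by simp
        moreover have "sec \<zero> Y \<in> Sets M" using Y by simp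
        ultimately show False using s \<phi>(1) by auto
      qed
    next
      assume no: "\<not> (\<exists>G. fn1 G \<and> (\<forall>x i. Q n x (G x) i (G i)))"
      show "l2_sat M (e(v := n)) E \<phi>"
      proof (rule ccontr)
        assume "\<not> l2_sat M (e(v := n)) E \<phi>"
        then obtain X where X: "X \<in> Sets M" "\<not> l2_sat M (e(v := n)) (E(j := X)) \<theta>" using \<phi>(1) by auto
        obtain Y where Y: "Y \<in> Sets M" "sec \<zero> Y = X" "R Y" using R(2) X(1) by blast
        note [ar_intros] = ar_mem[OF Y(1)]
        define S where "S x z \<longleftrightarrow> (\<forall>i. (P x z i \<longrightarrow> i \<in> Y) \<and> (N x z i \<longrightarrow> i \<notin> Y))" for x z
        have S: "rel2 S" unfolding S_def by (intro ar_intros)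
        have "\<exists>z. S x z" for x using PN(3)[OF Y(1)] Y(3) by (simp add: S_def)
        with S obtain g where g: "fn1 g" "\<And>x. S x (g x)" by (rule definable_choice[of S]) blast
        \<comment> \<open>A counterexample set becomes a path by least witnesses, which are
          definable from \<open>Y\<close>.\<close>
        define G where "G x = pr M (g x) (if x \<in> Y then \<zero> else \<one>)" for x
        have "fn1 G" unfolding G_def by (intro ar_intros g(1))
        moreover have "pr M \<one> x \<notin> Y" if "D n x" for x
          using R(3)[rule_format, OF Y(1,3)] sat_D[OF that] X(2) Y(2) by simp
        then have "Q n x (G x) i (G i)" for x i using g(2)[of x] by (simp add: Q_def G_def S_def)
        ultimately show False using no by blast
      qed
    qed
  qed
qed

end

section \<open>The dilator\<close>

text \<open>Formulas have disappeared: \<open>Q_zero\<close> and \<open>Q_step\<close> express the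
  premises of the induction, and what remains is to exclude paths at every index.\<close>

locale wf_step = aca0 +
  fixes Q :: "'a \<Rightarrow> 'a \<Rightarrow> 'a \<Rightarrow> 'a \<Rightarrow> 'a \<Rightarrow> bool"
  assumes Q_ar: "ar (\<lambda>e. Q (e 0) (e 1) (e 2) (e 3) (e 4))"
    and Q_zero: "\<not> Q (Zer M) x a i b"
    and Q_step: "\<nexists>G. af (\<lambda>e. G (e 0)) \<and> (\<forall>x i. Q n x (G x) i (G i)) \<Longrightarrow>
      \<nexists>G. af (\<lambda>e. G (e 0)) \<and> (\<forall>x i. Q (Add M n (One M)) x (G x) i (G i))"
begin

lemmas [ar_intros] = ar_sub5[OF Q_ar]

definition node :: "'a \<Rightarrow> 'a \<Rightarrow> bool" where
  "node n c \<longleftrightarrow> isseq c \<and> (\<forall>x i. x \<prec> p1 c \<and> i \<prec> p1 c \<longrightarrow> Q n x (ap c x) i (ap c i))"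

definition ext :: "'a \<Rightarrow> 'a \<Rightarrow> bool" where
  "ext c d \<longleftrightarrow> p1 c \<prec> p1 d \<and> (\<forall>i. i \<prec> p1 c \<longrightarrow> ap c i = ap d i)"

text \<open>Pairs that a rank function on the tree before the \<open>t\<close>-th must send to a
  descent. There are none for \<open>t = \<zero>\<close>.\<close>

definition rank_rel :: "'a \<Rightarrow> 'a \<Rightarrow> 'a \<Rightarrow> bool" where
  "rank_rel t i j \<longleftrightarrow> (\<exists>n. t = n \<oplus> \<one> \<and> node n i \<and> node n j \<and> ext i j)"

definition root :: 'a where "root = seq \<zero> (\<lambda>i. i)"

text \<open>Its empty support lies below every \<open>m\<close>, so normality forces it below all
  values of \<open>Mu\<close>; it is made the least element.\<close>

definition bot :: 'a where "bot = pr M \<zero> \<zero>"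

definition el :: "'a \<Rightarrow> 'a \<Rightarrow> 'a \<Rightarrow> 'a \<Rightarrow> 'a" where
  "el t c x w = pr M \<one> (pr M t (pr M c (pr M x w)))"

text \<open>
  An element \<open>el t c x w\<close> consists of a node \<open>c\<close> of the \<open>t\<close>-th tree and a finite approximation
  \<open>w\<close> to a rank function on the previous tree, with values up to \<open>x\<close>.
\<close>

definition felem :: "'a set \<Rightarrow> ('a \<Rightarrow> 'a \<Rightarrow> bool) \<Rightarrow> 'a \<Rightarrow> 'a \<Rightarrow> 'a \<Rightarrow> 'a \<Rightarrow> bool" where
  "felem A L t c x w \<longleftrightarrow> node t c \<and> isseq w \<and> p1 w = p1 c \<and> x \<in> A \<and>
    (\<forall>i. i \<prec> p1 w \<longrightarrow> ap w i \<in> A \<and> (L (ap w i) x \<or> ap w i = x)) \<and>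
    (\<forall>i j. i \<prec> p1 w \<and> j \<prec> p1 w \<and> rank_rel t i j \<longrightarrow> L (ap w j) (ap w i))"

definition F :: "'a set \<Rightarrow> ('a \<Rightarrow> 'a \<Rightarrow> bool) \<Rightarrow> 'a \<Rightarrow> bool" where
  "F A L \<sigma> \<longleftrightarrow> \<sigma> = bot \<or> (\<exists>t c x w. \<sigma> = el t c x w \<and> felem A L t c x w)"

text \<open>The Kleene-Brouwer order on sequences of pairs, each consisting of an entry of the node
  and a rank, compared lexicographically. The case \<open>k = p1 c'\<close> says that a proper
  extension is smaller.\<close>

definition kb :: "('a \<Rightarrow> 'a \<Rightarrow> bool) \<Rightarrow> 'a \<Rightarrow> 'a \<Rightarrow> 'a \<Rightarrow> 'a \<Rightarrow> bool" where
  "kb L c w c' w' \<longleftrightarrow> (\<exists>k. k \<prec> p1 c \<and> (\<forall>j. j \<prec> k \<longrightarrow> ap c j = ap c' j \<and> ap w j = ap w' j) \<and>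
    (k = p1 c' \<or> k \<prec> p1 c' \<and> (ap c k \<prec> ap c' k \<or> ap c k = ap c' k \<and> L (ap w k) (ap w' k))))"

definition fless :: "('a \<Rightarrow> 'a \<Rightarrow> bool) \<Rightarrow> 'a \<Rightarrow> 'a \<Rightarrow> bool" where
  "fless L \<sigma> \<tau> \<longleftrightarrow> (\<sigma> = bot \<and> (\<exists>t c x w. \<tau> = el t c x w)) \<or>
    (\<exists>t c x w t' c' x' w'. \<sigma> = el t c x w \<and> \<tau> = el t' c' x' w' \<and>
      (L x x' \<or> x = x' \<and> (t \<prec> t' \<or> t = t' \<and> kb L c w c' w')))"

definition supp :: "'a \<Rightarrow> 'a set" where
  "supp \<sigma> = {v. \<exists>t c x w. \<sigma> = el t c x w \<and> (v = x \<or> (\<exists>i. i \<prec> p1 w \<and> v = ap w i))}"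

text \<open>Only the bound and the ranks are elements of the varying order; the index
  \<open>t\<close> and the node \<open>c\<close> are plain numbers and stay fixed.\<close>

definition relabel :: "('a \<Rightarrow> 'a) \<Rightarrow> 'a \<Rightarrow> 'a" where
  "relabel h \<sigma> = (if \<sigma> = bot then bot else
    (let t = p1 (p2 \<sigma>); c = p1 (p2 (p2 \<sigma>)); x = p1 (p2 (p2 (p2 \<sigma>))); w = p2 (p2 (p2 (p2 \<sigma>)))
     in el t c (h x) (seq (p1 w) (\<lambda>i. h (ap w i)))))"

text \<open>\<open>Mor\<close> receives the bare code of a graph. Since \<open>ap\<close> looks at
  the second component only, \<open>pr M \<zero> g\<close> makes it applicable.
  \<open>Mu n k\<close> is the least element with bound \<open>k\<close>: at index
  \<open>\<zero>\<close> the root is the only node, and its list of ranks is empty.\<close>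

definition dil :: "'a normal_praedilator" where
  "dil = \<lparr>Ord = \<lambda>n. {(\<sigma>, \<tau>). F (below M n) (Less M) \<sigma> \<and> F (below M n) (Less M) \<tau> \<and>
        (\<sigma> = \<tau> \<or> fless (Less M) \<sigma> \<tau>)},
     Mor = \<lambda>n m g \<sigma>. relabel (ap (pr M \<zero> g)) \<sigma>, Supp = \<lambda>n. supp, Mu = \<lambda>n k. el \<zero> root k root\<rparr>"

lemma el_inj [simp]: "el t c x w = el t' c' x' w' \<longleftrightarrow> t = t' \<and> c = c' \<and> x = x' \<and> w = w'"
  by (simp add: el_def)

lemma bot_neq_el [simp]: "bot \<noteq> el t c x w" "el t c x w \<noteq> bot"
  by (simp_all add: el_def bot_def)

lemma F_bot [simp]: "F A L bot"
  by (simp add: F_def)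

lemma F_el [simp]: "F A L (el t c x w) \<longleftrightarrow> felem A L t c x w"
  by (auto simp: F_def)

lemma F_cases [consumes 1, case_names bot el]:
  assumes "F A L \<sigma>"
  obtains "\<sigma> = bot" | t c x w where "\<sigma> = el t c x w" "felem A L t c x w"
  using assms unfolding F_def by blast

lemma fless_simps [simp]:
  "\<not> fless L \<sigma> bot"
  "fless L bot (el t c x w)"
  "fless L (el t c x w) (el t' c' x' w') \<longleftrightarrow> L x x' \<or> x = x' \<and> (t \<prec> t' \<or> t = t' \<and> kb L c w c' w')"
  by (auto simp: fless_def)

lemma supp_simps [simp]:
  "supp bot = {}"
  "supp (el t c x w) = insert x {v. \<exists>i. i \<prec> p1 w \<and> v = ap w i}"
  by (auto simp: supp_def)

lemma relabel_simps [simp]: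
  "relabel h bot = bot"
  "relabel h (el t c x w) = el t c (h x) (seq (p1 w) (\<lambda>i. h (ap w i)))"
  by (simp_all add: relabel_def) (simp add: el_def)

lemma ar_node [ar_intros]: "af s \<Longrightarrow> af t \<Longrightarrow> ar (\<lambda>e. node (s e) (t e))"
  by (rule ar_sub2) (unfold node_def, intro ar_intros)

lemma ar_ext [ar_intros]: "af s \<Longrightarrow> af t \<Longrightarrow> ar (\<lambda>e. ext (s e) (t e))"
  by (rule ar_sub2) (unfold ext_def, intro ar_intros)

lemma ar_rank_rel [ar_intros]: "af s \<Longrightarrow> af t \<Longrightarrow> af u \<Longrightarrow> ar (\<lambda>e. rank_rel (s e) (t e) (u e))"
  by (rule ar_sub3) (unfold rank_rel_def, intro ar_intros)

lemma af_el [ar_intros]: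
  "af s \<Longrightarrow> af t \<Longrightarrow> af u \<Longrightarrow> af v \<Longrightarrow> af (\<lambda>e. el (s e) (t e) (u e) (v e))"
  unfolding el_def by (intro ar_intros)

lemma ar_F:
  assumes "rel2 L" "rel1 (\<lambda>x. x \<in> A)" "af s"
  shows "ar (\<lambda>e. F A L (s e))"
  by (rule ar_sub1[OF _ assms(3)])
    (unfold F_def felem_def, intro ar_intros ar_sub2[OF assms(1)] ar_sub1[OF assms(2)])

lemma ar_F_below [ar_intros]:
  "af s \<Longrightarrow> af t \<Longrightarrow> ar (\<lambda>e. F (below M (s e)) (Less M) (t e))"
  by (rule ar_sub2) (unfold F_def felem_def, intro ar_intros)

lemma ar_fless:
  assumes "rel2 L" "af s" "af t"
  shows "ar (\<lambda>e. fless L (s e) (t e))"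
  by (rule ar_sub2[OF _ assms(2,3)])
    (unfold fless_def kb_def, intro ar_intros ar_sub2[OF assms(1)])

lemma ar_fless_nat [ar_intros]: "af s \<Longrightarrow> af t \<Longrightarrow> ar (\<lambda>e. fless (Less M) (s e) (t e))"
  by (rule ar_fless) (intro ar_intros)

lemma ar_supp [ar_intros]: "af s \<Longrightarrow> af t \<Longrightarrow> ar (\<lambda>e. s e \<in> supp (t e))"
  by (rule ar_sub2) (unfold supp_def mem_Collect_eq, intro ar_intros)

lemma af_fcode_supp [ar_intros]: "af s \<Longrightarrow> af (\<lambda>e. fcode M (supp (s e)))"
  by (rule af_sub1) (unfold supp_def, intro ar_intros)

lemma af_fcode_vals [ar_intros]: "af s \<Longrightarrow> af (\<lambda>e. fcode M (vals (s e)))"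
  by (rule af_sub1) (unfold vals_def, intro ar_intros)

lemma af_relabel [ar_intros]: "af s \<Longrightarrow> af t \<Longrightarrow> af (\<lambda>e. relabel (ap (s e)) (t e))"
  by (rule af_sub2) (unfold relabel_def Let_def bot_def, intro ar_intros)

lemma rel2_less: "rel2 (Less M)"
  by (intro ar_intros)

lemma p1_root [simp]: "p1 root = \<zero>"
  by (simp add: root_def)

lemma isseq_root [simp]: "isseq root"
  unfolding root_def by (rule isseq_seq_fn1) (intro ar_intros)

lemma isseq_zero: "isseq c \<Longrightarrow> p1 c = \<zero> \<Longrightarrow> c = root"
  by (rule seq_ext) auto

lemma node_root [simp]: "node n root"
  by (simp add: node_def)

lemma node_zero: "node \<zero> c \<Longrightarrow> c = root"
proof -
  assume c: "node \<zero> c"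
  then have "p1 c = \<zero>" using Q_zero neq_zero[of "p1 c"] unfolding node_def by metis
  with c show "c = root" using isseq_zero by (simp add: node_def)
qed

section \<open>Linearity of the order on elements\<close>

lemma kb_irrefl: "slin L A \<Longrightarrow> \<not> kb L c w c w"
  using slin_irrefl unfolding kb_def by auto

text \<open>The comparison is decided at the smaller of the two positions of difference.\<close>

lemma kb_trans:
  assumes L: "slin L A" and "kb L c w c' w'" "kb L c' w' c'' w''"
  shows "kb L c w c'' w''"
proof -
  obtain k where k: "k \<prec> p1 c" "\<And>j. j \<prec> k \<Longrightarrow> ap c j = ap c' j \<and> ap w j = ap w' j"
    "k = p1 c' \<or> k \<prec> p1 c' \<and> (ap c k \<prec> ap c' k \<or> ap c k = ap c' k \<and> L (ap w k) (ap w' k))"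
    using assms(2) unfolding kb_def by blast
  obtain l where l: "l \<prec> p1 c'" "\<And>j. j \<prec> l \<Longrightarrow> ap c' j = ap c'' j \<and> ap w' j = ap w'' j"
    "l = p1 c'' \<or> l \<prec> p1 c'' \<and> (ap c' l \<prec> ap c'' l \<or> ap c' l = ap c'' l \<and> L (ap w' l) (ap w'' l))"
    using assms(3) unfolding kb_def by blast
  consider "k \<prec> l" | "k = l" | "l \<prec> k" using linear by blast
  then show ?thesis
  proof cases
    case 1
    then have "k \<prec> p1 c'" using l(1) less_trans by blast
    then have "ap c k \<prec> ap c' k \<or> ap c k = ap c' k \<and> L (ap w k) (ap w' k)"
      using k(3) less_irrefl by blast
    then have "ap c k \<prec> ap c'' k \<or> ap c k = ap c'' k \<and> L (ap w k) (ap w'' k)"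
      using l(2)[OF 1] by simp
    moreover have "k \<prec> p1 c''" using 1 l(3) less_trans by blast
    moreover have "ap c j = ap c'' j \<and> ap w j = ap w'' j" if "j \<prec> k" for j
      using k(2)[OF that] l(2)[OF less_trans[OF that 1]] by simp
    ultimately show ?thesis using k(1) unfolding kb_def by blast
  next
    case 2
    have "ap c j = ap c'' j \<and> ap w j = ap w'' j" if "j \<prec> k" for j
      using k(2)[OF that] l(2)[of j] that 2 by simp
    moreover have "ap c k \<prec> ap c' k \<or> ap c k = ap c' k \<and> L (ap w k) (ap w' k)"
      using k(3) l(1) 2 less_irrefl by blast
    moreover have "k = p1 c'' \<or> k \<prec> p1 c'' \<and>
        (ap c' k \<prec> ap c'' k \<or> ap c' k = ap c'' k \<and> L (ap w' k) (ap w'' k))" using l(3) 2 by simp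
    ultimately have "k = p1 c'' \<or> k \<prec> p1 c'' \<and>
        (ap c k \<prec> ap c'' k \<or> ap c k = ap c'' k \<and> L (ap w k) (ap w'' k))"
      using less_trans[of "ap c k" "ap c' k" "ap c'' k"]
        slin_trans[OF L, of "ap w k" "ap w' k" "ap w'' k"] by auto
    with \<open>\<And>j. j \<prec> k \<Longrightarrow> ap c j = ap c'' j \<and> ap w j = ap w'' j\<close> show ?thesis
      using k(1) unfolding kb_def by blast
  next
    case 3
    then have "l \<prec> p1 c" using k(1) less_trans by blast
    moreover have "ap c j = ap c'' j \<and> ap w j = ap w'' j" if "j \<prec> l" for j
      using l(2)[OF that] k(2)[OF less_trans[OF that 3]] by simp
    moreover have "l = p1 c'' \<or> l \<prec> p1 c'' \<and>
        (ap c l \<prec> ap c'' l \<or> ap c l = ap c'' l \<and> L (ap w l) (ap w'' l))"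
      using l(3) k(2)[OF 3] by simp
    ultimately show ?thesis unfolding kb_def by blast
  qed
qed

lemma kb_total:
  assumes L: "slin L A" and c: "isseq c" "isseq w" "p1 w = p1 c" "\<And>i. i \<prec> p1 w \<Longrightarrow> ap w i \<in> A"
    and c': "isseq c'" "isseq w'" "p1 w' = p1 c'" "\<And>i. i \<prec> p1 w' \<Longrightarrow> ap w' i \<in> A"
  shows "kb L c w c' w' \<or> c = c' \<and> w = w' \<or> kb L c' w' c w"
proof -
  \<comment> \<open>The first position where a node ends or the entries differ decides the
    comparison.\<close>
  define P where "P k \<longleftrightarrow> \<not> (k \<prec> p1 c \<and> k \<prec> p1 c' \<and> ap c k = ap c' k \<and> ap w k = ap w' k)" for k
  have "rel1 P" unfolding P_def by (intro ar_intros)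
  moreover have P: "P (p1 c)" "P (p1 c')" by (simp_all add: P_def)
  ultimately obtain k where k: "P k" "\<And>j. j \<prec> k \<Longrightarrow> \<not> P j" using least_ex[of P "p1 c"] by blast
  have le: "k \<preceq> p1 c" "k \<preceq> p1 c'" using k(2) P linear by blast+
  have eq: "ap c j = ap c' j \<and> ap w j = ap w' j" "ap c' j = ap c j \<and> ap w' j = ap w j" if "j \<prec> k" for j
    using k(2)[OF that] by (auto simp: P_def)
  consider "k = p1 c" "k = p1 c'" | "k = p1 c" "k \<prec> p1 c'" | "k \<prec> p1 c" "k = p1 c'"
    | "k \<prec> p1 c" "k \<prec> p1 c'" using le by blast
  then show ?thesis
  proof cases
    case 1
    have "c = c'" by (rule seq_ext[OF c(1) c'(1)]) (use 1 eq(1) in simp_all)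
    moreover have "w = w'" by (rule seq_ext[OF c(2) c'(2)]) (use 1 eq(1) c(3) c'(3) in simp_all)
    ultimately show ?thesis by blast
  next
    case 2
    then show ?thesis using eq unfolding kb_def by blast
  next
    case 3
    then show ?thesis using eq unfolding kb_def by blast
  next
    case 4
    then have ne: "ap c k \<noteq> ap c' k \<or> ap w k \<noteq> ap w' k" using k(1) by (simp add: P_def)
    have "ap w k \<in> A" "ap w' k \<in> A" using 4 c c' by auto
    then have "L (ap w k) (ap w' k) \<or> ap w k = ap w' k \<or> L (ap w' k) (ap w k)"
      by (rule slin_total[OF L])
    with ne linear[of "ap c k" "ap c' k"]
    have "(ap c k \<prec> ap c' k \<or> ap c k = ap c' k \<and> L (ap w k) (ap w' k)) \<or>
        (ap c' k \<prec> ap c k \<or> ap c' k = ap c k \<and> L (ap w' k) (ap w k))" by metis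
    then show ?thesis
    proof
      assume "ap c k \<prec> ap c' k \<or> ap c k = ap c' k \<and> L (ap w k) (ap w' k)"
      then have "kb L c w c' w'" unfolding kb_def using 4 eq by (intro exI[of _ k]) blast
      then show ?thesis ..
    next
      assume "ap c' k \<prec> ap c k \<or> ap c' k = ap c k \<and> L (ap w' k) (ap w k)"
      then have "kb L c' w' c w" unfolding kb_def using 4 eq by (intro exI[of _ k]) blast
      then show ?thesis by blast
    qed
  qed
qed

lemma slin_fless:
  assumes L: "slin L A"
  shows "slin (fless L) {\<sigma>. F A L \<sigma>}"
  unfolding slin_def
proof (intro conjI allI impI ballI)
  show "\<not> fless L \<sigma> \<sigma>" for \<sigma>
    using slin_irrefl[OF L] kb_irrefl[OF L] unfolding fless_def by auto
next
  fix \<sigma> \<tau> \<rho> assume "fless L \<sigma> \<tau>" "fless L \<tau> \<rho>"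
  then show "fless L \<sigma> \<rho>"
    unfolding fless_def[of L \<tau> \<rho>] fless_def[of L \<sigma> \<tau>]
    by (elim disjE conjE exE)
      (auto dest: slin_trans[OF L] intro: less_trans kb_trans[OF L])
next
  fix \<sigma> \<tau> assume "\<sigma> \<in> {\<sigma>. F A L \<sigma>}" "\<tau> \<in> {\<sigma>. F A L \<sigma>}"
  then have "F A L \<sigma>" "F A L \<tau>" by auto
  then show "fless L \<sigma> \<tau> \<or> \<sigma> = \<tau> \<or> fless L \<tau> \<sigma>"
  proof (cases rule: F_cases[case_product F_cases])
    case (el_el t c x w t' c' x' w')
    have "L x x' \<or> x = x' \<or> L x' x" using slin_total[OF L] el_el by (auto simp: felem_def)
    moreover have "kb L c w c' w' \<or> c = c' \<and> w = w' \<or> kb L c' w' c w"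
      using el_el by (intro kb_total[OF L]) (auto simp: felem_def node_def)
    ultimately show ?thesis using el_el linear[of t t'] by auto
  qed auto
qed

section \<open>Supports and relabelling\<close>

lemma F_supp: "F A L \<sigma> \<Longrightarrow> supp \<sigma> \<subseteq> A"
  by (erule F_cases) (auto simp: felem_def)

lemma F_restrict: "F A L \<sigma> \<Longrightarrow> supp \<sigma> \<subseteq> B \<Longrightarrow> F B L \<sigma>"
  by (erule F_cases) (auto simp: felem_def)

lemma relabel_cong: "F A L \<sigma> \<Longrightarrow> (\<And>v. v \<in> supp \<sigma> \<Longrightarrow> h v = h' v) \<Longrightarrow> relabel h \<sigma> = relabel h' \<sigma>"
  by (erule F_cases) (auto intro!: seq_cong)

lemma relabel_id: "F A L \<sigma> \<Longrightarrow> (\<And>v. v \<in> supp \<sigma> \<Longrightarrow> h v = v) \<Longrightarrow> relabel h \<sigma> = \<sigma>"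
proof (erule F_cases)
  fix t c x w
  assume *: "\<sigma> = el t c x w" "felem A L t c x w" "\<And>v. v \<in> supp \<sigma> \<Longrightarrow> h v = v"
  then have "seq (p1 w) (\<lambda>i. h (ap w i)) = seq (p1 w) (ap w)" by (intro seq_cong) auto
  also have "\<dots> = w" using *(2) unfolding felem_def isseq_def by (elim conjE) (rule sym)
  finally show "relabel h \<sigma> = \<sigma>" using * by simp
qed simp

lemma fn1_comp_ap: "fn1 h \<Longrightarrow> fn1 (\<lambda>i. h (ap w i))"
  by (erule af_sub1) (intro ar_intros)

text \<open>Definability of \<open>h\<close> ensures that the inner list of ranks has a code, so
  that its entries can be read back.\<close>

lemma relabel_comp: "F A L \<sigma> \<Longrightarrow> fn1 h \<Longrightarrow> relabel g (relabel h \<sigma>) = relabel (\<lambda>v. g (h v)) \<sigma>"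
  by (erule F_cases) (auto intro!: seq_cong simp: fn1_comp_ap)

lemma supp_relabel: "F A L \<sigma> \<Longrightarrow> fn1 h \<Longrightarrow> supp (relabel h \<sigma>) = h ` supp \<sigma>"
proof (erule F_cases)
  fix t c x w
  assume *: "\<sigma> = el t c x w" "felem A L t c x w" "fn1 h"
  have "(\<exists>i. i \<prec> p1 w \<and> v = ap (seq (p1 w) (\<lambda>i. h (ap w i))) i) \<longleftrightarrow> (\<exists>i. i \<prec> p1 w \<and> v = h (ap w i))" for v
    using fn1_comp_ap[OF *(3)] by (auto cong: conj_cong)
  then show "supp (relabel h \<sigma>) = h ` supp \<sigma>" using * by auto
qed simp

lemma relabel_F:
  assumes "F A L \<sigma>" "fn1 h" "\<And>v. v \<in> A \<Longrightarrow> h v \<in> B"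
    and mono: "\<And>u v. u \<in> A \<Longrightarrow> v \<in> A \<Longrightarrow> L u v \<Longrightarrow> L' (h u) (h v)"
  shows "F B L' (relabel h \<sigma>)"
  using assms(1)
proof (cases rule: F_cases)
  case (el t c x w)
  have "ap (seq (p1 w) (\<lambda>i. h (ap w i))) i = h (ap w i)" if "i \<prec> p1 w" for i
    using fn1_comp_ap[OF assms(2)] that by simp
  then have "felem B L' t c (h x) (seq (p1 w) (\<lambda>i. h (ap w i)))"
    using el(2) assms(3) mono fn1_comp_ap[OF assms(2), of w] unfolding felem_def by auto
  then show ?thesis using el by simp
qed simp

lemma relabel_less:
  assumes "F A L \<sigma>" "F A L \<tau>" "fn1 h" "fless L \<sigma> \<tau>"
    and mono: "\<And>u v. u \<in> A \<Longrightarrow> v \<in> A \<Longrightarrow> L u v \<Longrightarrow> L' (h u) (h v)"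
  shows "fless L' (relabel h \<sigma>) (relabel h \<tau>)"
  using assms(1,2)
proof (cases rule: F_cases[case_product F_cases])
  case (el_el t c x w t' c' x' w')
  have x: "x \<in> A" "x' \<in> A" using el_el by (auto simp: felem_def)
  let ?w = "seq (p1 w) (\<lambda>i. h (ap w i))" and ?w' = "seq (p1 w') (\<lambda>i. h (ap w' i))"
  have w: "p1 w = p1 c" "p1 w' = p1 c'" "\<And>i. i \<prec> p1 c \<Longrightarrow> ap w i \<in> A" "\<And>i. i \<prec> p1 c' \<Longrightarrow> ap w' i \<in> A"
    using el_el by (auto simp: felem_def)
  have "kb L' c ?w c' ?w'" if "kb L c w c' w'"
  proof -
    obtain k where k: "k \<prec> p1 c" "\<And>j. j \<prec> k \<Longrightarrow> ap c j = ap c' j \<and> ap w j = ap w' j"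
      "k = p1 c' \<or> k \<prec> p1 c' \<and> (ap c k \<prec> ap c' k \<or> ap c k = ap c' k \<and> L (ap w k) (ap w' k))"
      using \<open>kb L c w c' w'\<close> unfolding kb_def by blast
    have w1: "ap ?w i = h (ap w i)" if "i \<prec> p1 c" for i
      using fn1_comp_ap[OF assms(3)] that w by simp
    have w2: "ap ?w' i = h (ap w' i)" if "i \<prec> p1 c'" for i
      using fn1_comp_ap[OF assms(3)] that w by simp
    have "ap c j = ap c' j \<and> ap ?w j = ap ?w' j" if "j \<prec> k" for j
    proof -
      have "j \<prec> p1 c" "j \<prec> p1 c'" using that k(1,3) less_trans by blast+
      then show ?thesis using k(2)[OF that] w1 w2 by simp
    qed
    moreover have "k = p1 c' \<or> k \<prec> p1 c' \<and> (ap c k \<prec> ap c' k \<or> ap c k = ap c' k \<and> L' (ap ?w k) (ap ?w' k))"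
      using k(1,3) w1 w2 w mono by metis
    ultimately show ?thesis using k(1) unfolding kb_def by blast
  qed
  then show ?thesis using assms(4) el_el mono[OF x] by auto
qed (use assms(4) in auto)

text \<open>Strict monotonicity suffices, as the order on elements is total before relabelling and
  irreflexive and transitive after it.\<close>

lemma relabel_less_iff:
  assumes "slin L A" "slin L' B" "F A L \<sigma>" "F A L \<tau>" "fn1 h"
    and "\<And>u v. u \<in> A \<Longrightarrow> v \<in> A \<Longrightarrow> L u v \<Longrightarrow> L' (h u) (h v)"
  shows "fless L' (relabel h \<sigma>) (relabel h \<tau>) \<longleftrightarrow> fless L \<sigma> \<tau>"
proof
  assume l: "fless L' (relabel h \<sigma>) (relabel h \<tau>)"
  note irr = slin_irrefl[OF slin_fless[OF assms(2)]]
  show "fless L \<sigma> \<tau>"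
  proof (rule ccontr)
    assume "\<not> fless L \<sigma> \<tau>"
    then consider "\<sigma> = \<tau>" | "fless L \<tau> \<sigma>"
      using slin_total[OF slin_fless[OF assms(1)], of \<sigma> \<tau>] assms(3,4) by blast
    then show False
    proof cases
      case 1
      then show False using l irr by simp
    next
      case 2
      then have "fless L' (relabel h \<tau>) (relabel h \<sigma>)" by (intro relabel_less[of A L] assms)
      then show False using l slin_trans[OF slin_fless[OF assms(2)]] irr by blast
    qed
  qed
qed (intro relabel_less[of A L] assms)

lemma fin_supp:
  assumes "F A L \<sigma>"
  shows "fin M (supp \<sigma>)"
  using assms
proof (cases rule: F_cases)
  case bot
  have "{x. x \<noteq> x} \<in> Sets M" by (intro comprehension ar_intros)
  then show ?thesis using bot by (simp add: fin_iff)
next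
  case (el t c x w)
  obtain b where b: "vals w \<subseteq> below M b" using fin_vals fin_iff by blast
  have "v \<prec> b \<oplus> (x \<oplus> \<one>)" if "v \<in> supp \<sigma>" for v
  proof (cases "v = x")
    case True
    have "x \<prec> x \<oplus> \<one>" by simp
    also have "x \<oplus> \<one> \<preceq> b \<oplus> (x \<oplus> \<one>)" by (rule le_add2)
    finally show ?thesis using True by simp
  next
    case False
    then have "v \<in> vals w" using that el(1) by (auto simp: vals_def)
    then have "v \<prec> b" using b by auto
    also have "b \<preceq> b \<oplus> (x \<oplus> \<one>)" by (rule le_add1)
    finally show ?thesis .
  qed
  then have "supp \<sigma> \<subseteq> below M (b \<oplus> (x \<oplus> \<one>))" by auto
  moreover have "{v. v \<in> supp \<sigma>} \<in> Sets M" by (intro comprehension ar_intros)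
  ultimately show ?thesis by (auto simp: fin_iff)
qed

text \<open>\<open>\<sigma>'\<close> arises by relabelling along the inverse \<open>q\<close> of the
  enumeration of the support. Over the numbers this gives the support condition of a prae-dilator;
  over \<open>X\<close> it shows that each element is represented in the order
  \<open>D\<^sup>T(X)\<close>.\<close>

lemma decompose:
  assumes L: "slin L A" and \<sigma>: "F A L \<sigma>" and g: "inc L g" "vals g = supp \<sigma>"
  obtains \<sigma>' where "F (below M (p1 g)) (Less M) \<sigma>'" "relabel (ap g) \<sigma>' = \<sigma>" "supp \<sigma>' = below M (p1 g)"
proof -
  define q where "q v = lst (\<lambda>j. j \<prec> p1 g \<and> ap g j = v)" for v
  have q_fn: "fn1 q" unfolding q_def by (intro ar_intros)
  have q: "q (ap g i) = i" if "i \<prec> p1 g" for i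
    unfolding q_def using inc_inj[OF L g(1) _ that] that by (intro lst_unique) blast
  have S: "F (vals g) L \<sigma>" using F_restrict[OF \<sigma>] g(2) by simp
  have q_mono: "q u \<prec> q v" if "u \<in> vals g" "v \<in> vals g" "L u v" for u v
    using that q inc_less_iff[OF L g(1)] by (auto simp: vals_def)
  show ?thesis
  proof
    show "F (below M (p1 g)) (Less M) (relabel q \<sigma>)"
      using S q_fn by (rule relabel_F) (auto simp: vals_def q q_mono)
    have "relabel (ap g) (relabel q \<sigma>) = relabel (\<lambda>v. ap g (q v)) \<sigma>" by (rule relabel_comp[OF S q_fn])
    also have "\<dots> = \<sigma>" using S by (rule relabel_id) (auto simp: g(2)[symmetric] vals_def q)
    finally show "relabel (ap g) (relabel q \<sigma>) = \<sigma>" .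
    have "supp (relabel q \<sigma>) = q ` vals g" using supp_relabel[OF S q_fn] g(2) by simp
    also have "\<dots> = below M (p1 g)" using q by (force simp: vals_def image_iff)
    finally show "supp (relabel q \<sigma>) = below M (p1 g)" .
  qed
qed

section \<open>The functor, its supports and its codes\<close>

abbreviation "FN n \<equiv> F (below M n) (Less M)"

lemma Ord_dil: "(\<sigma>, \<tau>) \<in> Ord dil n \<longleftrightarrow> FN n \<sigma> \<and> FN n \<tau> \<and> (\<sigma> = \<tau> \<or> fless (Less M) \<sigma> \<tau>)"
  by (simp add: dil_def)

lemma Fld_dil [simp]: "Fld dil n = {\<sigma>. FN n \<sigma>}"
  by (auto simp: Field_def Ord_dil)

lemma fless_irrefl_nat: "\<not> fless (Less M) \<sigma> \<sigma>"
  using slin_irrefl[OF slin_fless[OF slin_less]] .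

lemma lt_dil: "lt (Ord dil n) \<sigma> \<tau> \<longleftrightarrow> FN n \<sigma> \<and> FN n \<tau> \<and> fless (Less M) \<sigma> \<tau>"
  using fless_irrefl_nat by (auto simp: lt_def Ord_dil)

lemma Supp_dil [simp]: "Supp dil n \<sigma> = supp \<sigma>"
  by (simp add: dil_def)

lemma Linear_order_dil: "Linear_order (Ord dil n)"
proof -
  note lin = slin_fless[OF slin_less, of "below M n"]
  have "trans (Ord dil n)"
    unfolding trans_def Ord_dil using slin_trans[OF lin] by blast
  moreover have "antisym (Ord dil n)"
    unfolding antisym_def Ord_dil using slin_trans[OF lin] slin_irrefl[OF lin] by blast
  moreover have "total_on (Fld dil n) (Ord dil n)"
    unfolding total_on_def Ord_dil Fld_dil using slin_total[OF lin] by blast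
  ultimately show ?thesis
    by (auto simp: order_on_defs refl_on_def Ord_dil)
qed

lemma code_ap:
  assumes "fin M (fgraph M n f)" "i \<prec> n"
  shows "ap (pr M \<zero> (fcode M (fgraph M n f))) i = f i"
  using ap_seq[OF assms] by (simp add: ap_def seq_def)

lemma act_dil:
  assumes "nat_mor M n m f" "FN n \<sigma>" "\<And>i. i \<prec> n \<Longrightarrow> h i = f i"
  shows "act M dil n m f \<sigma> = relabel h \<sigma>"
proof -
  have "act M dil n m f \<sigma> = relabel (ap (pr M \<zero> (fcode M (fgraph M n f)))) \<sigma>"
    by (simp add: act_def dil_def)
  also have "\<dots> = relabel h \<sigma>"
    using assms(2) by (rule relabel_cong) (use F_supp[OF assms(2)] assms(1,3) in \<open>auto simp: code_ap nat_mor_def\<close>)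
  finally show ?thesis .
qed

text \<open>A morphism may be undefinable outside its domain, while the relabelling lemmas ask for a
  definable function. This one is read off from the code of the graph and agrees with
  \<open>f\<close> below \<open>n\<close>.\<close>

definition graph_fun :: "'a \<Rightarrow> ('a \<Rightarrow> 'a) \<Rightarrow> 'a \<Rightarrow> 'a" where
  "graph_fun n f = ap (pr M \<zero> (fcode M (fgraph M n f)))"

lemma graph_fun:
  assumes "nat_mor M n m f"
  shows "fn1 (graph_fun n f)" "\<And>i. i \<prec> n \<Longrightarrow> graph_fun n f i = f i"
    "\<And>i. i \<prec> n \<Longrightarrow> graph_fun n f i \<prec> m"
    "\<And>i j. i \<prec> n \<Longrightarrow> j \<prec> n \<Longrightarrow> i \<prec> j \<Longrightarrow> graph_fun n f i \<prec> graph_fun n f j"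
proof -
  show "fn1 (graph_fun n f)" unfolding graph_fun_def by (rule fn1_ap)
  show eq: "graph_fun n f i = f i" if "i \<prec> n" for i
    using assms that unfolding graph_fun_def by (intro code_ap) (auto simp: nat_mor_def)
  show "graph_fun n f i \<prec> m" if "i \<prec> n" for i
    using assms that eq[OF that] by (auto simp: nat_mor_def Pi_iff)
  show "graph_fun n f i \<prec> graph_fun n f j" if "i \<prec> n" "j \<prec> n" "i \<prec> j" for i j
    using assms that eq[OF that(1)] eq[OF that(2)] by (auto simp: nat_mor_def)
qed

lemma act_dil_F:
  assumes "nat_mor M n m f" "FN n \<sigma>"
  shows "FN m (act M dil n m f \<sigma>)"
proof -
  define h where "h = graph_fun n f"
  note h = graph_fun[OF assms(1), folded h_def]
  have "act M dil n m f \<sigma> = relabel h \<sigma>" by (rule act_dil[OF assms]) (rule h)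
  moreover have "FN m (relabel h \<sigma>)" using h by (intro relabel_F[OF assms(2)]) auto
  ultimately show ?thesis by simp
qed

lemma act_dil_less:
  assumes "nat_mor M n m f" "FN n \<sigma>" "FN n \<tau>"
  shows "fless (Less M) (act M dil n m f \<sigma>) (act M dil n m f \<tau>) \<longleftrightarrow> fless (Less M) \<sigma> \<tau>"
proof -
  define h where "h = graph_fun n f"
  note h = graph_fun[OF assms(1), folded h_def]
  have "act M dil n m f \<sigma> = relabel h \<sigma>" "act M dil n m f \<tau> = relabel h \<tau>"
    by (rule act_dil[OF assms(1,2)] act_dil[OF assms(1,3)], rule h, assumption)+
  moreover have "fless (Less M) (relabel h \<sigma>) (relabel h \<tau>) \<longleftrightarrow> fless (Less M) \<sigma> \<tau>"
    using h by (intro relabel_less_iff[OF slin_less slin_less assms(2,3)]) auto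
  ultimately show ?thesis by simp
qed

lemma nat_functor_dil: "nat_functor M dil"
  unfolding nat_functor_def
proof (intro conjI allI impI ballI)
  fix n m f assume f: "nat_mor M n m f"
  note lin = slin_fless[OF slin_less, of "below M n"]
  show "order_embedding (Ord dil n) (Ord dil m) (act M dil n m f)"
    unfolding order_embedding_def
  proof (intro conjI ballI)
    show "act M dil n m f ` Fld dil n \<subseteq> Fld dil m" using act_dil_F[OF f] by auto
    fix \<sigma> \<tau> assume "\<sigma> \<in> Fld dil n" "\<tau> \<in> Fld dil n"
    then have F: "FN n \<sigma>" "FN n \<tau>" by auto
    have "act M dil n m f \<sigma> = act M dil n m f \<tau> \<longleftrightarrow> \<sigma> = \<tau>"
      using slin_total[OF lin, of \<sigma> \<tau>] F act_dil_less[OF f] fless_irrefl_nat by (metis mem_Collect_eq)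
    then show "(\<sigma>, \<tau>) \<in> Ord dil n \<longleftrightarrow> (act M dil n m f \<sigma>, act M dil n m f \<tau>) \<in> Ord dil m"
      using F act_dil_F[OF f] act_dil_less[OF f] by (simp add: Ord_dil)
  qed
next
  fix n \<sigma> assume "\<sigma> \<in> Fld dil n"
  then have \<sigma>: "FN n \<sigma>" by simp
  have "fn1 (\<lambda>i. i)" by (intro ar_intros)
  then have "nat_mor M n n (\<lambda>i. i)" by (auto simp: nat_mor_def intro: fin_fgraph)
  then have "act M dil n n (\<lambda>i. i) \<sigma> = relabel (\<lambda>i. i) \<sigma>" using \<sigma> by (rule act_dil) simp
  then show "act M dil n n (\<lambda>i. i) \<sigma> = \<sigma>" using relabel_id[OF \<sigma>] by simp
next
  fix n m k f g \<sigma> assume fg: "nat_mor M n m f \<and> nat_mor M m k g" and "\<sigma> \<in> Fld dil n"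
  then have f: "nat_mor M n m f" and g: "nat_mor M m k g" and \<sigma>: "FN n \<sigma>" by auto
  define h where "h = graph_fun n f"
  note h = graph_fun[OF f, folded h_def]
  define h' where "h' = graph_fun m g"
  note h' = graph_fun[OF g, folded h'_def]
  have hh: "fn1 (\<lambda>i. h' (h i))" by (rule af_sub1[OF h'(1) h(1)])
  have "(g \<circ> f) i = h' (h i)" if "i \<prec> n" for i
    using h(2,3)[OF that] h'(2)[of "h i"] by simp
  moreover from this have "fgraph M n (g \<circ> f) = fgraph M n (\<lambda>i. h' (h i))" by (intro fgraph_cong)
  ultimately have "nat_mor M n k (g \<circ> f)"
    using fin_fgraph[OF hh, of n] h h' by (auto simp: nat_mor_def)
  then have "act M dil n k (g \<circ> f) \<sigma> = relabel (\<lambda>i. h' (h i)) \<sigma>"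
    using \<sigma> by (rule act_dil) (use \<open>\<And>i. i \<prec> n \<Longrightarrow> (g \<circ> f) i = h' (h i)\<close> in simp)
  also have "\<dots> = relabel h' (relabel h \<sigma>)" using relabel_comp[OF \<sigma> h(1)] by simp
  also have "\<dots> = relabel h' (act M dil n m f \<sigma>)" using act_dil[OF f \<sigma>, of h] h(2) by simp
  also have "\<dots> = act M dil m k g (act M dil n m f \<sigma>)"
    by (rule act_dil[symmetric, OF g act_dil_F[OF f \<sigma>] h'(2)])
  finally show "act M dil n k (g \<circ> f) \<sigma> = act M dil m k g (act M dil n m f \<sigma>)" .
qed (rule Linear_order_dil)

lemma lt_nat_le: "lt (nat_le M) = Less M"
  by (auto simp: lt_def nat_le_def fun_eq_iff)

lemma Field_nat_le: "Field (nat_le M) = UNIV"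
  by (auto simp: Field_def nat_le_def)

lemma Linear_order_nat_le: "Linear_order (nat_le M)"
proof -
  have "trans (nat_le M)" unfolding nat_le_def by (rule transI) (use less_trans in blast)
  moreover have "antisym (nat_le M)" unfolding nat_le_def by (rule antisymI) (use less_asym in blast)
  moreover have "total (nat_le M)" unfolding nat_le_def total_on_def using linear by blast
  ultimately show ?thesis unfolding order_on_defs Field_nat_le by (auto simp: nat_le_def refl_on_def)
qed

lemma nat_mor_inc:
  assumes "inc (Less M) g" "vals g \<subseteq> below M n"
  shows "nat_mor M (p1 g) n (restrict (ap g) (below M (p1 g)))"
proof -
  have "fin M (fgraph M (p1 g) (restrict (ap g) (below M (p1 g))))"
    using fgraph_ap[of "p1 g" g] fgraph_cong[of "p1 g" "restrict (ap g) (below M (p1 g))" "ap g"] by simp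
  moreover have "ap g i \<in> vals g" if "i \<prec> p1 g" for i using that by (auto simp: vals_def)
  ultimately show ?thesis using assms by (auto simp: nat_mor_def inc_def)
qed

lemma supports_dil: "supports M dil"
  unfolding supports_def
proof (intro conjI allI impI ballI)
  fix n \<sigma> assume "\<sigma> \<in> Fld dil n"
  then have \<sigma>: "FN n \<sigma>" by simp
  show sub: "Supp dil n \<sigma> \<subseteq> below M n" using F_supp[OF \<sigma>] by simp
  show "fin M (Supp dil n \<sigma>)" using fin_supp[OF \<sigma>] by simp
  obtain g where g: "inc (Less M) g" "vals g = supp \<sigma>"
    using inc_exists[OF slin_less rel2_less fin_supp[OF \<sigma>] F_supp[OF \<sigma>]] .
  have e: "enum M (nat_le M) (supp \<sigma>) = restrict (ap g) (below M (p1 g))"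
    using enum_eq[OF Linear_order_nat_le, of g] g by (simp add: lt_nat_le)
  have c: "fcard M (supp \<sigma>) = p1 g" using fcard_vals[OF slin_less g(1)] g(2) by simp
  obtain \<sigma>' where \<sigma>': "FN (p1 g) \<sigma>'" "relabel (ap g) \<sigma>' = \<sigma>"
    using decompose[OF slin_less \<sigma> g] by blast
  have "act M dil (p1 g) n (restrict (ap g) (below M (p1 g))) \<sigma>' = relabel (ap g) \<sigma>'"
    using nat_mor_inc[OF g(1)] sub g(2) by (intro act_dil[OF _ \<sigma>'(1)]) simp_all
  then show "\<sigma> \<in> act M dil (fcard M (Supp dil n \<sigma>)) n (enum M (nat_le M) (Supp dil n \<sigma>)) `
      Fld dil (fcard M (Supp dil n \<sigma>))"
    using \<sigma>' by (auto simp: e c image_iff)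
next
  fix n m f \<sigma> assume f: "nat_mor M n m f" and "\<sigma> \<in> Fld dil n"
  then have \<sigma>: "FN n \<sigma>" by simp
  define h where "h = graph_fun n f"
  note h = graph_fun[OF f, folded h_def]
  have "act M dil n m f \<sigma> = relabel h \<sigma>" by (rule act_dil[OF f \<sigma>]) (rule h)
  moreover have "h ` supp \<sigma> = f ` supp \<sigma>"
    using F_supp[OF \<sigma>] h(2) by (intro image_cong) auto
  ultimately show "Supp dil m (act M dil n m f \<sigma>) = f ` Supp dil n \<sigma>"
    using supp_relabel[OF \<sigma> h(1)] by simp
qed

lemma praedilator_coded_dil: "praedilator_coded M dil"
proof -
  have "{z. \<exists>n \<sigma> \<tau>. z = pr M n (pr M \<sigma> \<tau>) \<and> FN n \<sigma> \<and> FN n \<tau> \<and> (\<sigma> = \<tau> \<or> fless (Less M) \<sigma> \<tau>)} \<in> Sets M"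
    by (intro comprehension ar_intros)
  then have 1: "{pr M n (pr M \<sigma> \<tau>) | n \<sigma> \<tau>. (\<sigma>, \<tau>) \<in> Ord dil n} \<in> Sets M"
    unfolding Ord_dil .
  \<comment> \<open>Comprehension cannot quantify over morphisms as functions. \<open>mor\<close>
    says in terms of numbers that \<open>g\<close> is the canonical code of one.\<close>
  define mor where "mor n m g \<longleftrightarrow> g = fcode M (fgraph M n (ap (pr M \<zero> g))) \<and>
    (\<forall>i. i \<prec> n \<longrightarrow> ap (pr M \<zero> g) i \<prec> m) \<and>
    (\<forall>i j. i \<prec> n \<and> j \<prec> n \<and> i \<prec> j \<longrightarrow> ap (pr M \<zero> g) i \<prec> ap (pr M \<zero> g) j)" for n m g
  have [ar_intros]: "ar (\<lambda>e. mor (s e) (t e) (u e))" if "af s" "af t" "af u" for s t u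
    by (rule ar_sub3[OF _ that]) (unfold mor_def, intro ar_intros)
  have "{z. \<exists>n m g \<sigma>. z = pr M (pr M n (pr M m g)) (pr M \<sigma> (relabel (ap (pr M \<zero> g)) \<sigma>)) \<and>
      mor n m g \<and> FN n \<sigma>} \<in> Sets M" (is "?S \<in> _")
    by (intro comprehension ar_intros)
  moreover have "?S = {pr M (pr M n (pr M m (fcode M (fgraph M n f)))) (pr M \<sigma> (act M dil n m f \<sigma>)) | n m f \<sigma>.
        nat_mor M n m f \<and> \<sigma> \<in> Fld dil n}" (is "_ = ?T")
  proof (intro equalityI subsetI)
    fix z assume "z \<in> ?S"
    then obtain n m g \<sigma> where z: "z = pr M (pr M n (pr M m g)) (pr M \<sigma> (relabel (ap (pr M \<zero> g)) \<sigma>))"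
      "mor n m g" "FN n \<sigma>" by blast
    let ?f = "ap (pr M \<zero> g)"
    have f: "nat_mor M n m ?f" using z(2) fgraph_ap by (auto simp: mor_def nat_mor_def)
    have "g = fcode M (fgraph M n ?f)" using z(2) unfolding mor_def by (rule conjunct1)
    then have "z = pr M (pr M n (pr M m (fcode M (fgraph M n ?f)))) (pr M \<sigma> (act M dil n m ?f \<sigma>))"
      using z(1) act_dil[OF f z(3), of ?f] by simp
    then show "z \<in> ?T" using f z(3)
      by (intro CollectI exI[of _ n] exI[of _ m] exI[of _ ?f] exI[of _ \<sigma>]) simp
  next
    fix z assume "z \<in> ?T"
    then obtain n m f \<sigma> where z: "z = pr M (pr M n (pr M m (fcode M (fgraph M n f)))) (pr M \<sigma> (act M dil n m f \<sigma>))"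
      "nat_mor M n m f" "FN n \<sigma>" by auto
    let ?g = "fcode M (fgraph M n f)"
    have eq: "ap (pr M \<zero> ?g) i = f i" if "i \<prec> n" for i
      using z(2) that by (intro code_ap) (auto simp: nat_mor_def)
    then have "fgraph M n (ap (pr M \<zero> ?g)) = fgraph M n f" by (rule fgraph_cong)
    then have "mor n m ?g" using z(2) eq by (auto simp: mor_def nat_mor_def)
    moreover have "act M dil n m f \<sigma> = relabel (ap (pr M \<zero> ?g)) \<sigma>" by (rule act_dil[OF z(2,3) eq])
    ultimately show "z \<in> ?S" using z
      by (intro CollectI exI[of _ n] exI[of _ m] exI[of _ ?g] exI[of _ \<sigma>]) simp
  qed
  ultimately have 2: "?T \<in> Sets M" by simp
  have "{z. \<exists>n \<sigma>. z = pr M n (pr M \<sigma> (fcode M (supp \<sigma>))) \<and> FN n \<sigma>} \<in> Sets M"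
    by (intro comprehension ar_intros)
  then have 3: "{pr M n (pr M \<sigma> (fcode M (Supp dil n \<sigma>))) | n \<sigma>. \<sigma> \<in> Fld dil n} \<in> Sets M"
    by simp
  from 1 2 3 show ?thesis unfolding praedilator_coded_def by blast
qed

lemma coded_praedilator_dil: "coded_praedilator M dil"
  unfolding coded_praedilator_def
  using praedilator_coded_dil nat_functor_dil supports_dil by blast

section \<open>Normality\<close>

lemma Mu_dil: "Mu dil n k = el \<zero> root k root"
  by (simp add: dil_def)

lemma felem_root: "x \<in> A \<Longrightarrow> felem A L \<zero> root x root"
  by (simp add: felem_def)

text \<open>The bound of an element is the largest member of its support, and it is compared first.
  As no element with bound \<open>m\<close> lies below \<open>Mu n m\<close>, an element is smaller
  than \<open>Mu n m\<close> exactly if its bound is smaller than \<open>m\<close>.\<close>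

lemma normality_dil: "normality M dil"
  unfolding normality_def Mu_dil
proof (intro conjI allI impI ballI)
  have "{z. \<exists>n k. z = pr M n (pr M k (el \<zero> root k root)) \<and> k \<in> below M n} \<in> Sets M"
    by (intro comprehension ar_intros)
  then show "{pr M n (pr M k (el \<zero> root k root)) | n k. k \<in> below M n} \<in> Sets M" .
next
  fix n m f k assume f: "nat_mor M n m f" and k: "k \<in> below M n"
  define h where "h = graph_fun n f"
  note h = graph_fun[OF f, folded h_def]
  have "act M dil n m f (el \<zero> root k root) = relabel h (el \<zero> root k root)"
    using felem_root[OF k] by (intro act_dil[OF f] h(2)) simp_all
  also have "\<dots> = el \<zero> root (f k) root"
    using h k fn1_comp_ap[OF h(1), of root] by (auto intro!: isseq_zero)
  finally show "act M dil n m f (el \<zero> root k root) = el \<zero> root (f k) root" .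
next
  fix n m \<sigma> assume m: "m \<in> below M n" and "\<sigma> \<in> Fld dil n"
  then have \<sigma>: "FN n \<sigma>" by simp
  then show "lt (Ord dil n) \<sigma> (el \<zero> root m root) \<longleftrightarrow> Supp dil n \<sigma> \<subseteq> below M m"
  proof (cases rule: F_cases)
    case bot
    then show ?thesis using m by (simp add: lt_dil felem_root)
  next
    case (el t c x w)
    have "\<not> (x = m \<and> (t \<prec> \<zero> \<or> t = \<zero> \<and> kb (Less M) c w root root))"
    proof
      assume "x = m \<and> (t \<prec> \<zero> \<or> t = \<zero> \<and> kb (Less M) c w root root)"
      then have t: "t = \<zero>" "kb (Less M) c w root root" by auto
      then have "c = root" using el(2) node_zero by (auto simp: felem_def)
      then have "w = root" using el(2) isseq_zero by (auto simp: felem_def)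
      then show False using t \<open>c = root\<close> kb_irrefl[OF slin_less] by simp
    qed
    then have "lt (Ord dil n) \<sigma> (el \<zero> root m root) \<longleftrightarrow> x \<prec> m"
      using m \<sigma> el(1) by (auto simp: lt_dil felem_root)
    also have "\<dots> \<longleftrightarrow> supp \<sigma> \<subseteq> below M m"
    proof
      assume x: "x \<prec> m"
      have "v \<prec> x \<or> v = x" if "v \<in> supp \<sigma>" for v using el that by (auto simp: felem_def)
      from le_less_trans[OF this x] show "supp \<sigma> \<subseteq> below M m" by auto
    qed (use el(1) in auto)
    finally show ?thesis by simp
  qed
qed (auto simp: felem_root lt_dil)

section \<open>Well-foundedness\<close>


abbreviation path :: "'a \<Rightarrow> ('a \<Rightarrow> 'a) \<Rightarrow> bool" where
  "path n G \<equiv> \<forall>x i. Q n x (G x) i (G i)"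

lemma no_descent:
  assumes "minimal_principle L" "fn1 s"
  shows "\<exists>i. \<not> L (s (i \<oplus> \<one>)) (s i)"
proof (rule ccontr)
  assume neg: "\<nexists>i. \<not> L (s (i \<oplus> \<one>)) (s i)"
  have "rel1 (\<lambda>x. \<exists>i. x = s i)" by (intro ar_intros af_sub1[OF assms(2)])
  then obtain m where m: "\<exists>i. m = s i" "\<And>y. L y m \<Longrightarrow> \<not> (\<exists>i. y = s i)"
    by (rule minimal_principleD[OF assms(1), of _ "s \<zero>"]) blast+
  then show False using neg by blast
qed

lemma node_path: "fn1 G \<Longrightarrow> path n G \<Longrightarrow> node n (seq k G)"
  by (simp add: node_def)

text \<open>The initial segments of a path are nodes that extend each other, so their ranks would
  form a definable descending sequence.\<close>

lemma no_path_of_ranking: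
  assumes L: "minimal_principle L" and f: "fn1 f"
    and rank: "\<And>i j. node n i \<Longrightarrow> node n j \<Longrightarrow> ext i j \<Longrightarrow> L (f j) (f i)"
  shows "\<nexists>G. fn1 G \<and> path n G"
proof
  assume "\<exists>G. fn1 G \<and> path n G"
  then obtain G where G: "fn1 G" "path n G" by blast
  note [ar_intros] = af_sub1[OF G(1)] af_sub1[OF f]
  have s: "fn1 (\<lambda>k. f (seq k G))" by (intro ar_intros)
  have "ext (seq k G) (seq (k \<oplus> \<one>) G)" for k
    using G(1) less_trans[OF _ less_suc_self] by (simp add: ext_def)
  then have "L (f (seq (k \<oplus> \<one>) G)) (f (seq k G))" for k
    using rank node_path[OF G] by blast
  then show False using no_descent[OF L s] by blast
qed

text \<open>A descending sequence stabilises first in the bounds, then in the tree indices, and then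
  in each position of nodes and rank lists, whose lengths grow beyond every number. The limits are a
  path and a rank function on the previous tree. They are arithmetical in the sequence, as the
  stages of stabilisation can be chosen definably.\<close>

lemma F_no_descent:
  assumes L: "slin L A" "rel2 L" "minimal_principle L" and u: "fn1 u" "\<And>i. F A L (u i)"
  shows "\<exists>i. \<not> fless L (u (i \<oplus> \<one>)) (u i)"
proof (rule ccontr)
  assume "\<nexists>i. \<not> fless L (u (i \<oplus> \<one>)) (u i)"
  then have desc: "fless L (u (i \<oplus> \<one>)) (u i)" for i by blast
  note [ar_intros] = af_sub1[OF u(1)]
  define t where "t i = p1 (p2 (u i))" for i
  define c where "c i = p1 (p2 (p2 (u i)))" for i
  define x where "x i = p1 (p2 (p2 (p2 (u i))))" for i
  define w where "w i = p2 (p2 (p2 (p2 (u i))))" for i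
  have u_eq: "u i = el (t i) (c i) (x i) (w i)" for i
  proof -
    obtain t' c' x' w' where "u i = el t' c' x' w'" using desc[of i] unfolding fless_def by blast
    then show ?thesis by (simp add: t_def c_def x_def w_def el_def)
  qed
  have elem: "felem A L (t i) (c i) (x i) (w i)" for i using u(2)[of i] unfolding u_eq by simp
  have step: "L (x (i \<oplus> \<one>)) (x i) \<or> x (i \<oplus> \<one>) = x i \<and> (t (i \<oplus> \<one>) \<prec> t i \<or>
      t (i \<oplus> \<one>) = t i \<and> kb L (c (i \<oplus> \<one>)) (w (i \<oplus> \<one>)) (c i) (w i))" for i
    using desc[of i] unfolding u_eq by simp
  have fns: "fn1 t" "fn1 c" "fn1 x" "fn1 w" unfolding t_def c_def x_def w_def by (intro ar_intros)+
  note [ar_intros] = fns[THEN af_sub1]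
  obtain I1 where I1: "\<And>i. I1 \<preceq> i \<Longrightarrow> x i = x I1"
  proof (rule eventually_constant[OF L(3) fns(3), of \<zero>])
    show "x (i \<oplus> \<one>) = x i \<or> L (x (i \<oplus> \<one>)) (x i)" for i using step by blast
  qed blast
  have suc_le_I: "a \<preceq> i \<oplus> \<one>" if "a \<preceq> i" for a i using that less_trans less_suc_self by blast
  have x_suc: "x (i \<oplus> \<one>) = x i" if "I1 \<preceq> i" for i
    using I1[OF that] I1[OF suc_le_I[OF that]] by simp
  obtain I2 where I2: "I1 \<preceq> I2" "\<And>i. I2 \<preceq> i \<Longrightarrow> t i = t I2"
  proof (rule eventually_constant[OF minimal_principle_less fns(1), of I1])
    show "t (i \<oplus> \<one>) = t i \<or> t (i \<oplus> \<one>) \<prec> t i" if "I1 \<preceq> i" for i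
      using step[of i] x_suc[OF that] slin_irrefl[OF L(1)] by metis
  qed blast
  have kb: "kb L (c (i \<oplus> \<one>)) (w (i \<oplus> \<one>)) (c i) (w i)" if i: "I2 \<preceq> i" for i
  proof -
    have "t (i \<oplus> \<one>) = t i" using I2(2)[OF i] I2(2)[OF suc_le_I[OF i]] by simp
    moreover have "x (i \<oplus> \<one>) = x i" using x_suc le_trans[OF I2(1) i] by blast
    ultimately show ?thesis using step[of i] slin_irrefl[OF L(1)] by simp
  qed
  \<comment> \<open>From stage \<open>I\<close> on, the first \<open>k\<close> entries are present
    and no longer change.\<close>
  define S where "S k I \<longleftrightarrow> I2 \<preceq> I \<and> (\<forall>i. I \<preceq> i \<longrightarrow> k \<preceq> p1 (c i) \<and>
    (\<forall>j. j \<prec> k \<longrightarrow> ap (c i) j = ap (c I) j \<and> ap (w i) j = ap (w I) j))" for k I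
  have S_ar: "rel2 S" unfolding S_def by (intro ar_intros)
  note [ar_intros] = ar_sub2[OF S_ar]
  have S_ex: "\<exists>I. S k I" for k
  proof (induction k rule: m_induct)
    show "ar (\<lambda>e. \<exists>I. S (e 0) I)" by (intro ar_intros)
  next
    case zero
    show ?case using zero_le by (intro exI[of _ I2]) (simp add: S_def)
  next
    case (suc k)
    then obtain I where I: "S k I" by blast
    have I2I: "I2 \<preceq> I" using I unfolding S_def by blast
    have kle: "k \<preceq> p1 (c i)" if "I \<preceq> i" for i using I that unfolding S_def by blast
    have eq: "ap (c (i \<oplus> \<one>)) j = ap (c i) j \<and> ap (w (i \<oplus> \<one>)) j = ap (w i) j" if "I \<preceq> i" "j \<prec> k" for i j
      using I that(2) that(1) suc_le_I[OF that(1)] unfolding S_def by metis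
    \<comment> \<open>As the first \<open>k\<close> entries are stable, the descent takes place at
      position \<open>k\<close> or later. So the next node has an entry at \<open>k\<close>, and the
      pair there does not increase in the lexicographic order once it exists.\<close>
    have diff: "k \<prec> p1 (c (i \<oplus> \<one>)) \<and> (k \<prec> p1 (c i) \<longrightarrow>
        ap (c (i \<oplus> \<one>)) k \<prec> ap (c i) k \<or> ap (c (i \<oplus> \<one>)) k = ap (c i) k \<and>
        (L (ap (w (i \<oplus> \<one>)) k) (ap (w i) k) \<or> ap (w (i \<oplus> \<one>)) k = ap (w i) k))"
      if i: "I \<preceq> i" for i
    proof -
      obtain l where l: "l \<prec> p1 (c (i \<oplus> \<one>))"
        "\<And>j. j \<prec> l \<Longrightarrow> ap (c (i \<oplus> \<one>)) j = ap (c i) j \<and> ap (w (i \<oplus> \<one>)) j = ap (w i) j"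
        "l = p1 (c i) \<or> l \<prec> p1 (c i) \<and> (ap (c (i \<oplus> \<one>)) l \<prec> ap (c i) l \<or>
          ap (c (i \<oplus> \<one>)) l = ap (c i) l \<and> L (ap (w (i \<oplus> \<one>)) l) (ap (w i) l))"
        using kb[OF le_trans[OF I2I i]] unfolding kb_def by blast
      have "\<not> l \<prec> k"
      proof
        assume lk: "l \<prec> k"
        then have "l \<noteq> p1 (c i)" using kle[OF i] less_asym by auto
        then show False using l(3) eq[OF i lk] slin_irrefl[OF L(1)] by auto
      qed
      then have "k \<prec> l \<or> k = l" using linear by blast
      then show ?thesis
      proof
        assume kl: "k \<prec> l"
        then show ?thesis using l(2)[OF kl] less_trans[OF kl l(1)] by simp
      next
        assume "k = l"
        then show ?thesis using l(1,3) by auto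
      qed
    qed
    let ?I = "I \<oplus> \<one>"
    have len: "k \<prec> p1 (c i)" if "?I \<preceq> i" for i
    proof (cases i rule: cases_m)
      case zero
      then show ?thesis using that by auto
    next
      case (suc j)
      then have "I \<preceq> j" using that by auto
      then show ?thesis using diff[of j] suc by blast
    qed
    have I_le: "I \<preceq> i" if "?I \<preceq> i" for i
      by (rule le_trans[OF disjI1[OF less_suc_self] that])
    \<comment> \<open>The node entry at \<open>k\<close> stabilises first; only then is the rank at
      \<open>k\<close> monotone and stabilises over \<open>L\<close>.\<close>
    obtain I3 where I3: "?I \<preceq> I3" "\<And>i. I3 \<preceq> i \<Longrightarrow> ap (c i) k = ap (c I3) k"
    proof (rule eventually_constant[OF minimal_principle_less, of "\<lambda>i. ap (c i) k" ?I])
      show "fn1 (\<lambda>i. ap (c i) k)" by (intro ar_intros)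
      show "ap (c (i \<oplus> \<one>)) k = ap (c i) k \<or> ap (c (i \<oplus> \<one>)) k \<prec> ap (c i) k" if "?I \<preceq> i" for i
        using diff[OF I_le[OF that]] len[OF that] by blast
    qed blast
    obtain I4 where I4: "I3 \<preceq> I4" "\<And>i. I4 \<preceq> i \<Longrightarrow> ap (w i) k = ap (w I4) k"
    proof (rule eventually_constant[OF L(3), of "\<lambda>i. ap (w i) k" I3])
      show "fn1 (\<lambda>i. ap (w i) k)" by (intro ar_intros)
      show "ap (w (i \<oplus> \<one>)) k = ap (w i) k \<or> L (ap (w (i \<oplus> \<one>)) k) (ap (w i) k)" if "I3 \<preceq> i" for i
      proof -
        have i: "?I \<preceq> i" using le_trans[OF I3(1) that] .
        have "ap (c (i \<oplus> \<one>)) k = ap (c i) k" using I3(2)[OF that] I3(2)[OF suc_le_I[OF that]] by simp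
        then show ?thesis using diff[OF I_le[OF i]] len[OF i] less_irrefl by metis
      qed
    qed blast
    have "S (k \<oplus> \<one>) I4"
      unfolding S_def
    proof (intro conjI allI impI)
      have II4: "I \<preceq> I4" using I_le[OF le_trans[OF I3(1) I4(1)]] .
      then show "I2 \<preceq> I4" by (rule le_trans[OF I2I])
      fix i assume i: "I4 \<preceq> i"
      have "?I \<preceq> i" using le_trans[OF le_trans[OF I3(1) I4(1)] i] .
      from len[OF this] show "k \<oplus> \<one> \<preceq> p1 (c i)" by (simp only: suc_le)
      fix j assume "j \<prec> k \<oplus> \<one>"
      then have "j \<prec> k \<or> j = k" by (simp add: less_suc)
      moreover have "ap (c i) j = ap (c I4) j \<and> ap (w i) j = ap (w I4) j" if j: "j \<prec> k"
      proof -
        have to_I: "ap (c l) j = ap (c I) j \<and> ap (w l) j = ap (w I) j" if "I \<preceq> l" for l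
          using I j that unfolding S_def by blast
        show ?thesis using to_I[OF le_trans[OF II4 i]] to_I[OF II4] by simp
      qed
      moreover have "ap (c i) k = ap (c I4) k" using I3(2)[OF le_trans[OF I4(1) i]] I3(2)[OF I4(1)] by simp
      ultimately show "ap (c i) j = ap (c I4) j" "ap (w i) j = ap (w I4) j" using I4(2)[OF i] by auto
    qed
    then show ?case by blast
  qed
  \<comment> \<open>Position \<open>k\<close> is stable once the first
    \<open>k \<oplus> \<one>\<close> entries are, hence the successor.\<close>
  have "ar (\<lambda>e. S (e 0 \<oplus> \<one>) (e 1))" by (intro ar_intros)
  then obtain N where N: "fn1 N" "\<And>k. S (k \<oplus> \<one>) (N k)"
    by (rule definable_choice[of "\<lambda>k I. S (k \<oplus> \<one>) I"]) (use S_ex in blast)+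
  note [ar_intros] = af_sub1[OF N(1)]
  define G where "G k = ap (c (N k)) k" for k
  define f where "f k = ap (w (N k)) k" for k
  have fns': "fn1 G" "fn1 f" unfolding G_def f_def by (intro ar_intros)+
  have lim: "k \<prec> p1 (c i) \<and> ap (c i) k = G k \<and> ap (w i) k = f k \<and> t i = t I2" if "N k \<preceq> i" for i k
  proof -
    have le: "I2 \<preceq> N k" using N(2)[of k] unfolding S_def by (rule conjunct1)
    have "k \<oplus> \<one> \<preceq> p1 (c i) \<and> (\<forall>j. j \<prec> k \<oplus> \<one> \<longrightarrow>
        ap (c i) j = ap (c (N k)) j \<and> ap (w i) j = ap (w (N k)) j)"
      using N(2)[of k] that unfolding S_def by blast
    then have "k \<prec> p1 (c i) \<and> ap (c i) k = ap (c (N k)) k \<and> ap (w i) k = ap (w (N k)) k"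
      by (simp add: suc_le)
    then show ?thesis using I2(2)[OF le_trans[OF le that]] unfolding G_def f_def by simp
  qed
  \<comment> \<open>Each condition on \<open>G\<close> and \<open>f\<close> concerns two positions
    and is inherited from an element at a stage where both are stable.\<close>
  have common: "\<exists>i. N k \<preceq> i \<and> N j \<preceq> i" for k j
    using le_add1[of "N k" "N j"] le_add2[of "N j" "N k"] by blast
  have path: "path (t I2) G"
  proof (intro allI)
    fix k j
    obtain i where i: "N k \<preceq> i" "N j \<preceq> i" using common by blast
    show "Q (t I2) k (G k) j (G j)"
      using elem[of i] lim[OF i(1)] lim[OF i(2)] unfolding felem_def node_def by metis
  qed
  have rank: "L (f j) (f k)" if "rank_rel (t I2) k j" for k j
  proof -
    obtain i where i: "N k \<preceq> i" "N j \<preceq> i" using common by blast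
    show ?thesis
      using elem[of i] lim[OF i(1)] lim[OF i(2)] that unfolding felem_def by metis
  qed
  show False
  proof (cases "t I2" rule: cases_m)
    case zero
    then show False using path Q_zero by simp
  next
    case (suc n)
    \<comment> \<open>The limit \<open>f\<close> ranks the previous tree, which thus has no path;
      \<open>Q_step\<close> then contradicts the path \<open>G\<close>.\<close>
    have "\<nexists>G. fn1 G \<and> path n G"
      using L(3) fns'(2) by (rule no_path_of_ranking) (use rank suc in \<open>auto simp: rank_rel_def\<close>)
    then show False using Q_step[of n] path fns'(1) suc by auto
  qed
qed

section \<open>The order \<open>D\<^sup>T(X)\<close>\<close>

context
  fixes X :: "'a rel"
  assumes X: "coded_linear_order M X"
begin

abbreviation "LX \<equiv> lt X"
abbreviation "FX \<equiv> F (Field X) (lt X)"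

lemma X_linear: "Linear_order X"
  using X by (simp add: coded_linear_order_def)

lemmas LX = slin_lt[OF X_linear]

lemma rel2_X: "rel2 LX"
  by (rule rel2_lt) (use X in \<open>simp add: coded_linear_order_def\<close>)

lemma ar_Field_X: "rel1 (\<lambda>x. x \<in> Field X)"
proof -
  have S: "{pr M x y | x y. (x, y) \<in> X} \<in> Sets M" (is "?S \<in> _")
    using X by (simp add: coded_linear_order_def)
  have "ar (\<lambda>e. \<exists>y. pr M (e 0) y \<in> ?S \<or> pr M y (e 0) \<in> ?S)"
    by (intro ar_intros ar_mem[OF S])
  moreover have "(\<exists>y. pr M x y \<in> ?S \<or> pr M y x \<in> ?S) \<longleftrightarrow> x \<in> Field X" for x
    by (auto simp: Field_def)
  ultimately show ?thesis by (simp only:)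
qed

lemmas ar_LX = ar_sub2[OF rel2_X]
lemmas ar_mem_X = ar_sub1[OF ar_Field_X]
lemmas ar_FX = ar_F[OF rel2_X ar_Field_X]
lemmas ar_inc_X = ar_inc[OF rel2_X]

definition enum_code :: "'a set \<Rightarrow> 'a" where
  "enum_code A = (SOME g. inc LX g \<and> vals g = A)"

text \<open>The isomorphism from \<open>D\<^sup>T(X)\<close> onto the elements over
  \<open>X\<close>: the finite order that underlies \<open>\<sigma>\<close> is replaced by the
  finite suborder in the first component.\<close>

definition D_val :: "'a set \<times> 'a \<Rightarrow> 'a" where
  "D_val p = relabel (ap (enum_code (fst p))) (snd p)"

lemma enum_code:
  assumes "fin M A" "A \<subseteq> Field X"
  shows "inc LX (enum_code A)" "vals (enum_code A) = A"
proof -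
  obtain g where "inc LX g \<and> vals g = A" using inc_exists[OF LX rel2_X assms] by blast
  then have "inc LX (enum_code A) \<and> vals (enum_code A) = A" unfolding enum_code_def by (rule someI)
  then show "inc LX (enum_code A)" "vals (enum_code A) = A" by auto
qed

lemma enum_code_eq: "inc LX g \<Longrightarrow> enum_code (vals g) = g"
  unfolding enum_code_def using inc_unique[OF LX] by (intro some_equality) auto

lemma D_pairs_dil:
  "(A, \<sigma>) \<in> D_pairs M dil X \<longleftrightarrow> fin M A \<and> A \<subseteq> Field X \<and> FN (p1 (enum_code A)) \<sigma> \<and>
    supp \<sigma> = below M (p1 (enum_code A))"
  using fcard_vals[OF LX enum_code(1), of A] enum_code(2)[of A] by (auto simp: D_pairs_def)

lemma ap_inc_mono: "inc LX g \<Longrightarrow> i \<prec> p1 g \<Longrightarrow> j \<prec> p1 g \<Longrightarrow> i \<prec> j \<Longrightarrow> LX (ap g i) (ap g j)"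
  by (auto simp: inc_def)

lemma D_val_F:
  assumes "p \<in> D_pairs M dil X"
  shows "FX (D_val p)"
proof -
  obtain A \<sigma> where p: "p = (A, \<sigma>)" by (cases p)
  have A: "fin M A" "A \<subseteq> Field X" "FN (p1 (enum_code A)) \<sigma>" using assms unfolding p D_pairs_dil by auto
  note e = enum_code[OF A(1,2)]
  have "ap (enum_code A) v \<in> vals (enum_code A)" if "v \<prec> p1 (enum_code A)" for v
    using that by (auto simp: vals_def)
  then show ?thesis
    unfolding p D_val_def fst_conv snd_conv using ap_inc_mono[OF e(1)] A(2) e(2)
    by (intro relabel_F[OF A(3)]) (auto simp: fn1_ap)
qed

text \<open>Both sides are compared over the enumeration of \<open>A \<union> B\<close>. An
  inclusion followed by this enumeration is the enumeration of the smaller set, so relabelling along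
  it turns the transported elements into the values of \<open>D_val\<close>.\<close>

lemma D_less_iff:
  assumes "p \<in> D_pairs M dil X" "q \<in> D_pairs M dil X"
  shows "D_less M dil X p q \<longleftrightarrow> fless LX (D_val p) (D_val q)"
proof -
  obtain A \<sigma> B \<tau> where pq: "p = (A, \<sigma>)" "q = (B, \<tau>)" by (cases p, cases q)
  have A: "fin M A" "A \<subseteq> Field X" "FN (p1 (enum_code A)) \<sigma>" using assms(1) unfolding pq D_pairs_dil by auto
  have B: "fin M B" "B \<subseteq> Field X" "FN (p1 (enum_code B)) \<tau>" using assms(2) unfolding pq D_pairs_dil by auto
  have AB: "fin M (A \<union> B)" "A \<union> B \<subseteq> Field X"
  proof -
    obtain a b where ab: "A = elts M a" "B = elts M b" using A(1) B(1) unfolding fin_def by blast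
    have "{x. x \<in> elts M a \<or> x \<in> elts M b} \<in> Sets M" by (intro comprehension ar_intros)
    moreover obtain k where k: "A \<subseteq> below M k" using A(1) unfolding fin_iff by blast
    moreover obtain l where l: "B \<subseteq> below M l" using B(1) unfolding fin_iff by blast
    have "A \<union> B \<subseteq> below M (k \<oplus> l)"
      using k l less_le_trans[OF _ le_add1[of k l]] less_le_trans[OF _ le_add2[of l k]] by auto
    ultimately show "fin M (A \<union> B)" using ab unfolding fin_iff by (auto simp: Un_def)
  qed (use A B in auto)
  note eA = enum_code[OF A(1,2)] and eB = enum_code[OF B(1,2)] and eC = enum_code[OF AB]
  let ?a = "enum_code A" and ?b = "enum_code B" and ?c = "enum_code (A \<union> B)"
  have c: "fcard M A = p1 ?a" "fcard M B = p1 ?b" "fcard M (A \<union> B) = p1 ?c"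
    using fcard_vals[OF LX] eA eB eC by metis+
  \<comment> \<open>Stated for a subset \<open>S\<close>, to be used for \<open>A\<close> and for
    \<open>B\<close>.\<close>
  have main: "nat_mor M (p1 (enum_code S)) (p1 ?c) (fmap M X S (A \<union> B) (\<lambda>x. x))" (is ?mor)
    "relabel (ap ?c) (act M dil (p1 (enum_code S)) (p1 ?c) (fmap M X S (A \<union> B) (\<lambda>x. x)) \<rho>) = relabel (ap (enum_code S)) \<rho>"
    if S: "fin M S" "S \<subseteq> Field X" "S \<subseteq> A \<union> B" and \<rho>: "FN (p1 (enum_code S)) \<rho>" for S \<rho>
  proof -
    note eS = enum_code[OF S(1,2)]
    let ?s = "enum_code S" and ?f = "fmap M X S (A \<union> B) (\<lambda>x. x)"
    have sub: "vals ?s \<subseteq> vals ?c" using eS eC S(3) by simp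
    show mor: ?mor using fmap_inclusion(1)[OF X_linear eS(1) eC(1) sub] eS(2) eC(2) by simp
    have ap: "ap ?c (?f i) = ap ?s i" if "i \<prec> p1 ?s" for i
      using fmap_inclusion(2)[OF X_linear eS(1) eC(1) sub that] eS(2) eC(2) by simp
    define h where "h = graph_fun (p1 ?s) ?f"
    note h = graph_fun[OF mor, folded h_def]
    have "act M dil (p1 ?s) (p1 ?c) ?f \<rho> = relabel h \<rho>" by (rule act_dil[OF mor \<rho>]) (rule h)
    then have "relabel (ap ?c) (act M dil (p1 ?s) (p1 ?c) ?f \<rho>) = relabel (\<lambda>v. ap ?c (h v)) \<rho>"
      using relabel_comp[OF \<rho> h(1)] by simp
    also have "\<dots> = relabel (ap ?s) \<rho>"
      using \<rho> by (rule relabel_cong) (use F_supp[OF \<rho>] h(2) ap in auto)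
    finally show "relabel (ap ?c) (act M dil (p1 ?s) (p1 ?c) ?f \<rho>) = relabel (ap ?s) \<rho>" .
  qed
  have Asub: "A \<subseteq> A \<union> B" and Bsub: "B \<subseteq> A \<union> B" by auto
  note mA = main[OF A(1,2) Asub A(3)] and mB = main[OF B(1,2) Bsub B(3)]
  let ?u = "act M dil (p1 ?a) (p1 ?c) (fmap M X A (A \<union> B) (\<lambda>x. x)) \<sigma>"
  let ?v = "act M dil (p1 ?b) (p1 ?c) (fmap M X B (A \<union> B) (\<lambda>x. x)) \<tau>"
  have F: "FN (p1 ?c) ?u" "FN (p1 ?c) ?v" using act_dil_F mA(1) A(3) mB(1) B(3) by blast+
  have "D_less M dil X p q \<longleftrightarrow> fless (Less M) ?u ?v"
    using F by (simp add: D_less_def pq lt_dil c)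
  also have "\<dots> \<longleftrightarrow> fless LX (relabel (ap ?c) ?u) (relabel (ap ?c) ?v)"
    using ap_inc_mono[OF eC(1)] by (intro relabel_less_iff[OF slin_less LX F fn1_ap, symmetric]) simp
  finally show ?thesis unfolding mA mB pq D_val_def by simp
qed

lemma D_val_surj:
  assumes "FX u"
  obtains g \<sigma> where "inc LX g" "vals g \<subseteq> Field X" "FN (p1 g) \<sigma>" "supp \<sigma> = below M (p1 g)" "u = relabel (ap g) \<sigma>"
proof -
  obtain g where g: "inc LX g" "vals g = supp u"
    using inc_exists[OF LX rel2_X fin_supp[OF assms] F_supp[OF assms]] .
  show ?thesis
    by (rule decompose[OF LX assms g]) (use that g F_supp[OF assms] in auto)
qed

lemma D_pairs_intro:
  assumes "inc LX g" "vals g \<subseteq> Field X" "FN (p1 g) \<sigma>" "supp \<sigma> = below M (p1 g)"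
  shows "(vals g, \<sigma>) \<in> D_pairs M dil X" "D_val (vals g, \<sigma>) = relabel (ap g) \<sigma>"
  using assms fin_vals by (auto simp: D_pairs_dil enum_code_eq D_val_def)

lemma D_code_inj:
  "p \<in> D_pairs M dil X \<Longrightarrow> q \<in> D_pairs M dil X \<Longrightarrow> D_code M p = D_code M q \<Longrightarrow> p = q"
  using fcode_inj by (cases p, cases q) (auto simp: D_code_def D_pairs_def)

lemma D_ord_iff:
  assumes "p \<in> D_pairs M dil X" "q \<in> D_pairs M dil X"
  shows "(D_code M p, D_code M q) \<in> D_ord M dil X \<longleftrightarrow> p = q \<or> fless LX (D_val p) (D_val q)"
  using assms D_code_inj D_less_iff unfolding D_ord_def by blast

lemma fless_irrefl_X: "\<not> fless LX u u"
  using slin_irrefl[OF slin_fless[OF LX]] .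

lemma well_founded_D:
  assumes wf: "well_founded M X"
  shows "well_founded M (D_ord M dil X)"
  unfolding well_founded_def
proof
  note [ar_intros] = ar_inc_X
  assume "\<exists>s. {pr M i (s i) | i. True} \<in> Sets M \<and> (\<forall>i. lt (D_ord M dil X) (s (i \<oplus> \<one>)) (s i))"
  then obtain s where s: "fn1 s" "\<And>i. lt (D_ord M dil X) (s (i \<oplus> \<one>)) (s i)"
    using fn1_coded by blast
  note [ar_intros] = af_sub1[OF s(1)]
  have "\<exists>p. p \<in> D_pairs M dil X \<and> s i = D_code M p" for i
    using s(2)[of i] unfolding lt_def D_ord_def by blast
  then obtain P where P: "\<And>i. P i \<in> D_pairs M dil X" "\<And>i. s i = D_code M (P i)" by metis
  have less: "fless LX (D_val (P (i \<oplus> \<one>))) (D_val (P i))" for i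
    using s(2)[of i] D_ord_iff[OF P(1) P(1)] unfolding lt_def P(2) by auto
  \<comment> \<open>\<open>P\<close> and \<open>enum_code\<close> come from choice operators and
    give no definition. \<open>R\<close> describes the same values from the coded sequence
    \<open>s\<close>, through an increasing sequence whose values have the given code.\<close>
  define R where "R i v \<longleftrightarrow> (\<exists>g. inc LX g \<and> fcode M (vals g) = p1 (s i) \<and> v = relabel (ap g) (p2 (s i)))" for i v
  have R: "R i v \<longleftrightarrow> v = D_val (P i)" for i v
  proof -
    obtain A \<sigma> where p: "P i = (A, \<sigma>)" by (cases "P i")
    have A: "fin M A" "A \<subseteq> Field X" using P(1)[of i] unfolding p D_pairs_dil by auto
    have s_eq: "p1 (s i) = fcode M A" "p2 (s i) = \<sigma>" by (simp_all add: P(2) p D_code_def)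
    have "inc LX g \<and> fcode M (vals g) = fcode M A \<longleftrightarrow> g = enum_code A" for g
      using enum_code[OF A] enum_code_eq[of g] fcode_inj[OF fin_vals A(1), of g] by metis
    then show ?thesis unfolding R_def s_eq D_val_def p conj_assoc[symmetric] by simp
  qed
  have R_ar: "rel2 R" unfolding R_def by (intro ar_intros)
  have "af (\<lambda>e. D_val (P (e 0)))"
    unfolding af_def R[symmetric] by (intro ar_sub2[OF R_ar] ar_intros)
  moreover have "minimal_principle LX" using well_founded_minimal[OF wf rel2_X] .
  ultimately show False
    using F_no_descent[OF LX rel2_X, of "\<lambda>i. D_val (P i)"] D_val_F[OF P(1)] less by blast
qed

end

lemma coded_normal_dilator_dil: "coded_normal_dilator M dil"
  unfolding coded_normal_dilator_def coded_dilator_def coded_well_order_def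
  using coded_praedilator_dil normality_dil well_founded_D by blast

section \<open>Fixed points\<close>

text \<open>That no tree has a path is not an arithmetical statement, but that the
  \<open>n\<close>-th function ranks the \<open>n\<close>-th tree in \<open>X\<close> is one. So
  ordinary induction produces all rank functions, and well-foundedness of \<open>X\<close> is
  applied only at the end, to a single tree.\<close>

lemma no_path_of_fixed_point:
  assumes fp: "fixed_point M dil X \<xi>" and wf: "well_founded M X"
  shows "\<nexists>G. fn1 G \<and> path n G"
proof -
  have X: "coded_linear_order M X" and emb: "order_embedding (D_ord M dil X) X \<xi>"
    and \<Xi>: "{pr M p (\<xi> p) | p. p \<in> Field (D_ord M dil X)} \<in> Sets M" (is "?\<Xi> \<in> _")
    using fp by (auto simp: fixed_point_def)
  let ?L = "lt X" and ?F = "F (Field X) (lt X)"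
  note L = LX[OF X] rel2_X[OF X]
  note [ar_intros] = ar_inc_X[OF X] ar_FX[OF X] ar_mem[OF \<Xi>] ar_mem_X[OF X] ar_LX[OF X]
  note min = well_founded_minimal[OF wf L(2)]
  have code_Field: "D_code M p \<in> Field (D_ord M dil X)" if "p \<in> D_pairs M dil X" for p
    using D_ord_iff[OF X that that] by (auto simp: Field_def)
  \<comment> \<open>\<open>\<zeta>\<close> will be \<open>\<xi>\<close> transported to elements over
    \<open>X\<close>. The pair that represents \<open>u\<close> is expressed by codes to keep
    \<open>R\<close> definable, and \<open>R\<close> is trivial for other numbers, so that a total
    choice is possible.\<close>
  define R where "R u v \<longleftrightarrow> (?F u \<longrightarrow> (\<exists>g \<sigma>. inc ?L g \<and> (\<forall>i. i \<prec> p1 g \<longrightarrow> ap g i \<in> Field X) \<and> FN (p1 g) \<sigma> \<and>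
    (\<forall>v. v \<in> supp \<sigma> \<longleftrightarrow> v \<prec> p1 g) \<and> u = relabel (ap g) \<sigma> \<and> pr M (pr M (fcode M (vals g)) \<sigma>) v \<in> ?\<Xi>))" for u v
  have R_ar: "rel2 R" unfolding R_def by (intro ar_intros)
  have R_ex: "\<exists>v. R u v" for u
  proof (cases "?F u")
    case True
    obtain g \<sigma> where g: "inc ?L g" "vals g \<subseteq> Field X" "FN (p1 g) \<sigma>" "supp \<sigma> = below M (p1 g)" "u = relabel (ap g) \<sigma>"
      using D_val_surj[OF X True] .
    have "pr M (D_code M (vals g, \<sigma>)) (\<xi> (D_code M (vals g, \<sigma>))) \<in> ?\<Xi>"
      using code_Field[OF D_pairs_intro(1)[OF X g(1-4)]] by blast
    then have "pr M (pr M (fcode M (vals g)) \<sigma>) (\<xi> (D_code M (vals g, \<sigma>))) \<in> ?\<Xi>"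
      by (simp only: D_code_def fst_conv snd_conv)
    moreover have "\<forall>i. i \<prec> p1 g \<longrightarrow> ap g i \<in> Field X" using g(2) by (auto simp: vals_def)
    moreover have "\<forall>v. v \<in> supp \<sigma> \<longleftrightarrow> v \<prec> p1 g" using g(4) by simp
    ultimately show ?thesis unfolding R_def using g(1,3,5) by blast
  qed (simp add: R_def)
  obtain \<zeta> where \<zeta>: "fn1 \<zeta>" "\<And>u. R u (\<zeta> u)" using R_ar R_ex by (rule definable_choice[of R]) blast
  have \<zeta>_eq: "\<exists>p\<in>D_pairs M dil X. D_val X p = u \<and> \<zeta> u = \<xi> (D_code M p)" if u: "?F u" for u
  proof -
    obtain g \<sigma> where g: "inc ?L g" "\<forall>i. i \<prec> p1 g \<longrightarrow> ap g i \<in> Field X" "FN (p1 g) \<sigma>"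
      "\<forall>v. v \<in> supp \<sigma> \<longleftrightarrow> v \<prec> p1 g" "u = relabel (ap g) \<sigma>" "pr M (pr M (fcode M (vals g)) \<sigma>) (\<zeta> u) \<in> ?\<Xi>"
      using \<zeta>(2)[of u, unfolded R_def, THEN mp, OF u] by (elim exE conjE) (rule that)
    have "vals g \<subseteq> Field X" using g(2) by (auto simp: vals_def)
    moreover have "supp \<sigma> = below M (p1 g)" by (rule set_eqI) (simp add: g(4))
    ultimately have "(vals g, \<sigma>) \<in> D_pairs M dil X" "D_val X (vals g, \<sigma>) = u"
      using D_pairs_intro[OF X g(1) _ g(3)] g(5) by auto
    moreover have "\<zeta> u = \<xi> (D_code M (vals g, \<sigma>))" using g(6) by (auto simp: D_code_def)
    ultimately show ?thesis by blast
  qed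
  have \<zeta>_Field: "\<zeta> u \<in> Field X" if "?F u" for u
    using \<zeta>_eq[OF that] code_Field emb unfolding order_embedding_def by auto
  have \<zeta>_mono: "?L (\<zeta> u) (\<zeta> v)" if uv: "?F u" "?F v" "fless ?L u v" for u v
  proof -
    obtain p where p: "p \<in> D_pairs M dil X" "D_val X p = u" "\<zeta> u = \<xi> (D_code M p)" using \<zeta>_eq[OF uv(1)] by blast
    obtain q where q: "q \<in> D_pairs M dil X" "D_val X q = v" "\<zeta> v = \<xi> (D_code M q)" using \<zeta>_eq[OF uv(2)] by blast
    have e: "(D_code M a, D_code M b) \<in> D_ord M dil X \<longleftrightarrow> (\<xi> (D_code M a), \<xi> (D_code M b)) \<in> X"
      if "a \<in> D_pairs M dil X" "b \<in> D_pairs M dil X" for a b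
      using emb code_Field that unfolding order_embedding_def by blast
    have "(\<zeta> u, \<zeta> v) \<in> X" using e[OF p(1) q(1)] D_ord_iff[OF X p(1) q(1)] uv(3) p q by simp
    moreover have "(\<zeta> v, \<zeta> u) \<notin> X"
    proof
      assume "(\<zeta> v, \<zeta> u) \<in> X"
      then have "q = p \<or> fless ?L v u" using e[OF q(1) p(1)] D_ord_iff[OF X q(1) p(1)] p q by simp
      then have "fless ?L u u" using uv(3) p(2) q(2) slin_trans[OF slin_fless[OF L(1)]] by auto
      then show False using fless_irrefl_X[OF X] by blast
    qed
    ultimately show ?thesis by (auto simp: lt_def)
  qed
  note [ar_intros] = af_sub1[OF \<zeta>(1)]
  \<comment> \<open>Numbers that are not nodes are replaced by the root, so that every argument
    yields an attempt.\<close>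
  define c' where "c' n c = (if node (n \<oplus> \<one>) c then c else root)" for n c
  have [ar_intros]: "af (\<lambda>e. c' (s e) (t e))" if "af s" "af t" for s t
    by (rule af_sub2[OF _ that]) (unfold c'_def, intro ar_intros)
  \<comment> \<open>The attempt assigned to \<open>c\<close>, given a table \<open>v\<close> of the
    previous rank function: its bound is the value at the root, and its ranks are the first entries
    of the table.\<close>
  define U where "U n v c = el (n \<oplus> \<one>) (c' n c) (ap v root) (seq (p1 (c' n c)) (ap v))" for n v c
  have [ar_intros]: "af (\<lambda>e. U (s e) (t e) (u e))" if "af s" "af t" "af u" for s t u
    by (rule af_sub3[OF _ that]) (unfold U_def, intro ar_intros)
  \<comment> \<open>Such a table contains \<open>b\<close> and the code of the root, and with any
    argument also all numbers below the length of the corresponding node, by \<open>p1_le\<close>.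
    Hence it can be computed from the previous table of the same size.\<close>
  define len where "len b = b \<oplus> (root \<oplus> \<one>)" for b
  have [ar_intros]: "af (\<lambda>e. len (s e))" if "af s" for s
    unfolding len_def by (intro ar_intros that)
  obtain H where H: "fn2 H" "\<And>b. H b \<zero> = seq (len b) (\<lambda>_. \<zeta> bot)"
    "\<And>b n. H b (n \<oplus> \<one>) = seq (len b) (\<lambda>c. \<zeta> (U n (H b n) c))"
  proof (rule recursion[of "\<lambda>b. seq (len b) (\<lambda>_. \<zeta> bot)" "\<lambda>b n v. seq (len b) (\<lambda>c. \<zeta> (U n v c))"])
    show "fn1 (\<lambda>b. seq (len b) (\<lambda>_. \<zeta> bot))" by (intro ar_intros)
    show "fn3 (\<lambda>b n v. seq (len b) (\<lambda>c. \<zeta> (U n v c)))" by (intro ar_intros)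
  qed blast
  note [ar_intros] = af_sub2[OF H(1)]
  have root_len: "root \<prec> len b" for b
    unfolding len_def using less_le_trans[OF less_suc_self le_add2] by blast
  have self_len: "b \<prec> len b" for b
  proof -
    have "b \<prec> b \<oplus> \<one>" by simp
    also have "b \<oplus> \<one> \<preceq> b \<oplus> root \<oplus> \<one>" by (intro add_le_mono le_add1) simp
    finally show ?thesis by (simp add: len_def add_assoc)
  qed
  have c'_len: "i \<prec> len b" if "c \<prec> len b" "i \<prec> p1 (c' n c)" for b c n i
  proof -
    have "c' n c \<prec> len b" using that(1) root_len by (simp add: c'_def)
    then show ?thesis using less_le_trans[OF that(2) p1_le] less_trans by blast
  qed
  have H0: "ap (H b \<zero>) c = \<zeta> bot" if "c \<prec> len b" for b c
  proof -
    have "fn1 (\<lambda>_. \<zeta> bot)" by (intro ar_intros)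
    from ap_seq_fn1[OF this that] show ?thesis by (simp only: H(2))
  qed
  have HS: "ap (H b (n \<oplus> \<one>)) c = \<zeta> (U n (H b n) c)" if "c \<prec> len b" for b c n
  proof -
    have "fn1 (\<lambda>c. \<zeta> (U n (H b n) c))" by (intro ar_intros)
    from ap_seq_fn1[OF this that] show ?thesis by (simp only: H(3))
  qed
  \<comment> \<open>The entry at \<open>c\<close> consults only places that belong to both tables,
    by \<open>c'_len\<close>. Therefore the tables fit together to a single function for each
    \<open>n\<close>.\<close>
  have H_indep: "ap (H b n) c = ap (H d n) c" if "c \<prec> len b" "c \<prec> len d" for b d n c
  proof -
    have "\<forall>c. c \<prec> len b \<and> c \<prec> len d \<longrightarrow> ap (H b n) c = ap (H d n) c"
    proof (induction n rule: m_induct)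
      show "ar (\<lambda>e. \<forall>c. c \<prec> len b \<and> c \<prec> len d \<longrightarrow> ap (H b (e 0)) c = ap (H d (e 0)) c)"
        by (intro ar_intros)
    next
      case zero
      then show ?case using H0 by simp
    next
      case (suc n)
      show ?case
      proof (intro allI impI)
        fix c assume c: "c \<prec> len b \<and> c \<prec> len d"
        have "ap (H b n) root = ap (H d n) root" using suc root_len by blast
        moreover have "seq (p1 (c' n c)) (ap (H b n)) = seq (p1 (c' n c)) (ap (H d n))"
          by (rule seq_cong) (use suc c c'_len in blast)
        ultimately have "U n (H b n) c = U n (H d n) c" by (simp add: U_def)
        then show "ap (H b (n \<oplus> \<one>)) c = ap (H d (n \<oplus> \<one>)) c" using HS c by simp
      qed
    qed
    with that show ?thesis by blast
  qed
  define f where "f n c = ap (H c n) c" for n c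
  have f_fn: "fn2 f" unfolding f_def by (intro ar_intros)
  note [ar_intros] = af_sub2[OF f_fn]
  have fH: "f n c = ap (H b n) c" if "c \<prec> len b" for n c b
    unfolding f_def using H_indep[OF self_len that] .
  define V where "V n c = el (n \<oplus> \<one>) (c' n c) (f n root) (seq (p1 (c' n c)) (f n))" for n c
  have f0: "f \<zero> c = \<zeta> bot" for c using H0[OF self_len] by (simp add: f_def)
  have fS: "f (n \<oplus> \<one>) c = \<zeta> (V n c)" for n c
  proof -
    have "f n root = ap (H c n) root" using fH[OF root_len] .
    moreover have "seq (p1 (c' n c)) (f n) = seq (p1 (c' n c)) (ap (H c n))"
      by (rule seq_cong) (use fH c'_len[OF self_len] in blast)
    ultimately have "V n c = U n (H c n) c" by (simp add: V_def U_def)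
    then show ?thesis using HS[OF self_len] by (simp add: f_def)
  qed
  have f_fn1: "fn1 (f n)" for n by (intro ar_intros)
  \<comment> \<open>Membership in \<open>X\<close> and the bound by the root value are claimed for
    all numbers, because an attempt also lists values at numbers that are not nodes.\<close>
  have inv: "(\<forall>c. f n c \<in> Field X \<and> (?L (f n c) (f n root) \<or> f n c = f n root)) \<and>
    (\<forall>i j. node n i \<and> node n j \<and> ext i j \<longrightarrow> ?L (f n j) (f n i))" for n
  proof (induction n rule: m_induct)
    show "ar (\<lambda>e. (\<forall>c. f (e 0) c \<in> Field X \<and> (?L (f (e 0) c) (f (e 0) root) \<or> f (e 0) c = f (e 0) root)) \<and>
      (\<forall>i j. node (e 0) i \<and> node (e 0) j \<and> ext i j \<longrightarrow> ?L (f (e 0) j) (f (e 0) i)))"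
      by (intro ar_intros)
  next
    case zero
    \<comment> \<open>The constant function ranks the first tree since a single node has no proper
      extension.\<close>
    have "\<not> ext i j" if "node \<zero> i" "node \<zero> j" for i j
      using node_zero[OF that(1)] node_zero[OF that(2)] by (simp add: ext_def)
    then show ?case using \<zeta>_Field[of bot] by (auto simp: f0)
  next
    case (suc n)
    then have IH: "\<And>c. f n c \<in> Field X" "\<And>c. ?L (f n c) (f n root) \<or> f n c = f n root"
      "\<And>i j. node n i \<Longrightarrow> node n j \<Longrightarrow> ext i j \<Longrightarrow> ?L (f n j) (f n i)" by blast+
    have c'_node: "node (n \<oplus> \<one>) (c' n c)" for c by (simp add: c'_def)
    \<comment> \<open>The parts of the invariant are what \<open>felem\<close> demands: ranks in
      \<open>X\<close>, below the bound, and descending along the previous tree.\<close>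
    have VF: "?F (V n c)" for c
      unfolding V_def F_el felem_def using c'_node IH f_fn1 by (simp add: rank_rel_def)
    \<comment> \<open>Both lists of ranks restrict the same function, so they agree as far as the
      shorter node reaches, and the longer one is smaller as a proper extension.\<close>
    have kb_ext: "kb ?L d (seq (p1 d) (f n)) c (seq (p1 c) (f n))" if "ext c d" for c d
      unfolding kb_def using that f_fn1 less_trans
      by (intro exI[of _ "p1 c"]) (auto simp: ext_def)
    have V_ext: "?L (f (n \<oplus> \<one>) d) (f (n \<oplus> \<one>) c)" if "ext (c' n c) (c' n d)" for c d
      unfolding fS using kb_ext[OF that] by (intro \<zeta>_mono VF) (simp add: V_def)
    show ?case
    proof (intro conjI allI impI)
      fix c
      show "f (n \<oplus> \<one>) c \<in> Field X" unfolding fS using \<zeta>_Field[OF VF] .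
      have r: "c' n root = root" by (simp add: c'_def)
      show "?L (f (n \<oplus> \<one>) c) (f (n \<oplus> \<one>) root) \<or> f (n \<oplus> \<one>) c = f (n \<oplus> \<one>) root"
      proof (cases "p1 (c' n c) = \<zero>")
        case True
        then have "c' n c = root" using c'_node isseq_zero by (auto simp: node_def)
        then show ?thesis by (simp add: fS V_def r)
      next
        case False
        \<comment> \<open>Every other node properly extends the root, which therefore has the
          largest rank; this restores the bound for the next stage.\<close>
        then have "ext (c' n root) (c' n c)" by (simp add: r ext_def neq_zero)
        then show ?thesis using V_ext by blast
      qed
    next
      fix i j assume "node (n \<oplus> \<one>) i \<and> node (n \<oplus> \<one>) j \<and> ext i j"
      then show "?L (f (n \<oplus> \<one>) j) (f (n \<oplus> \<one>) i)" by (intro V_ext) (simp add: c'_def)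
    qed
  qed
  show ?thesis using min f_fn1 by (rule no_path_of_ranking) (use inv in blast)
qed

end

theorem theorem3p14:
  fixes M :: "'a l2_structure"
  assumes "models_ACA0 M"
    and "\<And>T. coded_normal_dilator M T \<Longrightarrow> \<exists>X \<xi>. fixed_point M T X \<xi> \<and> well_founded M X"
  shows "\<forall>\<phi> v. Pi11 \<phi> \<longrightarrow> holds_induction M \<phi> v"
proof (intro allI impI)
  interpret aca0 M by (unfold_locales) (rule assms(1))
  fix \<phi> v assume \<phi>: "Pi11 \<phi>"
  show "holds_induction M \<phi> v"
    unfolding holds_induction_def
  proof (intro allI impI, elim conjE)
    fix e E n
    assume E: "range E \<subseteq> Sets M" and zero: "l2_sat M (e(v := \<zero>)) E \<phi>"
      and step: "\<forall>n. l2_sat M (e(v := n)) E \<phi> \<longrightarrow> l2_sat M (e(v := n \<oplus> \<one>)) E \<phi>"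
    obtain Q where Q: "ar (\<lambda>e. Q (e 0) (e 1) (e 2) (e 3) (e 4))"
      "\<forall>n. l2_sat M (e(v := n)) E \<phi> \<longleftrightarrow> \<not> (\<exists>G. fn1 G \<and> (\<forall>x i. Q n x (G x) i (G i)))"
      using Pi11_normal_form[OF \<phi> E, of e v] by (elim exE conjE) (rule that)
    \<comment> \<open>The shift by one makes room for the tree without proper nodes at
      \<open>\<zero>\<close>.\<close>
    define Q' where "Q' m x a i b \<longleftrightarrow> (\<exists>n. m = n \<oplus> \<one> \<and> Q n x a i b)" for m x a i b
    have Q'_suc: "Q' (n \<oplus> \<one>) x a i b \<longleftrightarrow> Q n x a i b" for n x a i b by (simp add: Q'_def)
    interpret wf_step M Q'
    proof
      show "ar (\<lambda>e. Q' (e 0) (e 1) (e 2) (e 3) (e 4))"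
        unfolding Q'_def by (intro ar_intros ar_sub5[OF Q(1)])
      show "\<not> Q' \<zero> x a i b" for x a i b by (simp add: Q'_def)
      show "\<nexists>G. fn1 G \<and> (\<forall>x i. Q' (n \<oplus> \<one>) x (G x) i (G i))"
        if "\<nexists>G. fn1 G \<and> (\<forall>x i. Q' n x (G x) i (G i))" for n
      \<comment> \<open>Because of the shift, the base of the induction is the step from the trivial
        tree, and the induction step covers the successors.\<close>
      proof (cases n rule: cases_m)
        case zero
        then show ?thesis using \<open>l2_sat M (e(v := \<zero>)) E \<phi>\<close> Q(2) unfolding Q'_suc by blast
      next
        case (suc m)
        then have "l2_sat M (e(v := m)) E \<phi>" using that Q(2) unfolding suc Q'_suc by blast
        then have "l2_sat M (e(v := n)) E \<phi>" using step suc by blast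
        then show ?thesis using Q(2) unfolding Q'_suc by blast
      qed
    qed
    obtain X \<xi> where "fixed_point M dil X \<xi>" "well_founded M X"
      using assms(2)[OF coded_normal_dilator_dil] by blast
    then have "\<nexists>G. fn1 G \<and> (\<forall>x i. Q' (n \<oplus> \<one>) x (G x) i (G i))" by (rule no_path_of_fixed_point)
    then show "l2_sat M (e(v := n)) E \<phi>" unfolding Q'_suc using Q(2) by blast
  qed
qed

end
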